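(* Let $1\le N\le3$, $a_1,a_2>0$, $\beta>\max\{a_1,a_2\}$, and let $V_1,V_2$ be continuous with $\liminf_{|x|\to\infty}V_i(x)>\mu=\inf_{\mathbb{R}^N}V_i>0$ ($i=1,2$) and $\{x:V_1(x)=V_2(x)=\mu\}\neq\emptyset$. Then for $\varepsilon>0$ small enough, $(S_\varepsilon)$ has at least one nonnegative ground state.
   Context: $(S_\varepsilon)$: $-\varepsilon^2\Delta u_1+V_1u_1=a_1u_1^3+\beta u_2^2u_1$, $-\varepsilon^2\Delta u_2+V_2u_2=a_2u_2^3+\beta u_1^2u_2$ in $\mathbb{R}^N$. $\mathcal X_\varepsilon$: pairs with $u_i\in H^1$, $\int V_iu_i^2<\infty$, $\|(u_1,u_2)\|^2_{\mathcal X_\varepsilon}=\sum_i\int(\varepsilon^2|\nabla u_i|^2+V_iu_i^2)$. $B(u_1,u_2)=\int(a_1u_1^4+a_2u_2^4+2\beta u_1^2u_2^2)$, $J_\varepsilon=\frac12\|\cdot\|^2_{\mathcal X_\varepsilon}-\frac14B$, $\mathcal N_\varepsilon=\{(u_1,u_2)\in\mathcal X_\varepsilon\setminus\{0\}:\|(u_1,u_2)\|^2_{\mathcal X_\varepsilon}=B(u_1,u_2)\}$, $c_\varepsilon=\inf_{\mathcal N_\varepsilon}J_\varepsilon$; a ground state is a critical point of $J_\varepsilon$ in $\mathcal X_\varepsilon$ with $J_\varepsilon=c_\varepsilon$. *)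

theory Defs
  imports "HOL-Analysis.Analysis"
begin

definition partial_deriv :: "'n::finite \<Rightarrow> (real^'n \<Rightarrow> real) \<Rightarrow> real^'n \<Rightarrow> real" where
  "partial_deriv i f x = frechet_derivative f (at x) (axis i 1)"

fun iter_partial :: "'n::finite list \<Rightarrow> (real^'n \<Rightarrow> real) \<Rightarrow> real^'n \<Rightarrow> real" where
  "iter_partial [] f = f"
| "iter_partial (i # is) f = partial_deriv i (iter_partial is f)"

definition test_fun :: "(real^'n::finite \<Rightarrow> real) \<Rightarrow> bool" where
  "test_fun \<phi> \<longleftrightarrow> (\<forall>is. (iter_partial is \<phi>) differentiable_on UNIV)
      \<and> compact (closure {x. \<phi> x \<noteq> 0})"

definition L2fun :: "(real^'n::finite \<Rightarrow> real) \<Rightarrow> bool" where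
  "L2fun u \<longleftrightarrow> u \<in> borel_measurable lborel \<and> integrable lborel (\<lambda>x. (u x)^2)"

definition is_weak_grad :: "(real^'n::finite \<Rightarrow> real) \<Rightarrow> (real^'n \<Rightarrow> real^'n) \<Rightarrow> bool" where
  "is_weak_grad u G \<longleftrightarrow> L2fun u \<and> (\<forall>i. L2fun (\<lambda>x. G x $ i)) \<and>
     (\<forall>\<phi> i. test_fun \<phi> \<longrightarrow>
        (\<integral>x. u x * partial_deriv i \<phi> x \<partial>lborel) = - (\<integral>x. G x $ i * \<phi> x \<partial>lborel))"

definition H1 :: "(real^'n::finite \<Rightarrow> real) \<Rightarrow> bool" where
  "H1 u \<longleftrightarrow> (\<exists>G. is_weak_grad u G)"

definition wgrad :: "(real^'n::finite \<Rightarrow> real) \<Rightarrow> real^'n \<Rightarrow> real^'n" where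
  "wgrad u = (SOME G. is_weak_grad u G)"

text \<open>The space X_eps (as a set; it does not depend on eps).\<close>
definition Xsp :: "(real^'n::finite \<Rightarrow> real) \<Rightarrow> (real^'n \<Rightarrow> real) \<Rightarrow>
    ((real^'n \<Rightarrow> real) \<times> (real^'n \<Rightarrow> real)) set" where
  "Xsp V1 V2 = {(u1, u2). H1 u1 \<and> H1 u2 \<and>
      integrable lborel (\<lambda>x. V1 x * (u1 x)^2) \<and> integrable lborel (\<lambda>x. V2 x * (u2 x)^2)}"

definition Xnormsq :: "real \<Rightarrow> (real^'n::finite \<Rightarrow> real) \<Rightarrow> (real^'n \<Rightarrow> real) \<Rightarrow>
    (real^'n \<Rightarrow> real) \<times> (real^'n \<Rightarrow> real) \<Rightarrow> real" where
  "Xnormsq \<epsilon> V1 V2 u =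
     (\<integral>x. \<epsilon>^2 * (norm (wgrad (fst u) x))^2 + V1 x * (fst u x)^2 \<partial>lborel)
   + (\<integral>x. \<epsilon>^2 * (norm (wgrad (snd u) x))^2 + V2 x * (snd u x)^2 \<partial>lborel)"

definition Bfun :: "real \<Rightarrow> real \<Rightarrow> real \<Rightarrow> (real^'n::finite \<Rightarrow> real) \<times> (real^'n \<Rightarrow> real) \<Rightarrow> real" where
  "Bfun a1 a2 \<beta> u =
     (\<integral>x. a1 * (fst u x)^4 + a2 * (snd u x)^4 + 2 * \<beta> * (fst u x)^2 * (snd u x)^2 \<partial>lborel)"

definition Jfun :: "real \<Rightarrow> (real^'n::finite \<Rightarrow> real) \<Rightarrow> (real^'n \<Rightarrow> real) \<Rightarrow> real \<Rightarrow> real \<Rightarrow> real \<Rightarrow>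
    (real^'n \<Rightarrow> real) \<times> (real^'n \<Rightarrow> real) \<Rightarrow> real" where
  "Jfun \<epsilon> V1 V2 a1 a2 \<beta> u = Xnormsq \<epsilon> V1 V2 u / 2 - Bfun a1 a2 \<beta> u / 4"

text \<open>Nehari manifold; "nonzero" is meant in X_eps, i.e. not a.e. zero.\<close>
definition Nehari :: "real \<Rightarrow> (real^'n::finite \<Rightarrow> real) \<Rightarrow> (real^'n \<Rightarrow> real) \<Rightarrow> real \<Rightarrow> real \<Rightarrow> real \<Rightarrow>
    ((real^'n \<Rightarrow> real) \<times> (real^'n \<Rightarrow> real)) set" where
  "Nehari \<epsilon> V1 V2 a1 a2 \<beta> = {u \<in> Xsp V1 V2.
      \<not> (AE x in lborel. fst u x = 0 \<and> snd u x = 0) \<and>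
      Xnormsq \<epsilon> V1 V2 u = Bfun a1 a2 \<beta> u}"

definition c_level :: "real \<Rightarrow> (real^'n::finite \<Rightarrow> real) \<Rightarrow> (real^'n \<Rightarrow> real) \<Rightarrow> real \<Rightarrow> real \<Rightarrow> real \<Rightarrow> real" where
  "c_level \<epsilon> V1 V2 a1 a2 \<beta> = Inf (Jfun \<epsilon> V1 V2 a1 a2 \<beta> ` Nehari \<epsilon> V1 V2 a1 a2 \<beta>)"

definition critical_point :: "real \<Rightarrow> (real^'n::finite \<Rightarrow> real) \<Rightarrow> (real^'n \<Rightarrow> real) \<Rightarrow> real \<Rightarrow> real \<Rightarrow> real \<Rightarrow>
    (real^'n \<Rightarrow> real) \<times> (real^'n \<Rightarrow> real) \<Rightarrow> bool" where
  "critical_point \<epsilon> V1 V2 a1 a2 \<beta> u \<longleftrightarrow> u \<in> Xsp V1 V2 \<and>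
     (\<forall>v \<in> Xsp V1 V2.
        ((\<lambda>t. Jfun \<epsilon> V1 V2 a1 a2 \<beta> (\<lambda>x. fst u x + t * fst v x, \<lambda>x. snd u x + t * snd v x))
           has_real_derivative 0) (at 0))"

definition ground_state :: "real \<Rightarrow> (real^'n::finite \<Rightarrow> real) \<Rightarrow> (real^'n \<Rightarrow> real) \<Rightarrow> real \<Rightarrow> real \<Rightarrow> real \<Rightarrow>
    (real^'n \<Rightarrow> real) \<times> (real^'n \<Rightarrow> real) \<Rightarrow> bool" where
  "ground_state \<epsilon> V1 V2 a1 a2 \<beta> u \<longleftrightarrow> critical_point \<epsilon> V1 V2 a1 a2 \<beta> u \<and>
     Jfun \<epsilon> V1 V2 a1 a2 \<beta> u = c_level \<epsilon> V1 V2 a1 a2 \<beta>"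

end

theory Submission
  imports Defs "HOL-Complex_Analysis.Great_Picard"
begin

text \<open>
  Write \<open>Q\<close> for the squared norm of \<open>X\<^sub>\<epsilon>\<close>. By homogeneity the ground state level is \<open>1 / (4 S)\<close> with
  \<open>S = sup B / Q\<^sup>2\<close>, so it suffices to maximise \<open>B\<close> on the unit sphere. Along a maximising sequence with
  weak limit \<open>z\<close> and remainder \<open>w\<^sub>n \<rightharpoonup> 0\<close>, both \<open>Q\<close> and \<open>B\<close> split asymptotically. Local compactness lets
  \<open>w\<^sub>n\<close> see only potentials above some constant \<open>m > \<mu>\<close>, so that
  \<open>S \<le> S Q(z)\<^sup>2 + S\<^sub>m (1 - Q(z))\<^sup>2\<close> with \<open>S\<^sub>m\<close> the supremum for the constant potential \<open>m\<close>; if \<open>S\<^sub>m < S\<close> this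
  forces \<open>Q(z) = 1\<close>. The strict inequality holds for small \<open>\<epsilon>\<close>: rescaling a compactly supported near-maximiser
  for \<open>m\<close> around a common minimum point of the potentials gains the factor \<open>(m / \<mu>)\<^bsup>2 - N/2\<^esup> > 1\<close>.

  The Sobolev space theory rests on difference quotients: \<open>u\<close> has a square integrable weak gradient iff
  \<open>\<parallel>u(\<cdot> + s e\<^sub>i) - u\<parallel>\<^sub>2 \<le> C s\<close>, with the sharp constant. This gives \<open>\<bar>u\<bar>\<close>, cut-offs and dilations
  directly, and averaging over dyadic cubes gives Rellich's theorem and the Sobolev inequality.
\<close>

section \<open>The space of square integrable functions\<close>

text \<open>The strict inequality excludes vanishing and splitting at once: with
  \<open>t = Q(z)\<close>, a value t < 1 would give S \<le> S t^2 + S_m (1 - t)^2 < S (t^2 + (1 -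
  t)^2) \<le> S, and t = 0 is included. For a constant potential the substitution x -> \<epsilon> x
  removes \<epsilon> up to a power, so its supremum is studied at \<epsilon> = 1 and the
  near-maximiser is chosen before \<epsilon>. Small \<epsilon> serves one purpose: the rescaled
  support must fit into a ball on which both potentials are close to \<mu>. An extra dilation by
  sqrt(m/\<mu>) makes the energy at level \<mu> equal to \<mu>/m times that at level m, apart from
  the Jacobian; as B is divided by the squared energy, (m/\<mu>)^2 competes with one Jacobian
  (m/\<mu>)^(N/2). Weak gradients are determined only almost everywhere and \<open>wgrad\<close> is
  an arbitrary choice. Difference quotients involve u alone, and their bounds lose no constant: the
  energy of |u| must not exceed that of u, and the cost of a cut-off must tend to zero. The mixed
  terms in the splitting of B need no convergence in L4: a remainder bounded in L4 and tending to 0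
  in L2 on balls suffices.\<close>

definition ip :: "(real^'n::finite \<Rightarrow> real) \<Rightarrow> (real^'n \<Rightarrow> real) \<Rightarrow> real" where
  "ip f g = (\<integral>x. f x * g x \<partial>lborel)"

abbreviation nsq :: "(real^'n::finite \<Rightarrow> real) \<Rightarrow> real" where
  "nsq f \<equiv> ip f f"

lemma L2fun_meas: "L2fun f \<Longrightarrow> f \<in> borel_measurable borel"
  by (simp add: L2fun_def)

lemma L2fun_sq: "L2fun f \<Longrightarrow> integrable lborel (\<lambda>x. (f x)^2)"
  by (simp add: L2fun_def)

lemma abs_mult_le_squares:
  fixes a b :: real
  shows "\<bar>a * b\<bar> \<le> a^2 + b^2"
proof -
  have "2 * (\<bar>a\<bar> * \<bar>b\<bar>) \<le> \<bar>a\<bar>^2 + \<bar>b\<bar>^2"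
    using sum_squares_bound[of "\<bar>a\<bar>" "\<bar>b\<bar>"] by simp
  moreover have "0 \<le> \<bar>a\<bar> * \<bar>b\<bar>" by simp
  ultimately show ?thesis unfolding abs_mult power2_abs by linarith
qed

lemma L2fun_mult_integrable:
  assumes "L2fun f" "L2fun g"
  shows "integrable lborel (\<lambda>x. f x * g x)"
proof (rule Bochner_Integration.integrable_bound)
  show "integrable lborel (\<lambda>x. (f x)^2 + (g x)^2)"
    using assms by (simp add: L2fun_def)
  show "(\<lambda>x. f x * g x) \<in> borel_measurable lborel"
    using assms[THEN L2fun_meas] by measurable
  show "AE x in lborel. norm (f x * g x) \<le> norm ((f x)^2 + (g x)^2)"
    using abs_mult_le_squares by simp
qed

lemma L2fun_lin:
  assumes "L2fun f" "L2fun g"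
  shows "L2fun (\<lambda>x. a * f x + b * g x)"
  unfolding L2fun_def
proof
  show "(\<lambda>x. a * f x + b * g x) \<in> borel_measurable lborel"
    using assms[THEN L2fun_meas] by measurable
  have "integrable lborel (\<lambda>x. a^2 * (f x)^2 + b^2 * (g x)^2 + (2*a*b) * (f x * g x))"
    using assms L2fun_mult_integrable[OF assms] by (simp add: L2fun_def)
  then show "integrable lborel (\<lambda>x. (a * f x + b * g x)\<^sup>2)"
    by (simp add: power2_eq_square algebra_simps)
qed

lemma L2fun_add: "L2fun f \<Longrightarrow> L2fun g \<Longrightarrow> L2fun (\<lambda>x. f x + g x)"
  using L2fun_lin[of f g 1 1] by simp
lemma L2fun_diff: "L2fun f \<Longrightarrow> L2fun g \<Longrightarrow> L2fun (\<lambda>x. f x - g x)"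
  using L2fun_lin[of f g 1 "-1"] by simp
lemma L2fun_scale: "L2fun f \<Longrightarrow> L2fun (\<lambda>x. a * f x)"
  using L2fun_lin[of f f a 0] by simp
lemma L2fun_bound:
  assumes "L2fun g" "f \<in> borel_measurable lborel" "AE x in lborel. \<bar>f x\<bar> \<le> \<bar>g x\<bar>"
  shows "L2fun f"
  unfolding L2fun_def
proof
  show "integrable lborel (\<lambda>x. (f x)\<^sup>2)"
  proof (rule Bochner_Integration.integrable_bound[OF L2fun_sq[OF assms(1)]])
    show "AE x in lborel. norm ((f x)\<^sup>2) \<le> norm ((g x)\<^sup>2)"
      using assms(3) by eventually_elim (simp add: abs_le_square_iff)
  qed (use assms in simp)
qed (use assms in simp)

lemma L2fun_AE_cong:
  assumes "L2fun g" "f \<in> borel_measurable lborel" "AE x in lborel. f x = g x"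
  shows "L2fun f"
  using assms(3) by (intro L2fun_bound[OF assms(1,2)]) auto

lemma ip_commute: "ip f g = ip g f"
  by (simp add: ip_def mult.commute)

lemma ip_lin_left:
  assumes "L2fun f" "L2fun g" "L2fun h"
  shows "ip (\<lambda>x. a * f x + b * g x) h = a * ip f h + b * ip g h"
proof -
  have "ip (\<lambda>x. a * f x + b * g x) h = (\<integral>x. a * (f x * h x) + b * (g x * h x) \<partial>lborel)"
    unfolding ip_def by (rule Bochner_Integration.integral_cong) (auto simp: algebra_simps)
  also have "\<dots> = a * ip f h + b * ip g h"
    unfolding ip_def using L2fun_mult_integrable[OF assms(1,3)] L2fun_mult_integrable[OF assms(2,3)]
    by (subst Bochner_Integration.integral_add) auto
  finally show ?thesis .
qed

lemma ip_diff_left: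
  assumes "L2fun f" "L2fun g" "L2fun h"
  shows "ip (\<lambda>x. f x - g x) h = ip f h - ip g h"
  using ip_lin_left[OF assms, of 1 "-1"] by simp

lemma ip_lin_right:
  assumes "L2fun f" "L2fun g" "L2fun h"
  shows "ip h (\<lambda>x. a * f x + b * g x) = a * ip h f + b * ip h g"
  using ip_lin_left[OF assms] by (simp add: ip_commute)

lemma ip_diff_right:
  assumes "L2fun f" "L2fun g" "L2fun h"
  shows "ip h (\<lambda>x. f x - g x) = ip h f - ip h g"
  using ip_diff_left[OF assms] by (simp add: ip_commute)

lemma ip_lin_sq:
  assumes "L2fun f" "L2fun g"
  shows "nsq (\<lambda>x. a * f x + b * g x) = a^2 * nsq f + 2 * a * b * ip f g + b^2 * nsq g"
  using assms by (simp add: ip_lin_left ip_lin_right L2fun_lin ip_commute[of g f] power2_eq_square algebra_simps)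

lemma ip_diff_sq:
  assumes "L2fun f" "L2fun g"
  shows "nsq (\<lambda>x. f x - g x) = nsq f - 2 * ip f g + nsq g"
  using ip_lin_sq[OF assms, of 1 "-1"] by simp

lemma ip_self: "nsq f = (\<integral>x. (f x)^2 \<partial>lborel)"
  by (simp add: ip_def power2_eq_square)

lemma ip_self_nonneg: "0 \<le> nsq f"
  by (simp add: ip_self)

lemma ip_self_eq_0: "L2fun f \<Longrightarrow> nsq f = 0 \<longleftrightarrow> (AE x in lborel. f x = 0)"
  unfolding ip_self by (subst integral_nonneg_eq_0_iff_AE) (auto simp: L2fun_def)

lemma ip_AE_cong:
  assumes "AE x in lborel. f x = f' x" "AE x in lborel. g x = g' x"
    "f \<in> borel_measurable lborel" "f' \<in> borel_measurable lborel"
    "g \<in> borel_measurable lborel" "g' \<in> borel_measurable lborel"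
  shows "ip f g = ip f' g'"
  unfolding ip_def
proof (rule integral_cong_AE)
  show "AE x in lborel. f x * g x = f' x * g' x"
    using assms(1,2) by eventually_elim simp
qed (use assms in auto)

lemma ip_CS:
  assumes "L2fun f" "L2fun g"
  shows "(ip f g)^2 \<le> nsq f * nsq g"
proof (cases "nsq g = 0")
  case True
  then have "AE x in lborel. g x = 0" using ip_self_eq_0 assms by blast
  then have "ip f g = 0" unfolding ip_def by (intro integral_eq_zero_AE) auto
  then show ?thesis using True by simp
next
  case False
  then have p: "nsq g > 0" using ip_self_nonneg[of g] by linarith
  define t where "t = ip f g / nsq g"
  have "0 \<le> nsq (\<lambda>x. 1 * f x + (-t) * g x)" by (rule ip_self_nonneg)
  also have "\<dots> = nsq f - 2 * t * ip f g + t^2 * nsq g"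
    by (subst ip_lin_sq[OF assms]) simp
  also have "\<dots> = nsq f - (ip f g)^2 / nsq g"
    using False unfolding t_def by (simp add: field_simps power2_eq_square)
  finally show ?thesis using p by (simp add: field_simps)
qed

lemma ip_CS_abs:
  assumes "L2fun f" "L2fun g"
  shows "\<bar>ip f g\<bar> \<le> sqrt (nsq f) * sqrt (nsq g)"
proof -
  have "\<bar>ip f g\<bar> = sqrt ((ip f g)^2)" by simp
  also have "\<dots> \<le> sqrt (nsq f * nsq g)" using ip_CS[OF assms] real_sqrt_le_iff by blast
  finally show ?thesis by (simp add: real_sqrt_mult)
qed

lemma L2_triangle:
  assumes "L2fun f" "L2fun g"
  shows "sqrt (nsq (\<lambda>x. f x + g x)) \<le> sqrt (nsq f) + sqrt (nsq g)"
proof (rule real_le_lsqrt)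
  have "nsq (\<lambda>x. f x + g x) = nsq f + 2 * ip f g + nsq g"
    using ip_lin_sq[OF assms, of 1 1] by simp
  also have "\<dots> \<le> nsq f + 2 * (sqrt (nsq f) * sqrt (nsq g)) + nsq g"
    using ip_CS_abs[OF assms] by linarith
  also have "\<dots> = (sqrt (nsq f) + sqrt (nsq g))^2"
    by (simp add: power2_sum ip_self_nonneg)
  finally show "nsq (\<lambda>x. f x + g x) \<le> (sqrt (nsq f) + sqrt (nsq g))^2" .
qed (simp_all add: ip_self_nonneg)

text \<open>A rapidly Cauchy sequence converges almost everywhere because the integral of
  \<open>\<Sum>k. 2 ^ k * (f (k + 1) - f k)\<^sup>2\<close> is finite; the a.e. limit is the limit in the mean by Fatou.\<close>
lemma L2_complete:
  fixes f :: "nat \<Rightarrow> real^'n::finite \<Rightarrow> real"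
  assumes L2: "\<And>n. L2fun (f n)"
    and cau: "\<And>n m. n \<le> m \<Longrightarrow> nsq (\<lambda>x. f m x - f n x) \<le> \<delta> n"
    and \<delta>: "\<delta> \<longlonglongrightarrow> 0"
  obtains z r where "L2fun z" "strict_mono (r::nat \<Rightarrow> nat)" "AE x in lborel. (\<lambda>k. f (r k) x) \<longlonglongrightarrow> z x"
    "(\<lambda>n. nsq (\<lambda>x. f n x - z x)) \<longlonglongrightarrow> 0"
proof -
  have [measurable]: "f n \<in> borel_measurable borel" for n using L2[of n] by (simp add: L2fun_def)
  have \<delta>0: "0 \<le> \<delta> n" for n using cau[of n n] ip_self_nonneg order_trans by blast
  have ex: "\<exists>n. \<forall>m\<ge>n. \<delta> m \<le> (1/4)^k" for k
    using LIMSEQ_D[OF \<delta>, of "(1/4)^k"] \<delta>0 by (auto simp: eventually_sequentially intro: less_imp_le)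
  define n0 where "n0 k = (SOME n. \<forall>m\<ge>n. \<delta> m \<le> (1/4)^k)" for k
  have n0: "m \<ge> n0 k \<Longrightarrow> \<delta> m \<le> (1/4)^k" for k m
    using someI_ex[OF ex[of k]] unfolding n0_def by blast
  \<comment> \<open>The sum gives \<open>n0 k \<le> r k\<close> and the added \<open>k\<close> makes
    \<open>r\<close> strictly increasing, whatever the order of the values of
    \<open>n0\<close>.\<close>
  define r where "r k = (\<Sum>j\<le>k. n0 j) + k" for k
  have r: "strict_mono r" unfolding r_def strict_mono_Suc_iff by auto
  have rn: "n0 k \<le> r k" for k unfolding r_def by (simp add: trans_le_add1 member_le_sum)
  have d: "nsq (\<lambda>x. f (r (Suc k)) x - f (r k) x) \<le> (1/4)^k" for k
    using cau[of "r k" "r (Suc k)"] n0[OF rn[of k]] strict_mono_less_eq[OF r, of k "Suc k"] by force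
  define D where "D k x = (f (r (Suc k)) x - f (r k) x)^2" for k x
  have Dm[measurable]: "D k \<in> borel_measurable borel" for k unfolding D_def by measurable
  have D0: "0 \<le> D k x" for k x unfolding D_def by simp
  have Dn: "(\<integral>\<^sup>+x. ennreal (D k x) \<partial>lborel) \<le> ennreal ((1/4)^k)" for k
  proof -
    have "integrable lborel (D k)" unfolding D_def
      using L2fun_sq[OF L2fun_diff[OF L2 L2]] by blast
    then have "(\<integral>\<^sup>+x. ennreal (D k x) \<partial>lborel) = ennreal (\<integral>x. D k x \<partial>lborel)"
      by (intro nn_integral_eq_integral) (auto simp: D0)
    also have "\<dots> \<le> ennreal ((1/4)^k)" using d[of k] by (intro ennreal_leI) (simp add: ip_self D_def)
    finally show ?thesis .
  qed
  have "(\<integral>\<^sup>+x. (\<Sum>k. ennreal (2^k * D k x)) \<partial>lborel) = (\<Sum>k. \<integral>\<^sup>+x. ennreal (2^k * D k x) \<partial>lborel)"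
    by (intro nn_integral_suminf) measurable
  also have "\<dots> \<le> (\<Sum>k. ennreal ((1/2)^k))"
  proof (intro suminf_le allI)
    fix k
    have "(\<integral>\<^sup>+x. ennreal (2^k * D k x) \<partial>lborel) = ennreal (2^k) * (\<integral>\<^sup>+x. ennreal (D k x) \<partial>lborel)"
      by (subst nn_integral_cmult[symmetric]) (auto simp: ennreal_mult D0)
    also have "\<dots> \<le> ennreal (2^k) * ennreal ((1/4)^k)" by (intro mult_left_mono Dn) simp
    also have "\<dots> = ennreal ((1/2)^k)"
      by (subst ennreal_mult[symmetric]) (auto simp flip: power_mult_distrib)
    finally show "(\<integral>\<^sup>+x. ennreal (2^k * D k x) \<partial>lborel) \<le> ennreal ((1/2)^k)" .
  qed auto
  also have "\<dots> = ennreal (\<Sum>k. (1/2)^k)" by (intro suminf_ennreal2) auto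
  finally have fin: "(\<integral>\<^sup>+x. (\<Sum>k. ennreal (2^k * D k x)) \<partial>lborel) < \<infinity>"
    by (simp add: top.not_eq_extremum order.strict_trans1)
  have "AE x in lborel. (\<Sum>k. ennreal (2^k * D k x)) \<noteq> \<infinity>"
    using fin by (intro nn_integral_noteq_infinite) auto
  then have conv: "AE x in lborel. convergent (\<lambda>k. f (r k) x)"
  proof eventually_elim
    case (elim x)
    then have sm: "summable (\<lambda>k. 2^k * D k x)"
      by (intro summable_suminf_not_top) (auto simp: D0)
    then have "(\<lambda>k. 2^k * D k x) \<longlonglongrightarrow> 0" by (rule summable_LIMSEQ_zero)
    then have "eventually (\<lambda>k. 2^k * D k x < 1) sequentially"
      by (rule order_tendstoD) simp
    \<comment> \<open>Terms of a convergent series are eventually below 1, so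
      \<open>D k x \<le> (1/2)^k\<close>: the weight \<open>2^k\<close> turns summability of the
      squares into geometric decay of the increments.\<close>
    then have ev: "eventually (\<lambda>k. norm (f (r (Suc k)) x - f (r k) x) \<le> (sqrt (1/2))^k) sequentially"
    proof eventually_elim
      case (elim k)
      have "D k x \<le> (1/2)^k" using elim by (simp add: field_simps)
      then have "sqrt (D k x) \<le> sqrt ((1/2)^k)" by simp
      then show ?case unfolding D_def by (simp add: real_sqrt_power[of "1/2"])
    qed
    have "summable (\<lambda>k. (sqrt (1/2))^k)" by (intro summable_geometric) (auto simp: real_sqrt_divide)
    then have "summable (\<lambda>k. f (r (Suc k)) x - f (r k) x)"
      using ev by (rule summable_comparison_test_ev[rotated])
    then have "convergent (\<lambda>n. \<Sum>k<n. f (r (Suc k)) x - f (r k) x)"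
      by (simp add: summable_iff_convergent)
    then have "convergent (\<lambda>n. f (r n) x - f (r 0) x)" by (simp add: sum_lessThan_telescope[of "\<lambda>k. f (r k) x"])
    then have "convergent (\<lambda>n. (f (r n) x - f (r 0) x) + f (r 0) x)"
      by (intro convergent_add convergent_const)
    then show ?case by simp
  qed
  define z where "z x = lim (\<lambda>k. f (r k) x)" for x
  have zm[measurable]: "z \<in> borel_measurable borel"
    unfolding z_def by measurable
  have zl: "AE x in lborel. (\<lambda>k. f (r k) x) \<longlonglongrightarrow> z x"
    using conv by eventually_elim (simp add: z_def convergent_LIMSEQ_iff)
  have fat: "(\<integral>\<^sup>+x. ennreal ((f n x - z x)^2) \<partial>lborel) \<le> ennreal (\<delta> n)" for n
  proof -
    have "(\<integral>\<^sup>+x. ennreal ((f n x - z x)^2) \<partial>lborel)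
        = (\<integral>\<^sup>+x. liminf (\<lambda>k. ennreal ((f n x - f (r k) x)^2)) \<partial>lborel)"
    proof (rule nn_integral_cong_AE)
      show "AE x in lborel. ennreal ((f n x - z x)^2) = liminf (\<lambda>k. ennreal ((f n x - f (r k) x)^2))"
        using zl
      proof eventually_elim
        case (elim x)
        have lm: "(\<lambda>k. ennreal ((f n x - f (r k) x)^2)) \<longlonglongrightarrow> ennreal ((f n x - z x)^2)"
          by (intro tendsto_ennrealI tendsto_intros elim)
        show ?case by (rule lim_imp_Liminf[OF _ lm, symmetric]) simp
      qed
    qed
    also have "\<dots> \<le> liminf (\<lambda>k. \<integral>\<^sup>+x. ennreal ((f n x - f (r k) x)^2) \<partial>lborel)"
      by (intro nn_integral_liminf) measurable
    also have "\<dots> \<le> limsup (\<lambda>k. \<integral>\<^sup>+x. ennreal ((f n x - f (r k) x)^2) \<partial>lborel)"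
      by (intro Liminf_le_Limsup) auto
    also have "\<dots> \<le> ennreal (\<delta> n)"
    proof (rule Limsup_bounded)
      show "eventually (\<lambda>k. (\<integral>\<^sup>+x. ennreal ((f n x - f (r k) x)^2) \<partial>lborel) \<le> ennreal (\<delta> n)) sequentially"
      proof (rule eventually_sequentiallyI)
        fix k assume "n \<le> k"
        then have nk: "n \<le> r k" using strict_mono_imp_increasing[OF r, of k] by linarith
        have "(\<integral>\<^sup>+x. ennreal ((f n x - f (r k) x)^2) \<partial>lborel) = ennreal (\<integral>x. (f n x - f (r k) x)^2 \<partial>lborel)"
          using L2fun_sq[OF L2fun_diff[OF L2 L2]] by (intro nn_integral_eq_integral) auto
        also have "\<dots> \<le> ennreal (\<delta> n)"
          using cau[OF nk] by (intro ennreal_leI) (simp add: ip_self power2_commute)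
        finally show "(\<integral>\<^sup>+x. ennreal ((f n x - f (r k) x)^2) \<partial>lborel) \<le> ennreal (\<delta> n)" .
      qed
    qed
    finally show ?thesis .
  qed
  have dL2: "L2fun (\<lambda>x. f n x - z x)" for n
    unfolding L2fun_def
  proof
    show "integrable lborel (\<lambda>x. (f n x - z x)\<^sup>2)"
      using fat[of n] by (intro integrableI_bounded) (auto simp: order.strict_trans1)
  qed simp
  have "L2fun (\<lambda>x. f 0 x - (f 0 x - z x))" by (intro L2fun_diff L2 dL2)
  then have zL2: "L2fun z" by simp
  have bd: "nsq (\<lambda>x. f n x - z x) \<le> \<delta> n" for n
  proof -
    have "ennreal (\<integral>x. (f n x - z x)^2 \<partial>lborel) = (\<integral>\<^sup>+x. ennreal ((f n x - z x)^2) \<partial>lborel)"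
      using L2fun_sq[OF dL2] by (intro nn_integral_eq_integral[symmetric]) auto
    also have "\<dots> \<le> ennreal (\<delta> n)" by (rule fat)
    finally show ?thesis using \<delta>0 by (simp add: ip_self)
  qed
  have "(\<lambda>n. nsq (\<lambda>x. f n x - z x)) \<longlonglongrightarrow> 0"
    by (rule tendsto_sandwich[OF _ _ tendsto_const \<delta>]) (auto simp: bd ip_self_nonneg)
  then show ?thesis using that zL2 r zl by blast
qed


section \<open>Weak sequential compactness in the space of square integrable functions\<close>

lemma L2_ip_tendsto:
  assumes "\<And>n. L2fun (f n)" "L2fun z" "L2fun g"
    and "(\<lambda>n. nsq (\<lambda>x. f n x - z x)) \<longlonglongrightarrow> 0"
  shows "(\<lambda>n. ip (f n) g) \<longlonglongrightarrow> ip z g"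
proof -
  have "(\<lambda>n. sqrt (nsq (\<lambda>x. f n x - z x)) * sqrt (nsq g)) \<longlonglongrightarrow> sqrt 0 * sqrt (nsq g)"
    by (intro tendsto_intros assms)
  then have t: "(\<lambda>n. sqrt (nsq (\<lambda>x. f n x - z x)) * sqrt (nsq g)) \<longlonglongrightarrow> 0" by simp
  have "\<bar>ip (f n) g - ip z g\<bar> \<le> sqrt (nsq (\<lambda>x. f n x - z x)) * sqrt (nsq g)" for n
    unfolding ip_diff_left[OF assms(1,2,3), symmetric] by (rule ip_CS_abs[OF L2fun_diff[OF assms(1,2)] assms(3)])
  then have "(\<lambda>n. ip (f n) g - ip z g) \<longlonglongrightarrow> 0"
    by (intro Lim_null_comparison[OF _ t]) simp
  then show ?thesis by (rule LIM_zero_cancel)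
qed

text \<open>Near-minimisers of the norm over a decreasing sequence of convex sets form a Cauchy sequence,
  by the parallelogram law; the closed convex hulls of the tails, written as intersections of half-spaces,
  thus yield every weak limit without a representation theorem.\<close>
lemma L2_weak_cluster:
  fixes f :: "nat \<Rightarrow> real^'n::finite \<Rightarrow> real"
  assumes L2: "\<And>n. L2fun (f n)" and bd: "\<And>n. nsq (f n) \<le> M"
  obtains z where "L2fun z" "\<And>g L. L2fun g \<Longrightarrow> (\<lambda>n. ip (f n) g) \<longlonglongrightarrow> L \<Longrightarrow> ip z g = L"
proof -
  define C where "C n = {v. L2fun v \<and> (\<forall>g c. L2fun g \<and> (\<forall>m\<ge>n. ip (f m) g \<le> c) \<longrightarrow> ip v g \<le> c)}" for n
  have fC: "f n \<in> C n" for n unfolding C_def using L2 by auto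
  have dec: "n \<le> m \<Longrightarrow> C m \<subseteq> C n" for n m unfolding C_def by (auto intro: order_trans)
  have cvx: "(\<lambda>x. (1/2) * u x + (1/2) * v x) \<in> C n" if "u \<in> C n" "v \<in> C n" for u v n
    unfolding C_def
  proof (intro CollectI conjI allI impI)
    have uv: "L2fun u" "L2fun v" using that by (auto simp: C_def)
    then show "L2fun (\<lambda>x. (1/2) * u x + (1/2) * v x)" by (rule L2fun_lin)
    fix g c assume g: "L2fun g \<and> (\<forall>m\<ge>n. ip (f m) g \<le> c)"
    then have "ip u g \<le> c" "ip v g \<le> c" using that by (auto simp: C_def)
    then show "ip (\<lambda>x. (1/2) * u x + (1/2) * v x) g \<le> c" using g uv by (subst ip_lin_left) auto
  qed
  define d where "d n = Inf ((\<lambda>v. nsq v) ` C n)" for n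
  have bb: "bdd_below ((\<lambda>v. nsq v) ` C n)" for n
    by (intro bdd_belowI[of _ 0]) (auto simp: ip_self_nonneg)
  have ne: "C n \<noteq> {}" for n using fC by auto
  have dl: "v \<in> C n \<Longrightarrow> d n \<le> nsq v" for v n
    unfolding d_def by (intro cInf_lower bb) auto
  have dM: "d n \<le> M" for n using dl[OF fC] bd order_trans by blast
  have dinc: "incseq d"
  proof (rule monoI)
    fix n m :: nat assume "n \<le> m"
    then show "d n \<le> d m" unfolding d_def using dec ne bb by (intro cInf_superset_mono image_mono) auto
  qed
  obtain D where D: "d \<longlonglongrightarrow> D" "\<And>n. d n \<le> D"
    using incseq_convergent[OF dinc, of M] dM by blast
  have "\<exists>v\<in>C n. nsq v < d n + 1 / Suc n" for n
    using cInf_lessD[of "(\<lambda>v. nsq v) ` C n" "d n + 1 / Suc n"] ne unfolding d_def by force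
  then obtain v where vC: "\<And>n. v n \<in> C n" and vd: "\<And>n. nsq (v n) < d n + 1 / Suc n" by metis
  have vL2: "L2fun (v n)" for n using vC by (auto simp: C_def)
  \<comment> \<open>By the parallelogram law the squared distance is at most
    \<open>2 * nsq (v m) + 2 * nsq (v n) - 4 * d n\<close>. For m \<ge> n the two norms are below
    \<open>D + e n\<close> and \<open>d n + e n\<close>, with \<open>e n = 1 / Suc n\<close>, which
    adds up to this bound.\<close>
  define \<delta> where "\<delta> n = 2 * (D - d n) + 4 * (1 / Suc n)" for n
  have "(\<lambda>n. 2 * (D - d n) + 4 * (1 / Suc n)) \<longlonglongrightarrow> 2 * (D - D) + 4 * 0"
    using LIMSEQ_inverse_real_of_nat by (intro tendsto_intros D) (simp add: inverse_eq_divide)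
  then have \<delta>: "\<delta> \<longlonglongrightarrow> 0" unfolding \<delta>_def[abs_def] by simp
  define e where "e n = 1 / real (Suc n)" for n
  have cau: "nsq (\<lambda>x. v m x - v n x) \<le> \<delta> n" if "n \<le> m" for n m
  proof -
    \<comment> \<open>Both points lie in \<open>C n\<close>, as the sets decrease, and so does their
      midpoint.\<close>
    have "d n \<le> nsq (\<lambda>x. (1/2) * v m x + (1/2) * v n x)"
      using vC dec[OF that] by (intro dl cvx) auto
    also have "\<dots> = (nsq (v m) + 2 * ip (v m) (v n) + nsq (v n)) / 4"
      by (subst ip_lin_sq[OF vL2 vL2]) (simp add: field_simps power2_eq_square)
    finally have "nsq (\<lambda>x. v m x - v n x) \<le> 2 * nsq (v m) + 2 * nsq (v n) - 4 * d n"
      using ip_diff_sq[OF vL2 vL2, of m n] by simp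
    moreover have "nsq (v m) < D + e n"
      using vd[of m] D(2)[of m] frac_le[of 1 1 "Suc n" "Suc m"] that by (simp add: e_def)
    moreover have "nsq (v n) < d n + e n" unfolding e_def by (rule vd)
    moreover have "\<delta> n = 2 * (D - d n) + 4 * e n" unfolding \<delta>_def e_def by simp
    ultimately show ?thesis by argo
  qed
  obtain z r where z: "L2fun z" "(\<lambda>n. nsq (\<lambda>x. v n x - z x)) \<longlonglongrightarrow> 0"
    using L2_complete[OF vL2 cau \<delta>] by blast
  have le: "ip z g \<le> L" if g: "L2fun g" and lim: "(\<lambda>n. ip (f n) g) \<longlonglongrightarrow> L" for g L
  proof (rule field_le_epsilon)
    fix e :: real assume "0 < e"
    then obtain n where n: "\<And>m. m \<ge> n \<Longrightarrow> ip (f m) g < L + e"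
      using order_tendstoD(2)[OF lim, of "L + e"] unfolding eventually_sequentially by auto
    have "ip (v m) g \<le> L + e" if "m \<ge> n" for m
    proof -
      have "v m \<in> C n" using vC dec[OF that] by auto
      then show ?thesis using g n unfolding C_def by (blast intro: less_imp_le)
    qed
    then show "ip z g \<le> L + e"
      by (intro LIMSEQ_le_const2[OF L2_ip_tendsto[OF vL2 z(1) g z(2)]]) auto
  qed
  have "ip z g = L" if g: "L2fun g" and lim: "(\<lambda>n. ip (f n) g) \<longlonglongrightarrow> L" for g L
  proof (rule antisym)
    show "ip z g \<le> L" using le that by blast
    \<comment> \<open>The inequality \<open>le\<close> for \<open>-g\<close> is the reverse
      inequality for \<open>g\<close>.\<close>
    have g': "L2fun (\<lambda>x. (-1) * g x)" using L2fun_scale[OF g, of "-1"] by simp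
    have neg: "ip h (\<lambda>x. (-1) * g x) = - ip h g" for h unfolding ip_def by simp
    have "(\<lambda>n. ip (f n) (\<lambda>x. (-1) * g x)) \<longlonglongrightarrow> - L"
      unfolding neg by (intro tendsto_minus lim)
    then show "L \<le> ip z g" using le[OF g'] unfolding neg by fastforce
  qed
  then show ?thesis using that z(1) by blast
qed

definition wconv :: "(nat \<Rightarrow> real^'n::finite \<Rightarrow> real) \<Rightarrow> (real^'n \<Rightarrow> real) \<Rightarrow> bool" where
  "wconv f z \<longleftrightarrow> (\<forall>g. L2fun g \<longrightarrow> (\<lambda>n. ip (f n) g) \<longlonglongrightarrow> ip z g)"

lemma wconv_subseq: "wconv f z \<Longrightarrow> strict_mono r \<Longrightarrow> wconv (\<lambda>n. f (r n)) z"
  unfolding wconv_def using LIMSEQ_subseq_LIMSEQ[of "\<lambda>n. ip (f n) g" "ip z g" r for g] unfolding comp_def by blast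

lemma bounded_real_convergent_subseq:
  fixes a :: "nat \<Rightarrow> real"
  assumes "\<And>n. \<bar>a n\<bar> \<le> M"
  obtains r l where "strict_mono (r::nat\<Rightarrow>nat)" "(\<lambda>n. a (r n)) \<longlonglongrightarrow> l"
proof -
  have "bounded (range a)" using assms by (intro boundedI[of _ M]) auto
  then obtain l r where "strict_mono (r::nat\<Rightarrow>nat)" "(a \<circ> r) \<longlonglongrightarrow> l"
    using bounded_imp_convergent_subsequence by blast
  then show ?thesis using that[of r l] by (simp add: comp_def)
qed

lemma not_tendsto_subseq:
  fixes a :: "nat \<Rightarrow> real"
  assumes "\<not> a \<longlonglongrightarrow> l"
  obtains r e where "strict_mono (r::nat\<Rightarrow>nat)" "e > 0" "\<And>n. \<bar>a (r n) - l\<bar> \<ge> e"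
proof -
  obtain e where e: "e > 0" "\<And>N. \<exists>n\<ge>N. \<not> \<bar>a n - l\<bar> < e"
    using assms unfolding LIMSEQ_def dist_real_def by auto
  then have "infinite {n. \<not> \<bar>a n - l\<bar> < e}"
    unfolding infinite_nat_iff_unbounded_le by auto
  then obtain r :: "nat \<Rightarrow> nat" where "strict_mono r" "\<And>n. r n \<in> {n. \<not> \<bar>a n - l\<bar> < e}"
    using infinite_enumerate by blast
  then show ?thesis using that e(1) by (auto simp: not_less)
qed

text \<open>If all \<open>ip (f n) (f m)\<close> converge as \<open>n\<close> grows, two weak cluster points differ by an element orthogonal
  to every \<open>f m\<close>, hence to themselves.\<close>
lemma L2_weak_compact:
  fixes f :: "nat \<Rightarrow> real^'n::finite \<Rightarrow> real"
  assumes L2: "\<And>n. L2fun (f n)" and bd: "\<And>n. nsq (f n) \<le> M"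
  obtains z r where "L2fun z" "strict_mono (r::nat\<Rightarrow>nat)" "wconv (\<lambda>n. f (r n)) z"
proof -
  have sq: "sqrt (nsq (f n)) \<le> sqrt M" for n using bd by simp
  have bdg: "\<bar>ip (f n) g\<bar> \<le> sqrt M * sqrt (nsq g)" if "L2fun g" for n g
    using ip_CS_abs[OF L2[of n] that] mult_right_mono[OF sq[of n], of "sqrt (nsq g)"] ip_self_nonneg[of g] by simp
  have M0: "0 \<le> M" using bd[of 0] ip_self_nonneg[of "f 0"] by linarith
  have nb: "norm (ip (f n) (f m)) \<le> M" for n m
  proof -
    have "\<bar>ip (f n) (f m)\<bar> \<le> sqrt M * sqrt M"
      using bdg[OF L2[of m], of n] mult_left_mono[OF sq[of m], of "sqrt M"] M0 by simp
    then show ?thesis using M0 by simp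
  qed
  \<comment> \<open>A diagonal argument for the countably many bounded sequences
    \<open>ip (f n) (f m)\<close> in \<open>n\<close>, one for each \<open>m\<close>.\<close>
  obtain r :: "nat \<Rightarrow> nat" where r: "strict_mono r"
    and rl: "\<And>m. m \<in> UNIV \<Longrightarrow> \<exists>l. (\<lambda>n. ip (f (r n)) (f m)) \<longlonglongrightarrow> l"
    by (rule function_convergent_subsequence[of "UNIV::nat set" "\<lambda>n m. ip (f n) (f m)" M]) (use nb in auto)
  obtain z where z: "L2fun z" and zl: "\<And>g L. L2fun g \<Longrightarrow> (\<lambda>n. ip (f (r n)) g) \<longlonglongrightarrow> L \<Longrightarrow> ip z g = L"
    using L2_weak_cluster[of "\<lambda>n. f (r n)" M, OF L2 bd] by blast
  have "(\<lambda>n. ip (f (r n)) g) \<longlonglongrightarrow> ip z g" if g: "L2fun g" for g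
  proof (rule ccontr)
    assume "\<not> ?thesis"
    \<comment> \<open>Failure for some \<open>g\<close> produces a further subsequence whose
      products with \<open>g\<close> tend to a limit other than \<open>ip z g\<close>, and with it a
      second weak cluster point \<open>z'\<close>.\<close>
    then obtain s e where s: "strict_mono (s::nat\<Rightarrow>nat)" "e > 0" "\<And>n. \<bar>ip (f (r (s n))) g - ip z g\<bar> \<ge> e"
      using not_tendsto_subseq by metis
    obtain t l where t: "strict_mono (t::nat\<Rightarrow>nat)" "(\<lambda>n. ip (f (r (s (t n)))) g) \<longlonglongrightarrow> l"
      using bounded_real_convergent_subseq[of "\<lambda>n. ip (f (r (s n))) g", OF bdg[OF g]] by blast
    have "(\<lambda>n. \<bar>ip (f (r (s (t n)))) g - ip z g\<bar>) \<longlonglongrightarrow> \<bar>l - ip z g\<bar>"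
      by (intro tendsto_intros t)
    then have "e \<le> \<bar>l - ip z g\<bar>" using s(3) by (intro LIMSEQ_le_const) auto
    then have ne: "l \<noteq> ip z g" using s(2) by auto
    obtain z' where z': "L2fun z'" and zl': "\<And>g L. L2fun g \<Longrightarrow> (\<lambda>n. ip (f (r (s (t n)))) g) \<longlonglongrightarrow> L \<Longrightarrow> ip z' g = L"
      using L2_weak_cluster[of "\<lambda>n. f (r (s (t n)))" M, OF L2 bd] by blast
    define h where "h x = z x - z' x" for x
    have h: "L2fun h" unfolding h_def by (intro L2fun_diff z z')
    have fh: "ip (f m) h = 0" for m
    proof -
      obtain L where L: "(\<lambda>n. ip (f (r n)) (f m)) \<longlonglongrightarrow> L" using rl by blast
      have "(\<lambda>n. ip (f (r (s (t n)))) (f m)) \<longlonglongrightarrow> L"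
        using LIMSEQ_subseq_LIMSEQ[OF LIMSEQ_subseq_LIMSEQ[OF L s(1)] t(1)] by (simp add: comp_def)
      then have "ip z' (f m) = L" "ip z (f m) = L" using zl' zl L L2 by blast+
      then show ?thesis unfolding h_def using ip_diff_right[OF z z' L2] by (simp add: ip_commute)
    qed
    \<comment> \<open>The products with \<open>h\<close> form the constant sequence 0, so both
      cluster points are orthogonal to \<open>h\<close>, and hence so is their difference
      \<open>h\<close>.\<close>
    then have "ip z h = 0" "ip z' h = 0" using zl[OF h, of 0] zl'[OF h, of 0] by auto
    then have "nsq h = 0" unfolding h_def[abs_def] using ip_diff_left[OF z z' h] by (simp add: h_def[abs_def])
    then have "AE x in lborel. h x = 0" using ip_self_eq_0[OF h] by simp
    then have "AE x in lborel. z' x = z x" by eventually_elim (simp add: h_def)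
    then have "ip z' g = ip z g" using z z' g by (intro ip_AE_cong) (auto simp: L2fun_def)
    then show False using zl'[OF g t(2)] ne by simp
  qed
  then show ?thesis using that[OF z r] by (simp add: wconv_def)
qed

text \<open>Weak lower semicontinuity of the norm: testing with \<open>z\<close> itself gives
  \<open>nsq z \<le> sqrt M * sqrt (nsq z)\<close>, and a nonzero norm of \<open>z\<close> may be
  cancelled.\<close>

lemma wconv_ip_le:
  assumes "\<And>n. L2fun (f n)" "\<And>n. nsq (f n) \<le> M" "L2fun z" "wconv f z"
  shows "nsq z \<le> M"
proof -
  have l: "(\<lambda>n. ip (f n) z) \<longlonglongrightarrow> nsq z" using assms by (simp add: wconv_def)
  have M0: "0 \<le> M" using assms(2)[of 0] ip_self_nonneg[of "f 0"] by linarith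
  have "ip (f n) z \<le> sqrt M * sqrt (nsq z)" for n
    using ip_CS_abs[OF assms(1)[of n] assms(3)] mult_right_mono[of "sqrt (nsq (f n))" "sqrt M" "sqrt (nsq z)"]
      assms(2)[of n] ip_self_nonneg[of z] by simp
  then have le: "nsq z \<le> sqrt M * sqrt (nsq z)" by (intro LIMSEQ_le_const2[OF l]) auto
  show ?thesis
  proof (cases "nsq z = 0")
    case False
    then have p: "sqrt (nsq z) > 0" using ip_self_nonneg[of z] by simp
    have "sqrt (nsq z) * sqrt (nsq z) \<le> sqrt M * sqrt (nsq z)" using le ip_self_nonneg[of z] by simp
    then have "sqrt (nsq z) \<le> sqrt M" using p mult_right_le_imp_le by blast
    then show ?thesis by simp
  qed (use M0 in simp)
qed

section \<open>Test functions and weak gradients\<close>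

text \<open>The standard smooth function exp(-c/t), together with all negative powers of t that its
  derivatives produce. With \<open>m\<close> free, the family is closed under differentiation up to
  linear combinations; with \<open>c\<close> free, c -> 0 recovers the indicator of the positive
  half-line at \<open>m = 0\<close>.\<close>

definition pexp :: "real \<Rightarrow> nat \<Rightarrow> real \<Rightarrow> real" where
  "pexp c m t = (if t > 0 then exp (- c / t) / t ^ m else 0)"

text \<open>One term of the exponential series, that of order \<open>m + 2\<close>, already beats
  the factor \<open>t ^ m\<close> and leaves \<open>t^2\<close>. This is the decay that makes the
  difference quotient at 0 vanish.\<close>

lemma pexp_le_square:
  assumes "c > 0"
  shows "\<bar>pexp c m t\<bar> \<le> fact (m + 2) / c ^ (m + 2) * t^2"
proof (cases "t > 0")
  case True
  have "(c / t) ^ (m + 2) / fact (m + 2) \<le> exp (c / t)"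
  proof -
    \<comment> \<open>The range stops at \<open>m + 3\<close> so that the term of index
      \<open>m + 2\<close> is included.\<close>
    have "(\<Sum>n<m+3. (c/t) ^ n /\<^sub>R fact n) \<le> exp (c/t)"
      unfolding exp_def using True assms by (intro sum_le_suminf summable_exp_generic) auto
    moreover have "(c/t) ^ (m+2) /\<^sub>R fact (m+2) \<le> (\<Sum>n<m+3. (c/t) ^ n /\<^sub>R fact n)"
      using True assms by (intro member_le_sum) auto
    ultimately show ?thesis by (simp add: divide_inverse mult.commute)
  qed
  then have "exp (- (c / t)) \<le> fact (m + 2) / (c / t) ^ (m + 2)"
  proof -
    have "inverse (exp (c / t)) \<le> inverse ((c / t) ^ (m + 2) / fact (m + 2))"
      using True assms by (intro le_imp_inverse_le \<open>(c / t) ^ (m + 2) / fact (m + 2) \<le> exp (c / t)\<close>) auto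
    then show ?thesis unfolding exp_minus inverse_divide .
  qed
  then have "exp (- (c / t)) / t ^ m \<le> fact (m + 2) / (c / t) ^ (m + 2) / t ^ m"
    using True by (intro divide_right_mono) auto
  then have "pexp c m t \<le> fact (m + 2) / (c / t) ^ (m + 2) / t ^ m"
    unfolding pexp_def using True by (simp only: if_True minus_divide_left)
  also have "\<dots> = fact (m + 2) / c ^ (m + 2) * t^2"
    using True by (simp add: power_divide power_add power2_eq_square)
  finally show ?thesis using True by (simp add: pexp_def)
qed (use assms in \<open>simp add: pexp_def\<close>)

text \<open>One formula serves all t because both sides vanish for t \<le> 0; only t = 0 needs an
  argument, which is the quadratic bound.\<close>

lemma pexp_DERIV:
  assumes c: "c > 0"
  shows "(pexp c m has_real_derivative (c * pexp c (m + 2) t - real m * pexp c (m + 1) t)) (at t)"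
proof -
  consider "t > 0" | "t < 0" | "t = 0" by linarith
  then show ?thesis
  proof cases
    case 1
    have "((\<lambda>t. exp (- c / t) / t ^ m) has_real_derivative (c * pexp c (m + 2) t - real m * pexp c (m + 1) t)) (at t)"
    proof -
      have d1: "((\<lambda>t. exp (- c / t)) has_real_derivative exp (- c / t) * (c / t^2)) (at t)"
        using 1 by (auto intro!: derivative_eq_intros simp: power2_eq_square)
      have d2: "((\<lambda>t. t ^ m) has_real_derivative real m * t ^ (m - 1)) (at t)"
        by (auto intro!: derivative_eq_intros)
      have "(exp (- c / t) * (c / t^2) * t ^ m - exp (- c / t) * (real m * t ^ (m - 1))) / (t ^ m * t ^ m)
          = c * pexp c (m + 2) t - real m * pexp c (m + 1) t"
      \<comment> \<open>In \<open>t ^ (m - 1)\<close> the subtraction is truncated; at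
        \<open>m = 0\<close> the coefficient \<open>real m\<close> removes the term.\<close>
      proof (cases m)
        case (Suc k)
        have t: "t \<noteq> 0" "t > 0" using 1 by auto
        show ?thesis unfolding Suc pexp_def using t
          by (simp add: divide_simps) (simp add: power2_eq_square algebra_simps)
      qed (use 1 in \<open>simp add: pexp_def power2_eq_square\<close>)
      with DERIV_divide[OF d1 d2] 1 show ?thesis by simp
    qed
    then show ?thesis
    proof (rule DERIV_cong_ev[OF refl _ refl, THEN iffD1, rotated])
      show "\<forall>\<^sub>F x in nhds t. exp (- c / x) / x ^ m = pexp c m x"
        using eventually_nhds_in_open[of "{0<..}" t] 1
        by (auto elim!: eventually_mono simp: pexp_def)
    qed
  next
    case 2
    have "((\<lambda>t. 0) has_real_derivative 0) (at t)" by simp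
    then have "(pexp c m has_real_derivative 0) (at t)"
    proof (rule DERIV_cong_ev[OF refl _ refl, THEN iffD1, rotated])
      show "\<forall>\<^sub>F x in nhds t. 0 = pexp c m x"
        using eventually_nhds_in_open[of "{..<0}" t] 2
        by (auto elim!: eventually_mono simp: pexp_def)
    qed
    then show ?thesis using 2 by (simp add: pexp_def)
  next
    case 3
    define K where "K = fact (m + 2) / c ^ (m + 2)"
    have "(\<lambda>h. (pexp c m h - pexp c m 0) / h) \<midarrow>0\<rightarrow> 0"
    proof (rule Lim_null_comparison)
      have "((\<lambda>h. K * \<bar>h\<bar>) \<longlongrightarrow> K * \<bar>0\<bar>) (at 0)" by (intro tendsto_intros)
      then show "((\<lambda>h. K * \<bar>h\<bar>) \<longlongrightarrow> 0) (at 0)" by simp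
      show "\<forall>\<^sub>F h in at 0. norm ((pexp c m h - pexp c m 0) / h) \<le> K * \<bar>h\<bar>"
      proof (rule always_eventually, rule allI)
        fix h :: real
        have "\<bar>pexp c m h\<bar> \<le> K * h^2" using pexp_le_square[OF c] unfolding K_def .
        then have "\<bar>pexp c m h\<bar> / \<bar>h\<bar> \<le> K * h^2 / \<bar>h\<bar>" by (intro divide_right_mono) auto
        also have "\<dots> = K * \<bar>h\<bar>" by (cases "h = 0") (auto simp: power2_eq_square abs_if)
        finally show "norm ((pexp c m h - pexp c m 0) / h) \<le> K * \<bar>h\<bar>" by (simp add: pexp_def[of c m 0])
      qed
    qed
    then have "(pexp c m has_real_derivative 0) (at 0)" by (simp add: DERIV_def)
    then show ?thesis using 3 by (simp add: pexp_def)
  qed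
qed

lemma partial_deriv_eq:
  assumes "(f has_derivative f') (at x)"
  shows "partial_deriv i f x = f' (axis i 1)"
  using frechet_derivative_at[OF assms] by (simp add: partial_deriv_def)

text \<open>A test function must have differentiable iterated partial derivatives of every order.
  This is shown for a whole class closed under partial derivatives, so that no formula for the
  iterated derivative is needed. The factor \<open>s\<close> is there for the two signs, since the
  two ends of an interval require x - a and b - x.\<close>

inductive bump_algebra :: "(real^'n::finite \<Rightarrow> real) \<Rightarrow> bool" where
  const: "bump_algebra (\<lambda>x. r)"
| base: "c > 0 \<Longrightarrow> bump_algebra (\<lambda>x. pexp c m (s * x $ i + a))"
| add: "bump_algebra f \<Longrightarrow> bump_algebra g \<Longrightarrow> bump_algebra (\<lambda>x. f x + g x)"
| mult: "bump_algebra f \<Longrightarrow> bump_algebra g \<Longrightarrow> bump_algebra (\<lambda>x. f x * g x)"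

lemma bump_algebra_deriv:
  fixes f :: "real^'n::finite \<Rightarrow> real"
  assumes "bump_algebra f"
  shows "(\<forall>x. f differentiable (at x)) \<and> (\<forall>j. bump_algebra (partial_deriv j f))"
  using assms
proof induction
  case (const r)
  have "partial_deriv j (\<lambda>x. r) = (\<lambda>x. 0)" for j :: 'n
    by (rule ext) (subst partial_deriv_eq[of _ "\<lambda>h. 0"], auto)
  then show ?case by (auto intro: bump_algebra.const)
next
  case (base c m s i a)
  have d: "((\<lambda>x. pexp c m (s * x $ i + a)) has_derivative
      (\<lambda>h. (c * pexp c (m + 2) (s * x $ i + a) - real m * pexp c (m + 1) (s * x $ i + a)) * (s * h $ i))) (at x)" for x :: "real^'n"
  proof -
    have "((\<lambda>x. s * x $ i + a) has_derivative (\<lambda>h. s * h $ i)) (at x)"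
      by (auto intro!: derivative_eq_intros bounded_linear_imp_has_derivative bounded_linear_vec_nth)
    from has_derivative_compose[OF this pexp_DERIV[OF base, of m, unfolded has_field_derivative_def]]
    show ?thesis by simp
  qed
  \<comment> \<open>The derivative raises \<open>m\<close> by one and by two; differentiation in a
    direction other than \<open>i\<close> is covered by a zero coefficient, so that the result is
    visibly in the class.\<close>
  have "partial_deriv j (\<lambda>x. pexp c m (s * x $ i + a)) = (\<lambda>x. (c * (if i = j then s else 0)) * pexp c (m + 2) (s * x $ i + a)
      + (- real m * (if i = j then s else 0)) * pexp c (m + 1) (s * x $ i + a))" for j :: 'n
    by (rule ext, subst partial_deriv_eq[OF d]) (auto simp: axis_def algebra_simps)
  then have "bump_algebra (partial_deriv j (\<lambda>x. pexp c m (s * x $ i + a)))" for j :: 'n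
    by (simp only:) (intro bump_algebra.intros base)
  then show ?case using d unfolding differentiable_def by blast
next
  case (add f g)
  have d: "(f has_derivative frechet_derivative f (at x)) (at x)" "(g has_derivative frechet_derivative g (at x)) (at x)" for x
    using add frechet_derivative_works by blast+
  have "partial_deriv j (\<lambda>x. f x + g x) = (\<lambda>x. partial_deriv j f x + partial_deriv j g x)" for j
    by (rule ext, subst partial_deriv_eq[OF has_derivative_add[OF d]]) (simp add: partial_deriv_def)
  then show ?case using add by (auto intro!: bump_algebra.intros)
next
  case (mult f g)
  have d: "(f has_derivative frechet_derivative f (at x)) (at x)" "(g has_derivative frechet_derivative g (at x)) (at x)" for x
    using mult frechet_derivative_works by blast+
  have "partial_deriv j (\<lambda>x. f x * g x) = (\<lambda>x. f x * partial_deriv j g x + partial_deriv j f x * g x)" for j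
    by (rule ext, subst partial_deriv_eq[OF has_derivative_mult[OF d]]) (simp add: partial_deriv_def)
  then show ?case using mult by (auto intro!: bump_algebra.intros)
qed

lemma bump_algebra_iter_partial: "bump_algebra f \<Longrightarrow> bump_algebra (iter_partial is f)"
  by (induction "is") (use bump_algebra_deriv in auto)

text \<open>Positive exactly on the open box. The parameter \<open>c\<close> does not change the
  support but the steepness: for c -> 0 the function increases to the indicator of the box.\<close>

definition bump :: "real \<Rightarrow> real^'n::finite \<Rightarrow> real^'n \<Rightarrow> real^'n \<Rightarrow> real" where
  "bump c a b x = (\<Prod>i\<in>UNIV. pexp c 0 (x $ i - a $ i) * pexp c 0 (b $ i - x $ i))"

lemma bump_algebra_bump:
  assumes "c > 0" shows "bump_algebra (bump c a b)"
proof -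
  have *: "bump_algebra (\<lambda>x. pexp c 0 (x $ i - a $ i) * pexp c 0 (b $ i - x $ i))" for i
    using bump_algebra.mult[OF bump_algebra.base[OF assms, of 0 1 i "- a $ i"] bump_algebra.base[OF assms, of 0 "-1" i "b $ i"]]
    by simp
  have "bump_algebra (\<lambda>x. \<Prod>i\<in>S. pexp c 0 (x $ i - a $ i) * pexp c 0 (b $ i - x $ i))" if "finite S" for S
    using that by (induction S) (auto intro!: bump_algebra.const bump_algebra.mult *)
  from this[of UNIV] show ?thesis unfolding bump_def[abs_def] by simp
qed

lemma pexp0_bounds: "c > 0 \<Longrightarrow> 0 \<le> pexp c 0 t \<and> pexp c 0 t \<le> 1"
  by (auto simp: pexp_def)

lemma bump_outside: "x \<notin> box a b \<Longrightarrow> bump c a b x = 0"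
  unfolding bump_def by (rule prod_zero) (auto simp: mem_box_cart pexp_def)

lemma bump_bounds: "c > 0 \<Longrightarrow> 0 \<le> bump c a b x \<and> bump c a b x \<le> 1"
  unfolding bump_def using pexp0_bounds by (auto intro!: prod_nonneg prod_le_1 mult_le_one)

lemma test_fun_bump:
  assumes "c > 0" shows "test_fun (bump c a b)"
  unfolding test_fun_def
proof
  show "\<forall>is. iter_partial is (bump c a b) differentiable_on UNIV"
  proof
    fix "is" :: "'a list"
    have "\<forall>x. iter_partial is (bump c a b) differentiable (at x)"
      using bump_algebra_deriv[OF bump_algebra_iter_partial[OF bump_algebra_bump[OF assms]]] by blast
    then show "iter_partial is (bump c a b) differentiable_on UNIV" by (simp add: differentiable_on_def)
  qed
  have "{x. bump c a b x \<noteq> 0} \<subseteq> box a b" using bump_outside by blast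
  then have "bounded {x. bump c a b x \<noteq> 0}" using bounded_box bounded_subset by blast
  then show "compact (closure {x. bump c a b x \<noteq> 0})" by (simp add: compact_closure)
qed

lemma bump_tendsto:
  fixes a b x :: "real^'n::finite"
  shows "(\<lambda>n. bump (1 / Suc n) a b x) \<longlonglongrightarrow> indicator (box a b) x"
proof (cases "x \<in> box a b")
  case True
  have *: "(\<lambda>n. pexp (1 / Suc n) 0 t) \<longlonglongrightarrow> 1" if "t > 0" for t
  proof -
    have "(\<lambda>n. exp (- (inverse (real (Suc n))) / t)) \<longlonglongrightarrow> exp (- 0 / t)"
      using that by (intro tendsto_intros LIMSEQ_inverse_real_of_nat) auto
    then show ?thesis using that by (simp add: pexp_def inverse_eq_divide)
  qed
  have "(\<lambda>n. bump (1 / Suc n) a b x) \<longlonglongrightarrow> (\<Prod>i\<in>(UNIV::'n set). 1 * 1)"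
    unfolding bump_def
  proof (rule Limits.tendsto_prod, rule tendsto_mult)
    fix i show "(\<lambda>n. pexp (1 / Suc n) 0 (x $ i - a $ i)) \<longlonglongrightarrow> 1"
      "(\<lambda>n. pexp (1 / Suc n) 0 (b $ i - x $ i)) \<longlonglongrightarrow> 1"
      using True by (intro *, simp add: mem_box_cart)+
  qed
  then show ?thesis using True by simp
qed (simp add: bump_outside)

lemma L2fun_indicator:
  assumes "A \<in> sets lborel" "emeasure lborel A < \<infinity>"
  shows "L2fun (indicat_real A)"
proof -
  have "(\<lambda>x. (indicat_real A x)^2) = indicat_real A" by (auto simp: indicator_def)
  then show ?thesis using assms by (simp add: L2fun_def integrable_indicator_iff)
qed

text \<open>The positive and the negative part of \<open>f\<close> are densities of two measures
  that agree on boxes. Boxes are stable under intersection, generate the Borel sets and exhaust the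
  space with finite measure, so the measures agree, and densities are unique almost
  everywhere.\<close>

lemma AE_zero_if_box_integrals_zero:
  fixes f :: "real^'n::finite \<Rightarrow> real"
  assumes f: "L2fun f" and z: "\<And>a b. ip f (indicat_real (box a b)) = 0"
  shows "AE x in lborel. f x = 0"
proof -
  have fm[measurable]: "f \<in> borel_measurable borel" using f L2fun_meas by blast
  define M where "M = density lborel (\<lambda>x. ennreal (max 0 (f x)))"
  define N where "N = density lborel (\<lambda>x. ennreal (max 0 (- f x)))"
  have L2i: "L2fun (indicat_real (box a b))" for a b :: "real^'n"
    by (intro L2fun_indicator) (auto simp: emeasure_lborel_box_eq)
  have int: "integrable lborel (\<lambda>x. f x * indicat_real (box a b) x)" for a b
    by (intro L2fun_mult_integrable f L2i)
  have eM: "emeasure M (box a b) = ennreal (\<integral>x. max 0 (f x * indicat_real (box a b) x) \<partial>lborel)" for a b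
  proof -
    have "emeasure M (box a b) = (\<integral>\<^sup>+x. ennreal (max 0 (f x)) * indicator (box a b) x \<partial>lborel)"
      unfolding M_def by (subst emeasure_density) auto
    also have "\<dots> = (\<integral>\<^sup>+x. ennreal (max 0 (f x * indicat_real (box a b) x)) \<partial>lborel)"
      by (intro nn_integral_cong) (auto simp: indicator_def)
    also have "\<dots> = ennreal (\<integral>x. max 0 (f x * indicat_real (box a b) x) \<partial>lborel)"
      using int by (intro nn_integral_eq_integral) auto
    finally show ?thesis .
  qed
  have eN: "emeasure N (box a b) = ennreal (\<integral>x. max 0 (- (f x * indicat_real (box a b) x)) \<partial>lborel)" for a b
  proof -
    have "emeasure N (box a b) = (\<integral>\<^sup>+x. ennreal (max 0 (- f x)) * indicator (box a b) x \<partial>lborel)"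
      unfolding N_def by (subst emeasure_density) auto
    also have "\<dots> = (\<integral>\<^sup>+x. ennreal (max 0 (- (f x * indicat_real (box a b) x))) \<partial>lborel)"
      by (intro nn_integral_cong) (auto simp: indicator_def)
    also have "\<dots> = ennreal (\<integral>x. max 0 (- (f x * indicat_real (box a b) x)) \<partial>lborel)"
      using int by (intro nn_integral_eq_integral) auto
    finally show ?thesis .
  qed
  have eq: "emeasure M (box a b) = emeasure N (box a b)" for a b
  proof -
    let ?h = "\<lambda>x. f x * indicat_real (box a b) x"
    have "(\<integral>x. max 0 (?h x) \<partial>lborel) - (\<integral>x. max 0 (- ?h x) \<partial>lborel) = (\<integral>x. max 0 (?h x) - max 0 (- ?h x) \<partial>lborel)"
      using int by (intro Bochner_Integration.integral_diff[symmetric]) auto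
    also have "(\<lambda>x. max 0 (?h x) - max 0 (- ?h x)) = ?h" by (auto simp: max_def)
    also have "(\<integral>x. ?h x \<partial>lborel) = 0" using z[of a b] by (simp add: ip_def)
    finally show ?thesis unfolding eM eN by simp
  qed
  have MN: "M = N"
  proof (rule measure_eqI_generator_eq)
    let ?E = "range (\<lambda>(a, b). box a b::(real^'n) set)"
    show "Int_stable ?E" by (auto simp: Int_stable_def box_Int_box)
    show "?E \<subseteq> Pow UNIV" "sets M = sigma_sets UNIV ?E" "sets N = sigma_sets UNIV ?E"
      by (simp_all add: borel_eq_box M_def N_def)
    let ?A = "\<lambda>n::nat. box (- (real n *\<^sub>R One)) (real n *\<^sub>R One) :: (real^'n) set"
    show "range ?A \<subseteq> ?E" "(\<Union>i. ?A i) = UNIV" unfolding UN_box_eq_UNIV by auto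
    show "emeasure M (?A i) \<noteq> \<infinity>" for i unfolding eM by simp
    show "emeasure M X = emeasure N X" if "X \<in> ?E" for X using that eq by auto
  qed
  have "AE x in lborel. ennreal (max 0 (f x)) = ennreal (max 0 (- f x))"
    using MN unfolding M_def N_def
    by (subst (asm) sigma_finite_measure.density_unique_iff[OF sigma_finite_lborel]) auto
  then show ?thesis by eventually_elim (auto simp: max_def split: if_splits)
qed

text \<open>The fundamental lemma of the calculus of variations. The bumps of a box are dominated by
  its indicator and converge to it, which reduces the claim to boxes.\<close>

lemma AE_zero_if_test_integrals_zero:
  fixes f :: "real^'n::finite \<Rightarrow> real"
  assumes f: "L2fun f" and z: "\<And>\<phi>. test_fun \<phi> \<Longrightarrow> (\<integral>x. f x * \<phi> x \<partial>lborel) = 0"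
  shows "AE x in lborel. f x = 0"
proof (rule AE_zero_if_box_integrals_zero[OF f])
  fix a b :: "real^'n"
  have fm[measurable]: "f \<in> borel_measurable borel" using f L2fun_meas by blast
  have bm[measurable]: "bump c a b \<in> borel_measurable borel" for c
    unfolding bump_def pexp_def[abs_def] by measurable
  have L2i: "L2fun (indicat_real (box a b))"
    by (intro L2fun_indicator) (auto simp: emeasure_lborel_box_eq)
  have int: "integrable lborel (\<lambda>x. \<bar>f x * indicat_real (box a b) x\<bar>)"
    using L2fun_mult_integrable[OF f L2i] by (rule integrable_abs)
  have "(\<lambda>n. \<integral>x. f x * bump (1 / Suc n) a b x \<partial>lborel) \<longlonglongrightarrow> (\<integral>x. f x * indicat_real (box a b) x \<partial>lborel)"
  proof (rule integral_dominated_convergence[OF _ _ int])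
    show "AE x in lborel. (\<lambda>n. f x * bump (1 / Suc n) a b x) \<longlonglongrightarrow> f x * indicat_real (box a b) x"
      by (intro AE_I2 tendsto_intros bump_tendsto)
    show "AE x in lborel. norm (f x * bump (1 / Suc n) a b x) \<le> \<bar>f x * indicat_real (box a b) x\<bar>" for n
    proof (intro AE_I2)
      fix x
      have "0 \<le> bump (1 / Suc n) a b x \<and> bump (1 / Suc n) a b x \<le> indicat_real (box a b) x"
        using bump_bounds[of "1 / Suc n" a b x] bump_outside[of x a b "1 / Suc n"] by (auto simp: indicator_def)
      then show "norm (f x * bump (1 / Suc n) a b x) \<le> \<bar>f x * indicat_real (box a b) x\<bar>"
        by (auto simp: abs_mult intro!: mult_left_mono)
    qed
  qed auto
  then show "ip f (indicat_real (box a b)) = 0"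
    using z[OF test_fun_bump] by (simp add: ip_def LIMSEQ_const_iff)
qed

lemma compact_support_L2:
  fixes f :: "real^'n::finite \<Rightarrow> real"
  assumes c: "continuous_on UNIV f" and K: "compact K" and z: "\<And>x. x \<notin> K \<Longrightarrow> f x = 0"
  obtains C where "L2fun f" "C \<ge> 0" "\<And>x. \<bar>f x\<bar> \<le> C"
proof -
  have "compact (f ` K)" using K c by (intro compact_continuous_image) (auto intro: continuous_on_subset)
  then obtain C where C: "\<And>x. x \<in> K \<Longrightarrow> \<bar>f x\<bar> \<le> C"
    using compact_imp_bounded bounded_iff by (metis image_eqI real_norm_def)
  have C': "\<bar>f x\<bar> \<le> max C 0" for x using C[of x] z[of x] by (cases "x \<in> K") auto
  have m: "f \<in> borel_measurable borel" using c by (rule borel_measurable_continuous_onI)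
  have "L2fun f"
  proof (rule L2fun_bound)
    show "L2fun (\<lambda>x. max C 0 * indicat_real K x)"
      using K emeasure_bounded_finite[OF compact_imp_bounded[OF K]]
      by (intro L2fun_scale L2fun_indicator) (auto simp: borel_compact)
    show "AE x in lborel. \<bar>f x\<bar> \<le> \<bar>max C 0 * indicat_real K x\<bar>"
      using C' z by (intro AE_I2) (auto simp: indicator_def)
  qed (use m in simp)
  then show ?thesis using that[of "max C 0"] C' by simp
qed

lemma test_fun_has_derivative:
  "test_fun \<phi> \<Longrightarrow> (\<phi> has_derivative frechet_derivative \<phi> (at x)) (at x)"
  using frechet_derivative_works[of \<phi> "at x"] by (force simp: test_fun_def differentiable_on_def dest: spec[of _ "[]"])

lemma test_fun_continuous: "test_fun \<phi> \<Longrightarrow> continuous_on UNIV \<phi>"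
  by (metis test_fun_def iter_partial.simps(1) differentiable_imp_continuous_on)

lemma test_fun_partial_continuous: "test_fun \<phi> \<Longrightarrow> continuous_on UNIV (partial_deriv i \<phi>)"
  by (metis test_fun_def iter_partial.simps differentiable_imp_continuous_on)

lemma test_fun_partial_outside:
  assumes "x \<notin> closure {x. \<phi> x \<noteq> 0}"
  shows "partial_deriv i \<phi> x = 0"
proof -
  have "((\<lambda>x. 0::real) has_derivative (\<lambda>h. 0)) (at x)" by simp
  then have "(\<phi> has_derivative (\<lambda>h. 0)) (at x)"
  proof (rule has_derivative_transform_within_open)
    show "open (- closure {x. \<phi> x \<noteq> 0})" by auto
    show "x \<in> - closure {x. \<phi> x \<noteq> 0}" using assms by simp
    show "0 = \<phi> y" if "y \<in> - closure {x. \<phi> x \<noteq> 0}" for y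
      using that closure_subset[of "{x. \<phi> x \<noteq> 0}"] by auto
  qed
  from partial_deriv_eq[OF this] show ?thesis by simp
qed

lemma test_fun_outside: "x \<notin> closure {x. \<phi> x \<noteq> 0} \<Longrightarrow> \<phi> x = 0"
  using closure_subset[of "{x. \<phi> x \<noteq> 0}"] by auto

lemma test_fun_L2: "test_fun \<phi> \<Longrightarrow> L2fun \<phi>"
  using compact_support_L2[of \<phi> "closure {x. \<phi> x \<noteq> 0}"] test_fun_continuous test_fun_outside
  by (metis test_fun_def)

lemma test_fun_partial_L2: "test_fun \<phi> \<Longrightarrow> L2fun (partial_deriv i \<phi>)"
  using compact_support_L2[of "partial_deriv i \<phi>" "closure {x. \<phi> x \<noteq> 0}"] test_fun_partial_continuous test_fun_partial_outside
  by (metis test_fun_def)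

lemma test_fun_partial_bounded:
  assumes "test_fun \<phi>" obtains C where "C \<ge> 0" "\<And>x. \<bar>partial_deriv i \<phi> x\<bar> \<le> C"
  using compact_support_L2[of "partial_deriv i \<phi>" "closure {x. \<phi> x \<noteq> 0}"] assms test_fun_partial_continuous test_fun_partial_outside
  by (metis test_fun_def)

section \<open>Weak gradients and the quadratic form of the gradient\<close>

lemma weak_grad_L2: "is_weak_grad u G \<Longrightarrow> L2fun u" "is_weak_grad u G \<Longrightarrow> L2fun (\<lambda>x. G x $ i)"
  by (auto simp: is_weak_grad_def)

lemma is_weak_grad_ip:
  "is_weak_grad u G \<longleftrightarrow> L2fun u \<and> (\<forall>i. L2fun (\<lambda>x. G x $ i)) \<and>
     (\<forall>\<phi> i. test_fun \<phi> \<longrightarrow> ip u (partial_deriv i \<phi>) = - ip (\<lambda>x. G x $ i) \<phi>)"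
  by (simp add: is_weak_grad_def ip_def)

text \<open>Partial derivatives of test functions cannot distinguish \<open>u\<close> from
  \<open>u'\<close>, so each coordinate of the difference of the gradients is orthogonal to all test
  functions.\<close>

lemma weak_grad_unique:
  fixes u u' :: "real^'n::finite \<Rightarrow> real"
  assumes "is_weak_grad u G" "is_weak_grad u' G'" "AE x in lborel. u x = u' x"
  shows "AE x in lborel. G x = G' x"
proof -
  have "AE x in lborel. G x $ i - G' x $ i = 0" for i
  proof (rule AE_zero_if_test_integrals_zero)
    show L: "L2fun (\<lambda>x. G x $ i - G' x $ i)" using assms by (intro L2fun_diff weak_grad_L2)
    fix \<phi> :: "real^'n \<Rightarrow> real" assume t: "test_fun \<phi>"
    have "ip u (partial_deriv i \<phi>) = ip u' (partial_deriv i \<phi>)"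
      using assms weak_grad_L2(1) test_fun_partial_L2[OF t]
      by (intro ip_AE_cong) (auto simp: L2fun_def)
    then have "ip (\<lambda>x. G x $ i - G' x $ i) \<phi> = 0"
      using assms t test_fun_L2[OF t] by (subst ip_diff_left) (auto simp: is_weak_grad_ip)
    then show "(\<integral>x. (G x $ i - G' x $ i) * \<phi> x \<partial>lborel) = 0" by (simp add: ip_def)
  qed
  then have "AE x in lborel. \<forall>i. G x $ i - G' x $ i = 0" by (simp add: AE_all_countable)
  then show ?thesis by eventually_elim (simp add: vec_eq_iff)
qed

lemma weak_grad_lin:
  assumes "is_weak_grad u G" "is_weak_grad v H"
  shows "is_weak_grad (\<lambda>x. a * u x + b * v x) (\<lambda>x. a *\<^sub>R G x + b *\<^sub>R H x)"
  using assms unfolding is_weak_grad_ip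
  by (auto simp: L2fun_lin ip_lin_left test_fun_L2 test_fun_partial_L2)

lemma H1_wgrad: "H1 u \<Longrightarrow> is_weak_grad u (wgrad u)"
  unfolding H1_def wgrad_def by (erule someI_ex)

lemma H1_L2: "H1 u \<Longrightarrow> L2fun u"
  using H1_wgrad weak_grad_L2(1) by blast

lemma wgrad_L2: "H1 u \<Longrightarrow> L2fun (\<lambda>x. wgrad u x $ i)"
  using H1_wgrad weak_grad_L2(2) by blast

text \<open>\<open>wgrad\<close> is a choice among the weak gradients; through this lemma every
  explicitly known gradient may be used to compute \<open>dip\<close>.\<close>

lemma wgrad_AE: "is_weak_grad u G \<Longrightarrow> AE x in lborel. wgrad u x = G x"
  using weak_grad_unique[of u "wgrad u" u G] H1_wgrad unfolding H1_def by blast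

lemma H1_lin: "H1 u \<Longrightarrow> H1 v \<Longrightarrow> H1 (\<lambda>x. a * u x + b * v x)"
  unfolding H1_def using weak_grad_lin by blast

definition dip :: "(real^'n::finite \<Rightarrow> real) \<Rightarrow> (real^'n \<Rightarrow> real) \<Rightarrow> real" where
  "dip u v = (\<Sum>i\<in>UNIV. ip (\<lambda>x. wgrad u x $ i) (\<lambda>x. wgrad v x $ i))"

lemma norm_sq_integral:
  fixes G :: "real^'n::finite \<Rightarrow> real^'n"
  assumes "\<And>i. L2fun (\<lambda>x. G x $ i)"
  shows "integrable lborel (\<lambda>x. (norm (G x))^2)"
    "(\<integral>x. (norm (G x))^2 \<partial>lborel) = (\<Sum>i\<in>UNIV. nsq (\<lambda>x. G x $ i))"
proof -
  have n: "(norm (G x))^2 = (\<Sum>i\<in>UNIV. (G x $ i)^2)" for x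
    unfolding power2_norm_eq_inner inner_vec_def by (simp add: power2_eq_square)
  show "integrable lborel (\<lambda>x. (norm (G x))^2)" unfolding n using assms by (auto simp: L2fun_def)
  show "(\<integral>x. (norm (G x))^2 \<partial>lborel) = (\<Sum>i\<in>UNIV. nsq (\<lambda>x. G x $ i))"
    unfolding n ip_self using assms by (subst Bochner_Integration.integral_sum) (auto simp: L2fun_def)
qed

lemma dip_eq:
  assumes "is_weak_grad u G"
  shows "dip u u = (\<Sum>i\<in>UNIV. nsq (\<lambda>x. G x $ i))"
  unfolding dip_def
proof (rule sum.cong[OF refl])
  fix i
  have a: "AE x in lborel. wgrad u x $ i = G x $ i" using wgrad_AE[OF assms] by eventually_elim simp
  have "H1 u" using assms by (auto simp: H1_def)
  then show "nsq (\<lambda>x. wgrad u x $ i) = nsq (\<lambda>x. G x $ i)"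
    using wgrad_L2[of u i] weak_grad_L2(2)[OF assms, of i] by (intro ip_AE_cong a) (auto simp: L2fun_def)
qed

lemma dip_self: "H1 u \<Longrightarrow> dip u u = (\<integral>x. (norm (wgrad u x))^2 \<partial>lborel)"
  unfolding dip_def using norm_sq_integral(2)[of "wgrad u"] wgrad_L2 by force

lemma dip_nonneg: "0 \<le> dip u u"
  unfolding dip_def by (intro sum_nonneg ip_self_nonneg)

lemma dip_lin_sq:
  assumes "H1 u" "H1 v"
  shows "dip (\<lambda>x. a * u x + b * v x) (\<lambda>x. a * u x + b * v x) = a^2 * dip u u + 2 * a * b * dip u v + b^2 * dip v v"
proof -
  have "is_weak_grad (\<lambda>x. a * u x + b * v x) (\<lambda>x. a *\<^sub>R wgrad u x + b *\<^sub>R wgrad v x)"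
    using assms by (intro weak_grad_lin H1_wgrad)
  from dip_eq[OF this] show ?thesis
    using assms by (simp add: ip_lin_sq wgrad_L2 dip_def sum.distrib sum_distrib_left)
qed

section \<open>Difference quotients\<close>

lemma lborel_integral_affine:
  fixes f :: "real^'n::finite \<Rightarrow> real"
  assumes [measurable]: "f \<in> borel_measurable borel" and c: "c > 0"
  shows "(\<integral>x. f (a + c *\<^sub>R x) \<partial>lborel) = (\<integral>x. f x \<partial>lborel) / c ^ CARD('n)"
proof -
  have "(\<integral>x. f x \<partial>lborel) = (\<integral>x. f x \<partial>(density (distr lborel borel (\<lambda>x. a + c *\<^sub>R x)) (\<lambda>_. ennreal (c ^ CARD('n)))))"
    using lborel_affine[of c a] c by (simp add: ennreal_power)
  also have "\<dots> = (\<integral>x. c ^ CARD('n) * f x \<partial>(distr lborel borel (\<lambda>x. a + c *\<^sub>R x)))"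
    using c by (subst integral_real_density) auto
  also have "\<dots> = (\<integral>x. c ^ CARD('n) * f (a + c *\<^sub>R x) \<partial>lborel)"
    by (subst integral_distr) auto
  finally show ?thesis using c by simp
qed

lemma lborel_integrable_affine:
  fixes f :: "real^'n::finite \<Rightarrow> real"
  assumes f: "integrable lborel f" and c: "c > 0"
  shows "integrable lborel (\<lambda>x. f (a + c *\<^sub>R x))"
proof -
  have [measurable]: "f \<in> borel_measurable borel" using f by auto
  have "integrable (density (distr lborel borel (\<lambda>x. a + c *\<^sub>R x)) (\<lambda>_. ennreal (c ^ CARD('n)))) f"
    using lborel_affine[of c a] c f by (simp add: ennreal_power)
  then have "integrable (distr lborel borel (\<lambda>x. a + c *\<^sub>R x)) (\<lambda>x. c ^ CARD('n) * f x)"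
    using c by (subst (asm) integrable_real_density) auto
  then have "integrable lborel (\<lambda>x. c ^ CARD('n) * f (a + c *\<^sub>R x))"
    by (subst (asm) integrable_distr_eq) auto
  then show ?thesis using c by simp
qed

lemma L2fun_affine:
  assumes "L2fun f" "c > 0"
  shows "L2fun (\<lambda>x. f (a + c *\<^sub>R x))"
proof -
  have [measurable]: "f \<in> borel_measurable borel" using assms L2fun_meas by blast
  show ?thesis unfolding L2fun_def
    using lborel_integrable_affine[OF L2fun_sq[OF assms(1)] assms(2)] by simp
qed

lemma ip_affine:
  fixes f g :: "real^'n::finite \<Rightarrow> real"
  assumes [measurable]: "f \<in> borel_measurable borel" "g \<in> borel_measurable borel" and "c > 0"
  shows "ip (\<lambda>x. f (a + c *\<^sub>R x)) (\<lambda>x. g (a + c *\<^sub>R x)) = ip f g / c ^ CARD('n)"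
  unfolding ip_def using lborel_integral_affine[of "\<lambda>x. f x * g x" c a] assms by simp

lemma lborel_nn_integral_shift:
  fixes f :: "real^'n::finite \<Rightarrow> ennreal"
  assumes [measurable]: "f \<in> borel_measurable borel"
  shows "(\<integral>\<^sup>+x. f (x + h) \<partial>lborel) = (\<integral>\<^sup>+x. f x \<partial>lborel)"
proof -
  have "(\<integral>\<^sup>+x. f x \<partial>lborel) = (\<integral>\<^sup>+x. f x \<partial>(distr lborel borel ((+) h)))"
    by (simp add: lborel_distr_plus)
  also have "\<dots> = (\<integral>\<^sup>+x. f (h + x) \<partial>lborel)" by (subst nn_integral_distr) auto
  finally show ?thesis by (simp add: add.commute)
qed

lemma L2fun_shift: "L2fun f \<Longrightarrow> L2fun (\<lambda>x. f (x + h))"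
  using L2fun_affine[of f 1 h] by (simp add: add.commute)

lemma ip_shift:
  fixes f g :: "real^'n::finite \<Rightarrow> real"
  assumes "f \<in> borel_measurable borel" "g \<in> borel_measurable borel"
  shows "ip (\<lambda>x. f (x + h)) (\<lambda>x. g (x + h)) = ip f g"
  using ip_affine[OF assms, of 1 h] by (simp add: add.commute)

lemma L2fun_nn_integral: "L2fun f \<Longrightarrow> (\<integral>\<^sup>+x. ennreal ((f x)^2) \<partial>lborel) = ennreal (nsq f)"
  unfolding ip_self by (intro nn_integral_eq_integral L2fun_sq) auto

lemma L2fun_nnI:
  assumes "f \<in> borel_measurable borel" "(\<integral>\<^sup>+x. ennreal ((f x)^2) \<partial>lborel) \<le> ennreal M" "0 \<le> M"
  shows "L2fun f" "nsq f \<le> M"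
proof -
  have "integrable lborel (\<lambda>x. (f x)^2)"
    using assms(1,2) by (intro integrableI_bounded) (auto simp: order.strict_trans1)
  then show L: "L2fun f" using assms(1) by (simp add: L2fun_def)
  show "nsq f \<le> M" using L2fun_nn_integral[OF L] assms(2,3) by simp
qed

lemma partial_deriv_shift:
  assumes "\<And>x. f differentiable (at x)"
  shows "partial_deriv i (\<lambda>x. f (x + h)) = (\<lambda>x. partial_deriv i f (x + h))"
proof
  fix x
  have 1: "((\<lambda>x. x + h) has_derivative (\<lambda>k. k)) (at x)" by (auto intro!: derivative_eq_intros)
  have 2: "(f has_derivative frechet_derivative f (at (x + h))) (at (x + h))"
    using assms frechet_derivative_works by blast
  show "partial_deriv i (\<lambda>x. f (x + h)) x = partial_deriv i f (x + h)"
    using partial_deriv_eq[OF has_derivative_compose[OF 1 2]] by (simp add: partial_deriv_def)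
qed

lemma test_fun_iter_differentiable: "test_fun \<phi> \<Longrightarrow> iter_partial is \<phi> differentiable (at x)"
  by (simp add: test_fun_def differentiable_on_def)

lemma iter_partial_shift:
  "test_fun \<phi> \<Longrightarrow> iter_partial is (\<lambda>x. \<phi> (x + h)) = (\<lambda>x. iter_partial is \<phi> (x + h))"
  by (induction "is") (auto simp: partial_deriv_shift test_fun_iter_differentiable)

lemma test_fun_shift:
  assumes t: "test_fun (\<phi> :: real^'n::finite \<Rightarrow> real)"
  shows "test_fun (\<lambda>x. \<phi> (x + h))"
  unfolding test_fun_def
proof
  show "\<forall>is. iter_partial is (\<lambda>x. \<phi> (x + h)) differentiable_on UNIV"
    unfolding iter_partial_shift[OF t] differentiable_on_def
  proof (intro allI ballI)
    fix "is" :: "'n list" and x :: "real^'n"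
    have "((\<lambda>x. x + h) has_derivative (\<lambda>k. k)) (at x)" by (auto intro!: derivative_eq_intros)
    then show "(\<lambda>x. iter_partial is \<phi> (x + h)) differentiable at x"
      using test_fun_iter_differentiable[OF t, of "is" "x + h"] has_derivative_compose
      unfolding differentiable_def by blast
  qed
  have "bounded {x. \<phi> x \<noteq> 0}"
    using t bounded_subset[OF compact_imp_bounded closure_subset] by (auto simp: test_fun_def)
  then have "bounded ((\<lambda>x. (-h) + x) ` {x. \<phi> x \<noteq> 0})" by (rule bounded_translation)
  moreover have "{x. \<phi> (x + h) \<noteq> 0} \<subseteq> (\<lambda>x. (-h) + x) ` {x. \<phi> x \<noteq> 0}"
  proof
    fix x assume "x \<in> {x. \<phi> (x + h) \<noteq> 0}"
    then show "x \<in> (\<lambda>x. (-h) + x) ` {x. \<phi> x \<noteq> 0}" by (intro image_eqI[of _ _ "x + h"]) auto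
  qed
  ultimately have "bounded {x. \<phi> (x + h) \<noteq> 0}" by (rule bounded_subset)
  then show "compact (closure {x. \<phi> (x + h) \<noteq> 0})" by (simp add: compact_closure)
qed

lemma test_fun_partial_shift: "test_fun \<phi> \<Longrightarrow> partial_deriv i (\<lambda>x. \<phi> (x + h)) = (\<lambda>x. partial_deriv i \<phi> (x + h))"
  using iter_partial_shift[of \<phi> "[i]"] by simp

lemma test_fun_line_derivative:
  assumes t: "test_fun \<phi>"
  shows "((\<lambda>r. \<phi> (x - r *\<^sub>R axis i 1)) has_real_derivative (- partial_deriv i \<phi> (x - r *\<^sub>R axis i 1))) (at r)"
proof -
  have 1: "((\<lambda>r. x - r *\<^sub>R axis i 1) has_derivative (\<lambda>k. - (k *\<^sub>R axis i 1))) (at r)"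
    by (auto intro!: derivative_eq_intros)
  have 2: "linear (frechet_derivative \<phi> (at y))" for y
    using test_fun_has_derivative[OF t] has_derivative_linear by blast
  have "((\<lambda>r. \<phi> (x - r *\<^sub>R axis i 1)) has_derivative
      (\<lambda>k. frechet_derivative \<phi> (at (x - r *\<^sub>R axis i 1)) (- (k *\<^sub>R axis i 1)))) (at r)"
    by (rule has_derivative_compose[OF 1 test_fun_has_derivative[OF t]])
  also have "(\<lambda>k. frechet_derivative \<phi> (at (x - r *\<^sub>R axis i 1)) (- (k *\<^sub>R axis i 1)))
      = (\<lambda>k. - partial_deriv i \<phi> (x - r *\<^sub>R axis i 1) * k)"
    by (auto simp: linear_neg[OF 2] linear_scale[OF 2] partial_deriv_def)
  finally show ?thesis unfolding has_field_derivative_def .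
qed

text \<open>The segment runs backwards from \<open>x\<close> because a forward shift of
  \<open>u\<close> becomes a backward shift of the test function.\<close>

lemma test_fun_line_integral:
  assumes t: "test_fun \<phi>" and s: "0 \<le> s"
  shows "(\<integral>r. indicator {0..s} r * partial_deriv i \<phi> (x - r *\<^sub>R axis i 1) \<partial>lborel) = \<phi> x - \<phi> (x - s *\<^sub>R axis i 1)"
proof -
  have "(\<integral>r. indicator {0..s} r *\<^sub>R partial_deriv i \<phi> (x - r *\<^sub>R axis i 1) \<partial>lborel)
      = - \<phi> (x - s *\<^sub>R axis i 1) - (- \<phi> (x - 0 *\<^sub>R axis i 1))"
  proof (rule integral_FTC_Icc[OF s])
    fix r
    have "((\<lambda>r. - \<phi> (x - r *\<^sub>R axis i 1)) has_real_derivative - (- partial_deriv i \<phi> (x - r *\<^sub>R axis i 1))) (at r)"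
      by (intro DERIV_minus test_fun_line_derivative[OF t])
    then show "((\<lambda>r. - \<phi> (x - r *\<^sub>R axis i 1)) has_vector_derivative partial_deriv i \<phi> (x - r *\<^sub>R axis i 1)) (at r within {0..s})"
      by (simp add: has_real_derivative_iff_has_vector_derivative has_vector_derivative_at_within)
    show "continuous_on {0..s} (\<lambda>r. partial_deriv i \<phi> (x - r *\<^sub>R axis i 1))"
      by (rule continuous_on_compose2[OF test_fun_partial_continuous[OF t]]) (auto intro!: continuous_intros)
  qed
  then show ?thesis by simp
qed

text \<open>The hypothesis of Fubini's theorem for both exchanges in
  \<open>weak_grad_steklov\<close>, one with a forward and one with a backward shift, hence the sign
  \<open>\<sigma>\<close>. It follows from |ab| \<le> a^2 + b^2 and translation invariance.\<close>

lemma shear_integrable: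
  fixes f h :: "real^'n::finite \<Rightarrow> real"
  assumes f: "L2fun f" and h: "L2fun h"
  shows "integrable (lborel \<Otimes>\<^sub>M lborel) (\<lambda>(x, r). indicator {0..s} r * (f x * h (x + (\<sigma> * r) *\<^sub>R axis i 1)))"
proof (rule integrableI_bounded)
  have [measurable]: "f \<in> borel_measurable borel" "h \<in> borel_measurable borel" using f h L2fun_meas by auto
  show "(\<lambda>(x, r). indicator {0..s} r * (f x * h (x + (\<sigma> * r) *\<^sub>R axis i 1))) \<in> borel_measurable (lborel \<Otimes>\<^sub>M lborel)"
    by measurable
  let ?F = "\<lambda>x r. ennreal (norm (indicator {0..s} r * (f x * h (x + (\<sigma> * r) *\<^sub>R axis i 1))))"
  have "(\<integral>\<^sup>+z. ennreal (norm (case z of (x, r) \<Rightarrow> indicator {0..s} r * (f x * h (x + (\<sigma> * r) *\<^sub>R axis i 1)))) \<partial>(lborel \<Otimes>\<^sub>M lborel))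
      = (\<integral>\<^sup>+r. \<integral>\<^sup>+x. ?F x r \<partial>lborel \<partial>lborel)"
    by (subst lborel_pair.nn_integral_snd[symmetric]) (auto simp: case_prod_beta)
  also have "\<dots> \<le> (\<integral>\<^sup>+r. ennreal (nsq f + nsq h) * indicator {0..s} r \<partial>lborel)"
  proof (rule nn_integral_mono)
    fix r :: real
    have "(\<integral>\<^sup>+x. ?F x r \<partial>lborel) \<le> (\<integral>\<^sup>+x. (ennreal ((f x)^2) + ennreal ((h (x + (\<sigma> * r) *\<^sub>R axis i 1))^2)) * indicator {0..s} r \<partial>lborel)"
    proof (rule nn_integral_mono)
      fix x
      show "?F x r \<le> (ennreal ((f x)^2) + ennreal ((h (x + (\<sigma> * r) *\<^sub>R axis i 1))^2)) * indicator {0..s} r"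
        using abs_mult_le_squares[of "f x" "h (x + (\<sigma> * r) *\<^sub>R axis i 1)"]
        by (auto simp: indicator_def ennreal_plus[symmetric] simp del: ennreal_plus intro!: ennreal_leI)
    qed
    also have "\<dots> = ((\<integral>\<^sup>+x. ennreal ((f x)^2) \<partial>lborel) + (\<integral>\<^sup>+x. ennreal ((h (x + (\<sigma> * r) *\<^sub>R axis i 1))^2) \<partial>lborel)) * indicator {0..s} r"
      by (subst nn_integral_multc, simp, subst nn_integral_add) auto
    also have "\<dots> = (ennreal (nsq f) + ennreal (nsq h)) * indicator {0..s} r"
      using lborel_nn_integral_shift[of "\<lambda>x. ennreal ((h x)^2)" "(\<sigma> * r) *\<^sub>R axis i 1"]
      by (simp add: L2fun_nn_integral f h)
    finally show "(\<integral>\<^sup>+x. ?F x r \<partial>lborel) \<le> ennreal (nsq f + nsq h) * indicator {0..s} r"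
      by (simp add: ip_self_nonneg)
  qed
  also have "\<dots> = ennreal (nsq f + nsq h) * emeasure lborel {0..s}"
    by (subst nn_integral_cmult) auto
  also have "\<dots> < \<infinity>"
    by (cases "0 \<le> s") (auto simp: ennreal_mult_less_top simp del: ennreal_plus)
  finally show "(\<integral>\<^sup>+z. ennreal (norm (case z of (x, r) \<Rightarrow> indicator {0..s} r * (f x * h (x + (\<sigma> * r) *\<^sub>R axis i 1)))) \<partial>(lborel \<Otimes>\<^sub>M lborel)) < \<infinity>" .
qed

text \<open>A Steklov average without the factor 1/s: applied to a partial derivative it is the
  increment of the function over the segment.\<close>

definition steklov :: "'n::finite \<Rightarrow> real \<Rightarrow> (real^'n \<Rightarrow> real) \<Rightarrow> real^'n \<Rightarrow> real" where
  "steklov i s g x = (\<integral>r. indicator {0..s} r * g (x + r *\<^sub>R axis i 1) \<partial>lborel)"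

text \<open>One factor \<open>s\<close> comes from the Cauchy-Schwarz inequality on the segment, the
  other from integrating the translation-invariant norm over its length. No constant is lost, which
  is the source of the sharp bound for difference quotients.\<close>

lemma steklov_L2:
  fixes g :: "real^'n::finite \<Rightarrow> real"
  assumes g: "L2fun g" and s: "0 \<le> s"
  shows "L2fun (steklov i s g)" "nsq (steklov i s g) \<le> s^2 * nsq g"
proof -
  have [measurable]: "g \<in> borel_measurable borel" using g L2fun_meas by auto
  have m: "steklov i s g \<in> borel_measurable borel" unfolding steklov_def[abs_def] by measurable
  have pt: "ennreal ((steklov i s g x)^2) \<le> ennreal s * (\<integral>\<^sup>+r. ennreal ((g (x + r *\<^sub>R axis i 1))^2) * indicator {0..s} r \<partial>lborel)" for x
  proof -
    let ?w = "\<lambda>r. indicator {0..s} r * g (x + r *\<^sub>R axis i 1)"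
    have "ennreal \<bar>steklov i s g x\<bar> \<le> (\<integral>\<^sup>+r. ennreal (norm (?w r)) \<partial>lborel)"
    \<comment> \<open>Along some lines the integrand may fail to be integrable; there
      \<open>steklov\<close> takes the default value 0 and the bound is trivial.\<close>
    proof (cases "integrable lborel ?w")
      case True
      from integral_norm_bound_ennreal[OF this] show ?thesis by (simp add: steklov_def)
    qed (simp add: steklov_def not_integrable_integral_eq)
    also have "\<dots> = (\<integral>\<^sup>+r. indicator {0..s} r * (ennreal \<bar>g (x + r *\<^sub>R axis i 1)\<bar> * indicator {0..s} r) \<partial>lborel)"
      by (intro nn_integral_cong) (auto simp: indicator_def)
    finally have "(ennreal \<bar>steklov i s g x\<bar>)^2 \<le> (\<integral>\<^sup>+r. indicator {0..s} r * (ennreal \<bar>g (x + r *\<^sub>R axis i 1)\<bar> * indicator {0..s} r) \<partial>lborel)^2"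
      by (intro power_mono) auto
    also have "\<dots> \<le> (\<integral>\<^sup>+r. (indicator {0..s} r)^2 \<partial>lborel) * (\<integral>\<^sup>+r. (ennreal \<bar>g (x + r *\<^sub>R axis i 1)\<bar> * indicator {0..s} r)^2 \<partial>lborel)"
      by (intro Cauchy_Schwarz_nn_integral) auto
    also have "(\<integral>\<^sup>+r. (indicator {0..s} r)^2 \<partial>lborel) = (\<integral>\<^sup>+r. indicator {0..s} r \<partial>lborel)"
      by (intro nn_integral_cong) (auto simp: indicator_def)
    also have "\<dots> = ennreal s" using s by simp
    also have "(\<integral>\<^sup>+r. (ennreal \<bar>g (x + r *\<^sub>R axis i 1)\<bar> * indicator {0..s} r)^2 \<partial>lborel)
        = (\<integral>\<^sup>+r. ennreal ((g (x + r *\<^sub>R axis i 1))^2) * indicator {0..s} r \<partial>lborel)"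
      by (intro nn_integral_cong) (auto simp: indicator_def ennreal_power)
    finally show ?thesis by (simp add: ennreal_power)
  qed
  have "(\<integral>\<^sup>+x. ennreal ((steklov i s g x)^2) \<partial>lborel)
      \<le> (\<integral>\<^sup>+x. ennreal s * (\<integral>\<^sup>+r. ennreal ((g (x + r *\<^sub>R axis i 1))^2) * indicator {0..s} r \<partial>lborel) \<partial>lborel)"
    by (intro nn_integral_mono pt)
  also have "\<dots> = ennreal s * (\<integral>\<^sup>+x. \<integral>\<^sup>+r. ennreal ((g (x + r *\<^sub>R axis i 1))^2) * indicator {0..s} r \<partial>lborel \<partial>lborel)"
    by (intro nn_integral_cmult) measurable
  also have "(\<integral>\<^sup>+x. \<integral>\<^sup>+r. ennreal ((g (x + r *\<^sub>R axis i 1))^2) * indicator {0..s} r \<partial>lborel \<partial>lborel)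
      = (\<integral>\<^sup>+r. \<integral>\<^sup>+x. ennreal ((g (x + r *\<^sub>R axis i 1))^2) * indicator {0..s} r \<partial>lborel \<partial>lborel)"
    by (intro lborel_pair.Fubini'[symmetric]) measurable
  also have "\<dots> = (\<integral>\<^sup>+r. ennreal (nsq g) * indicator {0..s} r \<partial>lborel)"
  proof (rule nn_integral_cong)
    fix r :: real
    have "(\<integral>\<^sup>+x. ennreal ((g (x + r *\<^sub>R axis i 1))^2) * indicator {0..s} r \<partial>lborel)
        = (\<integral>\<^sup>+x. ennreal ((g (x + r *\<^sub>R axis i 1))^2) \<partial>lborel) * indicator {0..s} r"
      by (intro nn_integral_multc) measurable
    then show "(\<integral>\<^sup>+x. ennreal ((g (x + r *\<^sub>R axis i 1))^2) * indicator {0..s} r \<partial>lborel) = ennreal (nsq g) * indicator {0..s} r"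
      using lborel_nn_integral_shift[of "\<lambda>x. ennreal ((g x)^2)" "r *\<^sub>R axis i 1"] by (simp add: L2fun_nn_integral g)
  qed
  also have "\<dots> = ennreal (nsq g) * ennreal s" using s by (subst nn_integral_cmult) auto
  also have "ennreal s * (ennreal (nsq g) * ennreal s) = ennreal (s^2 * nsq g)"
    using s by (simp add: ennreal_mult[symmetric] ip_self_nonneg power2_eq_square mult_ac)
  finally have b: "(\<integral>\<^sup>+x. ennreal ((steklov i s g x)^2) \<partial>lborel) \<le> ennreal (s^2 * nsq g)" .
  show "L2fun (steklov i s g)" "nsq (steklov i s g) \<le> s^2 * nsq g"
    using L2fun_nnI[OF m b] ip_self_nonneg[of g] by simp_all
qed

text \<open>The fundamental theorem of calculus along a coordinate line, by duality: both sides are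
  paired with a test function, Fubini's theorem moves all shifts onto it, and there the classical
  theorem applies.\<close>

lemma weak_grad_steklov:
  fixes u :: "real^'n::finite \<Rightarrow> real"
  assumes G: "is_weak_grad u G" and s: "0 \<le> s"
  shows "AE x in lborel. u (x + s *\<^sub>R axis i 1) - u x = steklov i s (\<lambda>x. G x $ i) x"
proof -
  define g where "g x = G x $ i" for x
  have g: "L2fun g" and u: "L2fun u" using weak_grad_L2[OF G] by (auto simp: g_def[abs_def])
  have [measurable]: "g \<in> borel_measurable borel" "u \<in> borel_measurable borel" using g u L2fun_meas by auto
  let ?e = "axis i 1 :: real^'n"
  have us: "L2fun (\<lambda>x. u (x + s *\<^sub>R ?e))" by (intro L2fun_shift u)
  have st: "L2fun (steklov i s g)" by (rule steklov_L2[OF g s])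
  have "AE x in lborel. u (x + s *\<^sub>R ?e) - u x - steklov i s g x = 0"
  proof (rule AE_zero_if_test_integrals_zero)
    show "L2fun (\<lambda>x. u (x + s *\<^sub>R ?e) - u x - steklov i s g x)" by (intro L2fun_diff us u st)
    fix \<phi> :: "real^'n \<Rightarrow> real" assume t: "test_fun \<phi>"
    have p: "L2fun \<phi>" "L2fun (partial_deriv i \<phi>)" by (intro test_fun_L2 test_fun_partial_L2 t)+
    have [measurable]: "\<phi> \<in> borel_measurable borel" "partial_deriv i \<phi> \<in> borel_measurable borel" using p L2fun_meas by auto
    have A: "ip (steklov i s g) \<phi> = (\<integral>r. indicator {0..s} r * ip g (\<lambda>x. \<phi> (x - r *\<^sub>R ?e)) \<partial>lborel)"
    proof -
      have "ip (steklov i s g) \<phi> = (\<integral>x. (\<integral>r. indicator {0..s} r * (\<phi> x * g (x + (1 * r) *\<^sub>R ?e)) \<partial>lborel) \<partial>lborel)"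
        unfolding ip_def steklov_def
        by (intro Bochner_Integration.integral_cong refl) (simp add: mult_ac flip: integral_mult_left_zero integral_mult_right_zero)
      also have "\<dots> = (\<integral>r. (\<integral>x. indicator {0..s} r * (\<phi> x * g (x + (1 * r) *\<^sub>R ?e)) \<partial>lborel) \<partial>lborel)"
        by (rule lborel_pair.Fubini_integral[symmetric, OF shear_integrable[OF p(1) g]])
      also have "\<dots> = (\<integral>r. indicator {0..s} r * ip g (\<lambda>x. \<phi> (x - r *\<^sub>R ?e)) \<partial>lborel)"
      proof (intro Bochner_Integration.integral_cong refl)
        fix r :: real
        have "ip g (\<lambda>x. \<phi> (x - r *\<^sub>R ?e)) = ip (\<lambda>x. g (x + r *\<^sub>R ?e)) \<phi>"
          using ip_shift[of g "\<lambda>x. \<phi> (x - r *\<^sub>R ?e)" "r *\<^sub>R ?e"] by simp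
        then show "(\<integral>x. indicator {0..s} r * (\<phi> x * g (x + (1 * r) *\<^sub>R ?e)) \<partial>lborel) = indicator {0..s} r * ip g (\<lambda>x. \<phi> (x - r *\<^sub>R ?e))"
          by (simp add: ip_def mult.commute)
      qed
      finally show ?thesis .
    qed
    have B: "ip u \<phi> - ip u (\<lambda>x. \<phi> (x - s *\<^sub>R ?e)) = (\<integral>r. indicator {0..s} r * ip u (\<lambda>x. partial_deriv i \<phi> (x - r *\<^sub>R ?e)) \<partial>lborel)"
    proof -
      have "ip u \<phi> - ip u (\<lambda>x. \<phi> (x - s *\<^sub>R ?e)) = ip u (\<lambda>x. \<phi> x - \<phi> (x - s *\<^sub>R ?e))"
        using L2fun_shift[OF p(1), of "- s *\<^sub>R ?e"] by (intro ip_diff_right[symmetric] p u) simp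
      also have "\<dots> = (\<integral>x. (\<integral>r. indicator {0..s} r * (u x * partial_deriv i \<phi> (x + (-1 * r) *\<^sub>R ?e)) \<partial>lborel) \<partial>lborel)"
        unfolding ip_def test_fun_line_integral[OF t s, symmetric, where i=i]
        by (intro Bochner_Integration.integral_cong refl) (simp add: mult_ac flip: integral_mult_left_zero integral_mult_right_zero)
      also have "\<dots> = (\<integral>r. (\<integral>x. indicator {0..s} r * (u x * partial_deriv i \<phi> (x + (-1 * r) *\<^sub>R ?e)) \<partial>lborel) \<partial>lborel)"
        by (rule lborel_pair.Fubini_integral[symmetric, OF shear_integrable[OF u p(2)]])
      finally show ?thesis by (simp add: ip_def)
    qed
    \<comment> \<open>The definition of the weak gradient enters here, for the shifted test
      function.\<close>
    have C: "ip u (\<lambda>x. partial_deriv i \<phi> (x - r *\<^sub>R ?e)) = - ip g (\<lambda>x. \<phi> (x - r *\<^sub>R ?e))" for r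
    proof -
      have "test_fun (\<lambda>x. \<phi> (x - r *\<^sub>R ?e))" using test_fun_shift[OF t, of "- r *\<^sub>R ?e"] by simp
      then have "ip u (partial_deriv i (\<lambda>x. \<phi> (x - r *\<^sub>R ?e))) = - ip g (\<lambda>x. \<phi> (x - r *\<^sub>R ?e))"
        using G by (simp add: is_weak_grad_ip g_def[abs_def])
      then show ?thesis using test_fun_partial_shift[OF t, of i "- r *\<^sub>R ?e"] by simp
    qed
    have D: "ip (\<lambda>x. u (x + s *\<^sub>R ?e)) \<phi> = ip u (\<lambda>x. \<phi> (x - s *\<^sub>R ?e))"
      using ip_shift[of u "\<lambda>x. \<phi> (x - s *\<^sub>R ?e)" "s *\<^sub>R ?e"] by simp
    have "ip (\<lambda>x. u (x + s *\<^sub>R ?e) - u x - steklov i s g x) \<phi> = 0"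
      using A B D unfolding C by (simp add: ip_diff_left L2fun_diff us u st p)
    then show "(\<integral>x. (u (x + s *\<^sub>R ?e) - u x - steklov i s g x) * \<phi> x \<partial>lborel) = 0" by (simp add: ip_def)
  qed
  then show ?thesis unfolding g_def[abs_def] by eventually_elim simp
qed

abbreviation diffq :: "'n::finite \<Rightarrow> real \<Rightarrow> (real^'n \<Rightarrow> real) \<Rightarrow> real^'n \<Rightarrow> real" where
  "diffq i s u \<equiv> (\<lambda>x. u (x + s *\<^sub>R axis i 1) - u x)"

lemma L2fun_diffq: "L2fun u \<Longrightarrow> L2fun (diffq i s u)"
  by (intro L2fun_diff L2fun_shift)

lemma weak_grad_diffq:
  fixes u :: "real^'n::finite \<Rightarrow> real"
  assumes G: "is_weak_grad u G"
  shows "nsq (diffq i s u) \<le> s^2 * nsq (\<lambda>x. G x $ i)"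
proof -
  have u: "L2fun u" using weak_grad_L2[OF G] by auto
  have pos: "nsq (diffq i s u) \<le> s^2 * nsq (\<lambda>x. G x $ i)" if s: "0 \<le> s" for s
  proof -
    note st = steklov_L2[OF weak_grad_L2(2)[OF G] s, of i i]
    have "nsq (diffq i s u) = nsq (steklov i s (\<lambda>x. G x $ i))"
      using weak_grad_steklov[OF G s, of i] L2fun_diffq[OF u, of s i] st(1) by (intro ip_AE_cong) (auto simp: L2fun_def)
    then show ?thesis using st(2) by simp
  qed
  show ?thesis
  proof (cases "0 \<le> s")
    case False
    have [measurable]: "u \<in> borel_measurable borel" using u L2fun_meas by auto
    \<comment> \<open>Translation by -s turns the increment with step s into minus the increment
      with step -s.\<close>
    have "nsq (diffq i s u) = nsq (\<lambda>x. diffq i s u (x + (-s) *\<^sub>R axis i 1))"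
      by (rule ip_shift[symmetric]) measurable
    also have "\<dots> = nsq (diffq i (-s) u)"
      unfolding ip_def by (intro Bochner_Integration.integral_cong) (auto simp: algebra_simps)
    also have "\<dots> \<le> s^2 * nsq (\<lambda>x. G x $ i)" using pos[of "-s"] False by simp
    finally show ?thesis .
  qed (rule pos)
qed


text \<open>Bounded difference quotients have a weak limit, which is the partial derivative, and
  weak lower semicontinuity of the norm hands the bound \<open>M i\<close> over without
  loss.\<close>

lemma weak_grad_from_diffq:
  fixes w :: "real^'n::finite \<Rightarrow> real"
  assumes w: "L2fun w"
    and M: "\<And>i s. 0 < s \<Longrightarrow> s \<le> 1 \<Longrightarrow> nsq (diffq i s w) \<le> s^2 * M i"
  obtains G where "is_weak_grad w G" "\<And>i. nsq (\<lambda>x. G x $ i) \<le> M i"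
proof -
  have [measurable]: "w \<in> borel_measurable borel" using w L2fun_meas by auto
  have "\<exists>g. L2fun g \<and> nsq g \<le> M i \<and> (\<forall>\<phi>. test_fun \<phi> \<longrightarrow> ip w (partial_deriv i \<phi>) = - ip g \<phi>)" for i
  proof -
    define s where "s n = 1 / real (Suc n)" for n
    have s: "0 < s n" "s n \<le> 1" for n by (auto simp: s_def)
    define f where "f n = (\<lambda>x. (1 / s n) * diffq i (s n) w x)" for n
    have fL: "L2fun (f n)" for n unfolding f_def by (intro L2fun_scale L2fun_diffq w)
    have fM: "nsq (f n) \<le> M i" for n
    proof -
      have "nsq (f n) = (1 / s n)^2 * nsq (diffq i (s n) w)"
        unfolding f_def ip_def by (simp add: power2_eq_square mult_ac flip: integral_mult_right_zero)
      also have "\<dots> \<le> (1 / s n)^2 * ((s n)^2 * M i)" by (intro mult_left_mono M s) auto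
      also have "\<dots> = M i" using s(1)[of n] by (simp add: field_simps)
      finally show ?thesis .
    qed
    obtain g r where g: "L2fun g" and r: "strict_mono (r::nat\<Rightarrow>nat)" and wc: "wconv (\<lambda>n. f (r n)) g"
      by (rule L2_weak_compact[OF fL fM])
    have "nsq g \<le> M i" by (rule wconv_ip_le[OF fL fM g wc])
    moreover have "ip w (partial_deriv i \<phi>) = - ip g \<phi>" if t: "test_fun \<phi>" for \<phi>
    proof -
      have p: "L2fun \<phi>" "L2fun (partial_deriv i \<phi>)" by (intro test_fun_L2 test_fun_partial_L2 t)+
      have [measurable]: "\<phi> \<in> borel_measurable borel" using p L2fun_meas by auto
      \<comment> \<open>Steps are at most 1, so all difference quotients of the test function vanish
        outside the ball of radius \<open>R + 1\<close>.\<close>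
      obtain R where R: "R \<ge> 0" "\<And>x. \<phi> x \<noteq> 0 \<Longrightarrow> norm x \<le> R"
      proof -
        have "bounded {x. \<phi> x \<noteq> 0}"
          using t bounded_subset[OF compact_imp_bounded closure_subset] by (auto simp: test_fun_def)
        then obtain R where R: "\<forall>x\<in>{x. \<phi> x \<noteq> 0}. norm x \<le> R" unfolding bounded_iff by blast
        then show ?thesis by (intro that[of "max R 0"]) (auto simp: max.coboundedI1)
      qed
      obtain C where C: "C \<ge> 0" "\<And>x. \<bar>partial_deriv i \<phi> x\<bar> \<le> C" using test_fun_partial_bounded[OF t, of i] by metis
      \<comment> \<open>Discrete integration by parts: the forward quotient of \<open>w\<close>
        becomes the backward quotient of the test function, with limit minus its partial
        derivative.\<close>
      define q where "q n x = (\<phi> (x - s n *\<^sub>R axis i 1) - \<phi> x) / s n" for n x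
      have ipf: "ip (f n) \<phi> = ip w (q n)" for n
      proof -
        have sh: "L2fun (\<lambda>x. \<phi> (x - s n *\<^sub>R axis i 1))" using L2fun_shift[OF p(1), of "- s n *\<^sub>R axis i 1"] by simp
        have "ip (f n) \<phi> = (1 / s n) * ip (diffq i (s n) w) \<phi>"
          unfolding f_def ip_def by (simp add: mult_ac flip: integral_mult_right_zero)
        also have "ip (diffq i (s n) w) \<phi> = ip (\<lambda>x. w (x + s n *\<^sub>R axis i 1)) \<phi> - ip w \<phi>"
          by (intro ip_diff_left L2fun_shift w p)
        also have "ip (\<lambda>x. w (x + s n *\<^sub>R axis i 1)) \<phi> = ip w (\<lambda>x. \<phi> (x - s n *\<^sub>R axis i 1))"
          using ip_shift[of w "\<lambda>x. \<phi> (x - s n *\<^sub>R axis i 1)" "s n *\<^sub>R axis i 1"] by simp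
        also have "ip w (\<lambda>x. \<phi> (x - s n *\<^sub>R axis i 1)) - ip w \<phi> = ip w (\<lambda>x. \<phi> (x - s n *\<^sub>R axis i 1) - \<phi> x)"
          by (intro ip_diff_right[symmetric] w p sh)
        also have "(1 / s n) * \<dots> = ip w (q n)"
          unfolding q_def ip_def by (simp add: field_simps flip: integral_mult_right_zero)
        finally show ?thesis .
      qed
      have q_lim: "(\<lambda>n. q n x) \<longlonglongrightarrow> - partial_deriv i \<phi> x" for x
      proof -
        have "((\<lambda>r. \<phi> (x - r *\<^sub>R axis i 1)) has_real_derivative (- partial_deriv i \<phi> (x - 0 *\<^sub>R axis i 1))) (at 0)"
          by (rule test_fun_line_derivative[OF t])
        then have l: "(\<lambda>h. (\<phi> (x - h *\<^sub>R axis i 1) - \<phi> x) / h) \<midarrow>0\<rightarrow> - partial_deriv i \<phi> x"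
          by (simp add: DERIV_def)
        have "filterlim s (at 0) sequentially"
          unfolding filterlim_at s_def using LIMSEQ_inverse_real_of_nat by (auto simp: inverse_eq_divide)
        from filterlim_compose[OF l this] show ?thesis by (simp add: q_def)
      qed
      \<comment> \<open>An integrable majorant for dominated convergence: the mean value bound
        inside the ball, zero outside.\<close>
      have q_bd: "\<bar>q n x\<bar> \<le> C * indicat_real (cball 0 (R + 1)) x" for n x
      proof (cases "x \<in> cball 0 (R + 1)")
        case False
        then have nx: "norm x > R + 1" by simp
        have "norm x \<le> norm (x - s n *\<^sub>R axis i 1) + norm (s n *\<^sub>R axis i 1 :: real^'n)"
          by (metis norm_triangle_sub add.commute)
        then have "norm (x - s n *\<^sub>R axis i 1) > R" using nx s[of n] by (simp add: norm_axis_1)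
        then have "\<phi> x = 0" "\<phi> (x - s n *\<^sub>R axis i 1) = 0" using R nx by force+
        then show ?thesis using C by (simp add: q_def)
      next
        case True
        have "\<bar>\<phi> (x - s n *\<^sub>R axis i 1) - \<phi> (x - 0 *\<^sub>R axis i 1)\<bar> \<le> C * \<bar>s n - 0\<bar>"
        proof -
          have "norm (\<phi> (x - s n *\<^sub>R axis i 1) - \<phi> (x - 0 *\<^sub>R axis i 1)) \<le> C * norm (s n - 0)"
            by (rule field_differentiable_bound[of UNIV _ "\<lambda>r. - partial_deriv i \<phi> (x - r *\<^sub>R axis i 1)"])
               (auto intro: test_fun_line_derivative[OF t] C)
          then show ?thesis by simp
        qed
        then show ?thesis using True s[of n] by (simp add: q_def field_simps)
      qed
      have q_m: "q n \<in> borel_measurable borel" for n unfolding q_def by measurable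
      have ind: "L2fun (indicat_real (cball 0 (R + 1) :: (real^'n) set))"
        using emeasure_bounded_finite[of "cball 0 (R + 1) :: (real^'n) set"] by (intro L2fun_indicator) auto
      have "(\<lambda>n. \<integral>x. w x * q n x \<partial>lborel) \<longlonglongrightarrow> (\<integral>x. w x * (- partial_deriv i \<phi> x) \<partial>lborel)"
      proof (rule integral_dominated_convergence)
        show "integrable lborel (\<lambda>x. \<bar>w x * (C * indicat_real (cball 0 (R + 1)) x)\<bar>)"
          by (intro integrable_abs L2fun_mult_integrable w L2fun_scale ind)
        show "AE x in lborel. (\<lambda>n. w x * q n x) \<longlonglongrightarrow> w x * (- partial_deriv i \<phi> x)"
          by (intro AE_I2 tendsto_intros q_lim)
        show "AE x in lborel. norm (w x * q n x) \<le> \<bar>w x * (C * indicat_real (cball 0 (R + 1)) x)\<bar>" for n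
          using q_bd[of n] C(1) by (intro AE_I2) (auto simp: abs_mult intro!: mult_left_mono)
        show "(\<lambda>x. w x * q n x) \<in> borel_measurable lborel" for n using q_m[of n] by measurable
        show "(\<lambda>x. w x * (- partial_deriv i \<phi> x)) \<in> borel_measurable lborel"
          using p(2)[THEN L2fun_meas] by measurable
      qed
      then have "(\<lambda>n. ip (f n) \<phi>) \<longlonglongrightarrow> - ip w (partial_deriv i \<phi>)"
        unfolding ipf by (simp add: ip_def)
      then have "(\<lambda>n. ip (f (r n)) \<phi>) \<longlonglongrightarrow> - ip w (partial_deriv i \<phi>)"
        using LIMSEQ_subseq_LIMSEQ[OF _ r, of "\<lambda>n. ip (f n) \<phi>"] by (simp add: comp_def)
      moreover have "(\<lambda>n. ip (f (r n)) \<phi>) \<longlonglongrightarrow> ip g \<phi>" using wc p(1) by (simp add: wconv_def)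
      ultimately have "- ip w (partial_deriv i \<phi>) = ip g \<phi>" by (rule LIMSEQ_unique)
      then show ?thesis by simp
    qed
    ultimately show ?thesis using g by blast
  qed
  then obtain g where g: "\<And>i. L2fun (g i)" "\<And>i. nsq (g i) \<le> M i"
    "\<And>i \<phi>. test_fun \<phi> \<Longrightarrow> ip w (partial_deriv i \<phi>) = - ip (g i) \<phi>" by metis
  have "is_weak_grad w (\<lambda>x. \<chi> i. g i x)"
    unfolding is_weak_grad_ip using w g by simp
  then show ?thesis using that[of "\<lambda>x. \<chi> i. g i x"] g(2) by simp
qed

lemma H1_diffq:
  "H1 u \<Longrightarrow> nsq (diffq i s u) \<le> s^2 * nsq (\<lambda>x. wgrad u x $ i)"
  by (rule weak_grad_diffq[OF H1_wgrad])

lemma H1_from_diffq: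
  fixes w :: "real^'n::finite \<Rightarrow> real"
  assumes w: "L2fun w"
    and M: "\<And>i s. 0 < s \<Longrightarrow> s \<le> 1 \<Longrightarrow> nsq (diffq i s w) \<le> s^2 * M i"
  shows "H1 w" "dip w w \<le> (\<Sum>i\<in>UNIV. M i)"
proof -
  obtain G where G: "is_weak_grad w G" "\<And>i. nsq (\<lambda>x. G x $ i) \<le> M i"
    using weak_grad_from_diffq[OF w M] by blast
  show "H1 w" using G(1) by (auto simp: H1_def)
  show "dip w w \<le> (\<Sum>i\<in>UNIV. M i)" unfolding dip_eq[OF G(1)] by (intro sum_mono G)
qed

section \<open>Absolute values, dilations and cut-offs of Sobolev functions\<close>

lemma ip_self_mono:
  assumes "L2fun g" "f \<in> borel_measurable borel" "\<And>x. \<bar>f x\<bar> \<le> \<bar>g x\<bar>"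
  shows "nsq f \<le> nsq g"
  unfolding ip_self
proof (rule integral_mono)
  have "L2fun f" using assms by (intro L2fun_bound[OF assms(1)]) auto
  then show "integrable lborel (\<lambda>x. (f x)\<^sup>2)" by (rule L2fun_sq)
qed (use assms in \<open>auto simp: L2fun_sq abs_le_square_iff\<close>)

text \<open>The reverse triangle inequality bounds each increment of |u| by that of u. With a sharp
  constant this gives the energy inequality that makes the ground state nonnegative.\<close>

lemma H1_abs:
  fixes u :: "real^'n::finite \<Rightarrow> real"
  assumes u: "H1 u"
  shows "H1 (\<lambda>x. \<bar>u x\<bar>)" "dip (\<lambda>x. \<bar>u x\<bar>) (\<lambda>x. \<bar>u x\<bar>) \<le> dip u u"
proof -
  have uL: "L2fun u" using u by (rule H1_L2)
  have [measurable]: "u \<in> borel_measurable borel" using uL L2fun_meas by auto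
  have L: "L2fun (\<lambda>x. \<bar>u x\<bar>)" by (rule L2fun_bound[OF uL]) auto
  have "nsq (diffq i s (\<lambda>x. \<bar>u x\<bar>)) \<le> s^2 * nsq (\<lambda>x. wgrad u x $ i)" for i s
  proof -
    have "nsq (diffq i s (\<lambda>x. \<bar>u x\<bar>)) \<le> nsq (diffq i s u)"
      by (rule ip_self_mono[OF L2fun_diffq[OF uL]]) auto
    then show ?thesis using H1_diffq[OF u, where i=i and s=s] by linarith
  qed
  from H1_from_diffq[OF L this]
  show "H1 (\<lambda>x. \<bar>u x\<bar>)" "dip (\<lambda>x. \<bar>u x\<bar>) (\<lambda>x. \<bar>u x\<bar>) \<le> dip u u"
    by (simp_all add: dip_def)
qed

text \<open>The increment of the dilated function with step s is the dilated increment of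
  \<open>u\<close> with step c s: the step contributes \<open>c^2\<close>, the change of variables
  the power of \<open>c\<close> in the denominator.\<close>

lemma H1_affine:
  fixes u :: "real^'n::finite \<Rightarrow> real"
  assumes u: "H1 u" and c: "c > 0"
  shows "H1 (\<lambda>x. u (a + c *\<^sub>R x))"
    "dip (\<lambda>x. u (a + c *\<^sub>R x)) (\<lambda>x. u (a + c *\<^sub>R x)) \<le> c^2 / c ^ CARD('n) * dip u u"
proof -
  have uL: "L2fun u" using u by (rule H1_L2)
  have m[measurable]: "u \<in> borel_measurable borel" using uL L2fun_meas by auto
  have "nsq (diffq i s (\<lambda>x. u (a + c *\<^sub>R x)))
      \<le> s^2 * (c^2 / c ^ CARD('n) * nsq (\<lambda>x. wgrad u x $ i))" for i s
  proof -
    have "diffq i s (\<lambda>x. u (a + c *\<^sub>R x)) = (\<lambda>x. diffq i (c * s) u (a + c *\<^sub>R x))"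
      by (simp add: algebra_simps)
    then have "nsq (diffq i s (\<lambda>x. u (a + c *\<^sub>R x))) = nsq (diffq i (c * s) u) / c ^ CARD('n)"
      using ip_affine[of "diffq i (c * s) u" "diffq i (c * s) u" c a] c by simp
    also have "\<dots> \<le> (c * s)^2 * nsq (\<lambda>x. wgrad u x $ i) / c ^ CARD('n)"
      using c by (intro divide_right_mono H1_diffq u) auto
    finally show ?thesis by (simp add: power_mult_distrib mult_ac)
  qed
  from H1_from_diffq[OF L2fun_affine[OF uL c] this]
  show "H1 (\<lambda>x. u (a + c *\<^sub>R x))"
    "dip (\<lambda>x. u (a + c *\<^sub>R x)) (\<lambda>x. u (a + c *\<^sub>R x)) \<le> c^2 / c ^ CARD('n) * dip u u"
    by (simp_all add: dip_def sum_distrib_left)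
qed

text \<open>A discrete product rule: the increment of \<psi> u is the shifted \<psi> times the
  increment of u, plus the increment of \<psi> times u. As \<open>K\<close> tends to 0 the bound
  tends to \<open>dip u u\<close>, so a wide cut-off costs little.\<close>

lemma H1_cutoff:
  fixes u \<psi> :: "real^'n::finite \<Rightarrow> real"
  assumes u: "H1 u" and m[measurable]: "\<psi> \<in> borel_measurable borel"
    and b: "\<And>x. \<bar>\<psi> x\<bar> \<le> 1" and l: "\<And>x y. \<bar>\<psi> x - \<psi> y\<bar> \<le> K * norm (x - y)" and K: "K \<ge> 0"
  shows "H1 (\<lambda>x. \<psi> x * u x)"
    "dip (\<lambda>x. \<psi> x * u x) (\<lambda>x. \<psi> x * u x) \<le> (\<Sum>i\<in>UNIV. (sqrt (nsq (\<lambda>x. wgrad u x $ i)) + K * sqrt (nsq u))^2)"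
proof -
  have uL: "L2fun u" using u by (rule H1_L2)
  have [measurable]: "u \<in> borel_measurable borel" using uL L2fun_meas by auto
  have L: "L2fun (\<lambda>x. \<psi> x * u x)" using b
    by (intro L2fun_bound[OF uL]) (auto simp: abs_mult intro!: mult_left_le_one_le)
  have "nsq (diffq i s (\<lambda>x. \<psi> x * u x))
      \<le> s^2 * (sqrt (nsq (\<lambda>x. wgrad u x $ i)) + K * sqrt (nsq u))^2" if s: "0 < s" for i s
  proof -
    define f where "f x = \<psi> (x + s *\<^sub>R axis i 1) * diffq i s u x" for x
    define g where "g x = (\<psi> (x + s *\<^sub>R axis i 1) - \<psi> x) * u x" for x
    have fm: "f \<in> borel_measurable borel" "g \<in> borel_measurable borel" unfolding f_def g_def by measurable
    have fb: "\<bar>f x\<bar> \<le> \<bar>diffq i s u x\<bar>" for x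
      unfolding f_def abs_mult using b by (intro mult_left_le_one_le) auto
    have gb: "\<bar>g x\<bar> \<le> \<bar>K * s * u x\<bar>" for x
      using l[of "x + s *\<^sub>R axis i 1" x] s K unfolding g_def abs_mult
      by (intro mult_right_mono) (auto simp: norm_axis_1)
    have fL: "L2fun f" by (rule L2fun_bound[OF L2fun_diffq[OF uL]]) (use fm fb in auto)
    have gL: "L2fun g" by (rule L2fun_bound[OF L2fun_scale[OF uL]]) (use fm gb in auto)
    have "sqrt (nsq f) \<le> sqrt (nsq (diffq i s u))"
      using ip_self_mono[OF L2fun_diffq[OF uL] fm(1) fb] by simp
    also have "\<dots> \<le> sqrt (s^2 * nsq (\<lambda>x. wgrad u x $ i))"
      using H1_diffq[OF u, where i=i and s=s] by simp
    finally have 1: "sqrt (nsq f) \<le> s * sqrt (nsq (\<lambda>x. wgrad u x $ i))"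
      using s by (simp add: real_sqrt_mult)
    have "nsq g \<le> nsq (\<lambda>x. (K * s) * u x)"
      using ip_self_mono[OF L2fun_scale[OF uL] fm(2) gb] by simp
    also have "\<dots> = (K * s)^2 * nsq u"
      using ip_lin_sq[OF uL uL, of "K * s" 0] by simp
    finally have "sqrt (nsq g) \<le> sqrt ((K * s)^2 * nsq u)" by simp
    then have 2: "sqrt (nsq g) \<le> s * (K * sqrt (nsq u))"
      using s K by (simp add: real_sqrt_mult mult_ac)
    have "diffq i s (\<lambda>x. \<psi> x * u x) = (\<lambda>x. f x + g x)" by (auto simp: f_def g_def algebra_simps)
    then have "sqrt (nsq (diffq i s (\<lambda>x. \<psi> x * u x))) \<le> sqrt (nsq f) + sqrt (nsq g)"
      using L2_triangle[OF fL gL] by simp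
    also have "\<dots> \<le> s * (sqrt (nsq (\<lambda>x. wgrad u x $ i)) + K * sqrt (nsq u))"
      using 1 2 by (simp add: distrib_left)
    finally show ?thesis
      using real_sqrt_le_iff sqrt_le_D by (fastforce simp: power_mult_distrib[symmetric])
  qed
  from H1_from_diffq[OF L this]
  show "H1 (\<lambda>x. \<psi> x * u x)"
    "dip (\<lambda>x. \<psi> x * u x) (\<lambda>x. \<psi> x * u x) \<le> (\<Sum>i\<in>UNIV. (sqrt (nsq (\<lambda>x. wgrad u x $ i)) + K * sqrt (nsq u))^2)"
    by simp_all
qed

definition tent :: "real \<Rightarrow> real^'n::finite \<Rightarrow> real" where
  "tent R x = max 0 (min 1 (2 - norm x / R))"

lemma tent_props:
  assumes "R > 0"
  shows "tent R \<in> borel_measurable borel" "0 \<le> tent R x" "\<bar>tent R x\<bar> \<le> 1"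
    "\<bar>tent R x - tent R y\<bar> \<le> (1 / R) * norm (x - y)"
    "norm x \<le> R \<Longrightarrow> tent R x = 1" "2 * R \<le> norm x \<Longrightarrow> tent R x = 0"
proof -
  show "tent R \<in> borel_measurable borel" unfolding tent_def[abs_def] by measurable
  show "0 \<le> tent R x" "\<bar>tent R x\<bar> \<le> 1" by (auto simp: tent_def)
  have "\<bar>tent R x - tent R y\<bar> \<le> \<bar>norm x / R - norm y / R\<bar>" unfolding tent_def by (auto simp: max_def min_def abs_if)
  also have "\<dots> = (1 / R) * \<bar>norm x - norm y\<bar>" using assms by (simp add: abs_if field_simps)
  also have "\<dots> \<le> (1 / R) * norm (x - y)" using assms norm_triangle_ineq3[of x y] by (intro mult_left_mono) auto
  finally show "\<bar>tent R x - tent R y\<bar> \<le> (1 / R) * norm (x - y)" .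
  show "norm x \<le> R \<Longrightarrow> tent R x = 1" "2 * R \<le> norm x \<Longrightarrow> tent R x = 0"
    using assms by (auto simp: tent_def field_simps)
qed

text \<open>A concrete element of the space, used later to show that the supremum of the quotient is
  positive.\<close>

lemma H1_tent: "H1 (tent 1 :: real^'n::finite \<Rightarrow> real)"
proof -
  note cp = tent_props[of 1, simplified]
  have m[measurable]: "tent 1 \<in> borel_measurable (borel :: (real^'n) measure)" by (rule cp)
  have ind: "L2fun (indicat_real (cball 0 r :: (real^'n) set))" for r
    using emeasure_bounded_finite[of "cball 0 r :: (real^'n) set"] by (intro L2fun_indicator) auto
  have "\<bar>tent 1 x\<bar> \<le> \<bar>indicat_real (cball 0 2) x\<bar>" for x :: "real^'n"
    using cp(3)[of x] cp(6)[of x] by (cases "norm x \<le> 2") auto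
  then have L: "L2fun (tent 1 :: real^'n \<Rightarrow> real)"
    by (intro L2fun_bound[OF ind[of 2]]) auto
  \<comment> \<open>The function vanishes outside radius 2 and steps are at most 1, hence the ball
    of radius 3.\<close>
  have "nsq (diffq i s (tent 1)) \<le> s^2 * ip (indicat_real (cball 0 3 :: (real^'n) set)) (indicat_real (cball 0 3))"
    if s: "0 < s" "s \<le> 1" for i :: 'n and s
  proof -
    have "\<bar>diffq i s (tent 1) x\<bar> \<le> \<bar>s * indicat_real (cball 0 3 :: (real^'n) set) x\<bar>" for x
    proof (cases "x \<in> cball 0 3")
      case True
      then show ?thesis using cp(4)[of "x + s *\<^sub>R axis i 1" x] s by (simp add: norm_axis_1)
    next
      case False
      have "norm x \<le> norm (x + s *\<^sub>R axis i 1) + norm (s *\<^sub>R axis i 1 :: real^'n)"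
        by (metis add_diff_cancel_right' norm_triangle_ineq4)
      then have "norm (x + s *\<^sub>R axis i 1) \<ge> 2" using False s by (simp add: norm_axis_1)
      then have "tent 1 (x + s *\<^sub>R axis i 1) = 0" "tent 1 x = 0"
        using False cp(6)[of "x + s *\<^sub>R axis i 1"] cp(6)[of x] by auto
      then show ?thesis by simp
    qed
    then have "nsq (diffq i s (tent 1)) \<le> ip (\<lambda>x. s * indicat_real (cball 0 3 :: (real^'n) set) x) (\<lambda>x. s * indicat_real (cball 0 3) x)"
      by (intro ip_self_mono L2fun_scale ind) auto
    also have "\<dots> = s^2 * ip (indicat_real (cball 0 3 :: (real^'n) set)) (indicat_real (cball 0 3))"
      using ip_lin_sq[OF ind[of 3] ind[of 3], of s 0] by simp
    finally show ?thesis .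
  qed
  from H1_from_diffq(1)[OF L this] show ?thesis .
qed

section \<open>Dyadic averages, local compactness and the Sobolev inequality\<close>

text \<open>The translation is carried out one coordinate at a time, by induction over the set of
  coordinates already moved. The triangle inequality adds the lengths, and Cauchy-Schwarz over the
  coordinates produces the dimension factor.\<close>

lemma H1_translate:
  fixes u :: "real^'n::finite \<Rightarrow> real"
  assumes u: "H1 u" and h: "\<And>i. \<bar>h $ i\<bar> \<le> l"
  shows "nsq (\<lambda>x. u (x + h) - u x) \<le> l^2 * (CARD('n) * dip u u)"
proof -
  have uL: "L2fun u" using u by (rule H1_L2)
  have m[measurable]: "u \<in> borel_measurable borel" using uL L2fun_meas by auto
  have l: "0 \<le> l" using h[of undefined] by linarith
  define g where "g i = sqrt (nsq (\<lambda>x. wgrad u x $ i))" for i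
  have g: "0 \<le> g i" for i by (simp add: g_def ip_self_nonneg)
  have "sqrt (nsq (\<lambda>x. u (x + (\<Sum>i\<in>S. h $ i *\<^sub>R axis i 1)) - u x)) \<le> (\<Sum>i\<in>S. l * g i)"
    if "finite S" for S :: "'n set"
    using that
  proof induction
    case empty
    then show ?case by (simp add: ip_def)
  next
    case (insert j S)
    let ?k = "\<Sum>i\<in>S. h $ i *\<^sub>R axis i 1 :: real^'n"
    define a where "a x = u (x + ?k) - u x" for x
    have aL: "L2fun a" unfolding a_def by (intro L2fun_diff L2fun_shift uL)
    have bL: "L2fun (\<lambda>x. diffq j (h $ j) u (x + ?k))" by (intro L2fun_shift L2fun_diffq uL)
    have eq: "(\<lambda>x. u (x + (\<Sum>i\<in>insert j S. h $ i *\<^sub>R axis i 1)) - u x) = (\<lambda>x. a x + diffq j (h $ j) u (x + ?k))"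
      using insert by (auto simp: a_def algebra_simps)
    have "sqrt (nsq (\<lambda>x. u (x + (\<Sum>i\<in>insert j S. h $ i *\<^sub>R axis i 1)) - u x))
        \<le> sqrt (nsq a) + sqrt (nsq (\<lambda>x. diffq j (h $ j) u (x + ?k)))"
      unfolding eq by (rule L2_triangle[OF aL bL])
    also have "nsq (\<lambda>x. diffq j (h $ j) u (x + ?k)) = nsq (diffq j (h $ j) u)"
      by (rule ip_shift) measurable
    also have "sqrt \<dots> \<le> sqrt ((h $ j)^2 * nsq (\<lambda>x. wgrad u x $ j))"
      using H1_diffq[OF u, where i=j and s="h $ j"] by simp
    also have "\<dots> = \<bar>h $ j\<bar> * g j" by (simp add: real_sqrt_mult g_def)
    also have "\<dots> \<le> l * g j" by (intro mult_right_mono h g)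
    also have "sqrt (nsq a) \<le> (\<Sum>i\<in>S. l * g i)" unfolding a_def by (rule insert.IH)
    finally show ?case using insert by simp
  qed
  from this[of UNIV] have "sqrt (nsq (\<lambda>x. u (x + (\<Sum>i\<in>UNIV. h $ i *\<^sub>R axis i 1)) - u x)) \<le> l * (\<Sum>i\<in>UNIV. g i)"
    by (simp add: sum_distrib_left)
  moreover have "(\<Sum>i\<in>UNIV. h $ i *\<^sub>R axis i 1) = h"
    using basis_expansion[of h] by (simp add: scalar_mult_eq_scaleR)
  ultimately have "sqrt (nsq (\<lambda>x. u (x + h) - u x)) \<le> l * (\<Sum>i\<in>UNIV. g i)" by simp
  then have "nsq (\<lambda>x. u (x + h) - u x) \<le> (l * (\<Sum>i\<in>UNIV. g i))^2" by (rule sqrt_le_D)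
  also have "\<dots> = l^2 * (\<Sum>i\<in>UNIV. g i * 1)^2" by (simp add: power_mult_distrib)
  also have "\<dots> \<le> l^2 * ((\<Sum>i\<in>UNIV. (g i)^2) * (\<Sum>i\<in>(UNIV::'n set). 1^2))"
    by (intro mult_left_mono Cauchy_Schwarz_ineq_sum) auto
  also have "\<dots> = l^2 * (CARD('n) * dip u u)"
    by (simp add: g_def dip_def ip_self_nonneg)
  finally show ?thesis .
qed

section \<open>Half-open dyadic cubes of side 2^-k and averages over them\<close>

definition cube :: "nat \<Rightarrow> real^'n::finite \<Rightarrow> (real^'n) set" where
  "cube k x = {y. \<forall>i. \<lfloor>2 ^ k * y $ i\<rfloor> = \<lfloor>2 ^ k * x $ i\<rfloor>}"

lemma cube_eq: "y \<in> cube k x \<Longrightarrow> cube k y = cube k x"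
  by (auto simp: cube_def)

text \<open>The floor of 2^k t is half the floor of 2^(k+1) t, rounded down, so the finer index
  determines the coarser one.\<close>

lemma cube_Suc: "cube (Suc k) x \<subseteq> cube k x"
proof
  have fl: "\<lfloor>2 ^ k * t\<rfloor> = \<lfloor>2 ^ Suc k * t\<rfloor> div 2" for t :: real
    using floor_divide_real_eq_div[of 2 "2 ^ Suc k * t"] by simp
  fix y assume "y \<in> cube (Suc k) x"
  then show "y \<in> cube k x" unfolding cube_def fl by simp
qed

lemma cube_dist: "y \<in> cube k x \<Longrightarrow> \<bar>(y - x) $ i\<bar> \<le> 1 / 2 ^ k"
proof -
  assume "y \<in> cube k x"
  then have "\<lfloor>2 ^ k * y $ i\<rfloor> = \<lfloor>2 ^ k * x $ i\<rfloor>" by (simp add: cube_def)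
  then have "\<bar>2 ^ k * y $ i - 2 ^ k * x $ i\<bar> \<le> 1" by linarith
  then have "2 ^ k * \<bar>y $ i - x $ i\<bar> \<le> 1" by (simp add: abs_mult flip: right_diff_distrib)
  then show ?thesis by (simp add: field_simps)
qed

text \<open>Joint measurability is required because \<open>davg\<close> integrates over a cube that
  depends on the point of evaluation.\<close>

lemma cube_measurable2 [measurable]:
  "Measurable.pred (borel \<Otimes>\<^sub>M borel) (\<lambda>z :: (real^'n::finite) \<times> (real^'n). snd z \<in> cube k (fst z))"
proof -
  define f :: "'n \<Rightarrow> (real^'n) \<times> (real^'n) \<Rightarrow> real" where "f i z = real_of_int \<lfloor>2 ^ k * snd z $ i\<rfloor>" for i z
  define g :: "'n \<Rightarrow> (real^'n) \<times> (real^'n) \<Rightarrow> real" where "g i z = real_of_int \<lfloor>2 ^ k * fst z $ i\<rfloor>" for i z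
  have c: "(\<lambda>x::real^'n. x $ i) \<in> borel_measurable borel" for i
    by (intro borel_measurable_continuous_onI continuous_intros)
  have [measurable]: "(\<lambda>z::(real^'n) \<times> (real^'n). snd z $ i) \<in> borel_measurable (borel \<Otimes>\<^sub>M borel)"
    "(\<lambda>z::(real^'n) \<times> (real^'n). fst z $ i) \<in> borel_measurable (borel \<Otimes>\<^sub>M borel)" for i
    by (rule measurable_compose[OF measurable_snd c], rule measurable_compose[OF measurable_fst c])
  have [measurable]: "f i \<in> borel_measurable (borel \<Otimes>\<^sub>M borel)" "g i \<in> borel_measurable (borel \<Otimes>\<^sub>M borel)" for i
    unfolding f_def g_def by measurable
  have eq: "(\<lambda>z. snd z \<in> cube k (fst z)) = (\<lambda>z. \<forall>i. f i z = g i z)"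
    by (simp add: cube_def fun_eq_iff f_def g_def)
  show ?thesis unfolding eq by measurable
qed

lemma cube_sets [measurable]: "cube k x \<in> sets borel"
proof -
  have "cube k x = {y. \<forall>i. real_of_int \<lfloor>2 ^ k * y $ i\<rfloor> = real_of_int \<lfloor>2 ^ k * x $ i\<rfloor>}"
    by (auto simp: cube_def)
  also have "\<dots> \<in> sets borel" by measurable
  finally show ?thesis .
qed

text \<open>The half-open cube lies between the open and the closed box with the same corners, which
  have equal measure.\<close>

lemma cube_emeasure: "emeasure lborel (cube k (x :: real^'n::finite)) = ennreal (1 / 2 ^ (k * CARD('n)))"
proof -
  define l :: "real^'n" where "l = (\<chi> i. real_of_int \<lfloor>2 ^ k * x $ i\<rfloor> / 2 ^ k)"
  define u :: "real^'n" where "u = (\<chi> i. (real_of_int \<lfloor>2 ^ k * x $ i\<rfloor> + 1) / 2 ^ k)"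
  have lu: "(u - l) $ i = 1 / 2 ^ k" for i by (simp add: l_def u_def field_simps)
  have le: "l \<bullet> b \<le> u \<bullet> b" and d: "(u - l) \<bullet> b = 1 / 2 ^ k" if "b \<in> Basis" for b
  proof -
    obtain i where "b = axis i 1" using \<open>b \<in> Basis\<close> by (auto simp: Basis_vec_def)
    then show "l \<bullet> b \<le> u \<bullet> b" "(u - l) \<bullet> b = 1 / 2 ^ k"
      using lu[of i] by (auto simp: inner_axis l_def u_def divide_right_mono)
  qed
  have p: "(\<Prod>b\<in>Basis. (u - l) \<bullet> b) = 1 / 2 ^ (k * CARD('n))"
    using d by (simp add: power_divide power_mult)
  have "box l u \<subseteq> cube k x"
  proof
    fix y assume y: "y \<in> box l u"
    show "y \<in> cube k x" unfolding cube_def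
    proof (intro CollectI allI)
      fix i
      have "l $ i < y $ i" "y $ i < u $ i" using y by (auto simp: mem_box_cart)
      then show "\<lfloor>2 ^ k * y $ i\<rfloor> = \<lfloor>2 ^ k * x $ i\<rfloor>"
        unfolding l_def u_def by (intro floor_unique) (auto simp: field_simps)
    qed
  qed
  then have 1: "emeasure lborel (box l u) \<le> emeasure lborel (cube k x)" by (intro emeasure_mono) auto
  have "cube k x \<subseteq> cbox l u"
  proof
    fix y assume "y \<in> cube k x"
    then have "\<lfloor>2 ^ k * y $ i\<rfloor> = \<lfloor>2 ^ k * x $ i\<rfloor>" for i by (simp add: cube_def)
    then have "real_of_int \<lfloor>2 ^ k * x $ i\<rfloor> \<le> 2 ^ k * y $ i" "2 ^ k * y $ i \<le> real_of_int \<lfloor>2 ^ k * x $ i\<rfloor> + 1" for i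
      by (metis of_int_floor_le, metis real_of_int_floor_add_one_ge)
    then show "y \<in> cbox l u" unfolding mem_box_cart l_def u_def by (simp add: field_simps)
  qed
  then have 2: "emeasure lborel (cube k x) \<le> emeasure lborel (cbox l u)" by (intro emeasure_mono) auto
  have "emeasure lborel (box l u) = ennreal (1 / 2 ^ (k * CARD('n)))"
    using emeasure_lborel_box[OF le] p by simp
  moreover have "emeasure lborel (cbox l u) = ennreal (1 / 2 ^ (k * CARD('n)))"
    using emeasure_lborel_cbox[OF le] p by simp
  ultimately show ?thesis using 1 2 by simp
qed

lemma L2fun_cube: "L2fun (indicat_real (cube k x))"
  by (intro L2fun_indicator) (auto simp: cube_emeasure)

lemma ip_cube: "ip (indicat_real (cube k x)) (indicat_real (cube k (x :: real^'n::finite))) = 1 / 2 ^ (k * CARD('n))"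
proof -
  have "nsq (indicat_real (cube k x)) = (\<integral>y. indicat_real (cube k x) y \<partial>lborel)"
    unfolding ip_def by (intro Bochner_Integration.integral_cong) (auto simp: indicator_def)
  then show ?thesis by (simp add: measure_def cube_emeasure)
qed

definition davg :: "nat \<Rightarrow> (real^'n::finite \<Rightarrow> real) \<Rightarrow> real^'n \<Rightarrow> real" where
  "davg k u x = 2 ^ (k * CARD('n)) * ip (indicat_real (cube k x)) u"

lemma davg_cong_cube: "y \<in> cube k x \<Longrightarrow> davg k u y = davg k u x"
  by (simp add: davg_def cube_eq)

text \<open>Jensen's inequality in the form of Cauchy-Schwarz against the indicator. Square
  integrability is asked on the cube only, so that \<open>f\<close> may be y -> u x - u y with x
  fixed.\<close>

lemma cube_average_sq:
  fixes f :: "real^'n::finite \<Rightarrow> real"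
  assumes f: "L2fun (\<lambda>y. indicat_real (cube k x) y * f y)"
  shows "(2 ^ (k * CARD('n)) * ip (indicat_real (cube k x)) f)^2
    \<le> 2 ^ (k * CARD('n)) * (\<integral>y. indicat_real (cube k x) y * (f y)^2 \<partial>lborel)"
proof -
  let ?I = "indicat_real (cube k x)" and ?N = "2 ^ (k * CARD('n)) :: real"
  have e: "ip ?I f = ip ?I (\<lambda>y. ?I y * f y)"
    unfolding ip_def by (intro Bochner_Integration.integral_cong) (auto simp: indicator_def)
  have q: "nsq (\<lambda>y. ?I y * f y) = (\<integral>y. ?I y * (f y)^2 \<partial>lborel)"
    unfolding ip_def by (intro Bochner_Integration.integral_cong) (auto simp: indicator_def power2_eq_square)
  have "(?N * ip ?I f)^2 = ?N^2 * (ip ?I (\<lambda>y. ?I y * f y))^2" by (simp add: e power_mult_distrib)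
  also have "\<dots> \<le> ?N^2 * (nsq ?I * nsq (\<lambda>y. ?I y * f y))"
    by (intro mult_left_mono ip_CS L2fun_cube f) auto
  also have "\<dots> = ?N * (\<integral>y. ?I y * (f y)^2 \<partial>lborel)"
    unfolding q ip_cube by (simp add: power2_eq_square)
  finally show ?thesis .
qed

lemma L2fun_cube_mult:
  assumes "L2fun f" shows "L2fun (\<lambda>y. indicat_real (cube k x) y * f y)"
proof -
  have [measurable]: "f \<in> borel_measurable borel" using assms L2fun_meas by auto
  show ?thesis by (rule L2fun_bound[OF assms]) (auto simp: indicator_def)
qed

text \<open>Averages over cubes of a fixed size are bounded pointwise by the global norm. The loss
  2^(k N) is what the decay of the averaging error has to compensate in the Sobolev
  inequality.\<close>

lemma davg_sq_le:
  fixes g :: "real^'n::finite \<Rightarrow> real"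
  assumes g: "L2fun g"
  shows "(davg k g x)^2 \<le> 2 ^ (k * CARD('n)) * nsq g"
proof -
  have "(davg k g x)^2 \<le> 2 ^ (k * CARD('n)) * (\<integral>y. indicat_real (cube k x) y * (g y)^2 \<partial>lborel)"
    unfolding davg_def by (rule cube_average_sq[OF L2fun_cube_mult[OF g]])
  also have "\<dots> \<le> 2 ^ (k * CARD('n)) * nsq g"
    unfolding ip_self
  proof (intro mult_left_mono integral_mono)
    have "integrable lborel (\<lambda>y. (indicat_real (cube k x) y * g y)^2)" by (intro L2fun_sq L2fun_cube_mult g)
    moreover have "(\<lambda>y. (indicat_real (cube k x) y * g y)^2) = (\<lambda>y. indicat_real (cube k x) y * (g y)^2)"
      by (auto simp: indicator_def)
    ultimately show "integrable lborel (\<lambda>y. indicat_real (cube k x) y * (g y)^2)" by simp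
  qed (use g in \<open>auto simp: L2fun_sq indicator_def\<close>)
  finally show ?thesis .
qed

lemma davg_measurable:
  assumes "u \<in> borel_measurable borel" shows "davg k u \<in> borel_measurable borel"
proof -
  have [measurable]: "u \<in> borel_measurable borel" by fact
  have "davg k u = (\<lambda>x. 2 ^ (k * CARD('a)) * (\<integral>y. (if y \<in> cube k x then 1 else 0) * u y \<partial>lborel))"
    unfolding davg_def ip_def by (auto simp: indicator_def of_bool_def)
  also have "\<dots> \<in> borel_measurable borel"
  proof (intro borel_measurable_times borel_measurable_const lborel.borel_measurable_lebesgue_integral)
    have "(\<lambda>z. (if snd z \<in> cube k (fst z) then 1 else 0) * u (snd z)) \<in> borel_measurable (borel \<Otimes>\<^sub>M borel)" by measurable
    then show "(\<lambda>(x, y). (if y \<in> cube k x then 1 else 0) * u y) \<in> borel_measurable (borel \<Otimes>\<^sub>M lborel)"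
      by (simp add: case_prod_beta measurable_cong_sets[OF sets_pair_measure_cong[OF refl sets_lborel] refl])
  qed
  finally show ?thesis .
qed

text \<open>Jensen's inequality bounds the left-hand side by the average over \<open>\<bar>h\<bar>\<^sub>\<infinity> \<le> 2\<^sup>-\<^sup>k\<close> of the squared
  norms of \<open>u (\<cdot> + h) - u\<close>.\<close>
lemma davg_error:
  fixes u :: "real^'n::finite \<Rightarrow> real"
  assumes u: "H1 u"
  shows "L2fun (\<lambda>x. u x - davg k u x)"
    "nsq (\<lambda>x. u x - davg k u x) \<le> 2 ^ CARD('n) * CARD('n) * dip u u / 4 ^ k"
proof -
  have uL: "L2fun u" using u by (rule H1_L2)
  have m[measurable]: "u \<in> borel_measurable borel" using uL L2fun_meas by auto
  note dm[measurable] = davg_measurable[OF m, of k]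
  define N :: real where "N = 2 ^ (k * CARD('n))"
  define l :: real where "l = 1 / 2 ^ k"
  have N0: "0 < N" and l0: "0 < l" by (auto simp: N_def l_def)
  \<comment> \<open>All differences of two points in one dyadic cube lie in this symmetric cube of
    side 2 l. Its volume times \<open>N\<close> is the factor 2^N of the result, and
    \<open>l^2\<close> is the factor 4^-k.\<close>
  define Q :: "(real^'n) set" where "Q = cbox (\<chi> i. - l) (\<chi> i. l)"
  have eQ: "emeasure lborel Q = ennreal ((2 * l) ^ CARD('n))"
  proof -
    have le: "(\<chi> i. - l) \<bullet> b \<le> (\<chi> i. l) \<bullet> b" and d: "((\<chi> i. l) - (\<chi> i. - l)) \<bullet> b = 2 * l" if "b \<in> Basis" for b :: "real^'n"
    proof -
      obtain i where "b = axis i 1" using \<open>b \<in> Basis\<close> by (auto simp: Basis_vec_def)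
      then show "(\<chi> i. - l) \<bullet> b \<le> (\<chi> i. l) \<bullet> b" "((\<chi> i. l) - (\<chi> i. - l)) \<bullet> b = 2 * l"
        using l0 by (auto simp: inner_axis)
    qed
    show ?thesis unfolding Q_def using emeasure_lborel_cbox[OF le] d by simp
  qed
  have pt: "ennreal ((u x - davg k u x)^2) \<le> ennreal N * (\<integral>\<^sup>+h. ennreal ((u (x + h) - u x)^2) * indicator Q h \<partial>lborel)" for x
  proof -
    let ?I = "indicat_real (cube k x)"
    have L: "L2fun (\<lambda>y. ?I y * (u x - u y))"
      using L2fun_diff[OF L2fun_scale[OF L2fun_cube[of k x], of "u x"] L2fun_cube_mult[OF uL, of k x]]
      by (simp add: algebra_simps)
    have "ip ?I (\<lambda>y. u x - u y) = (\<integral>y. u x * (?I y * ?I y) - ?I y * u y \<partial>lborel)"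
      unfolding ip_def by (intro Bochner_Integration.integral_cong) (auto simp: indicator_def)
    also have "\<dots> = u x * nsq ?I - ip ?I u"
      unfolding ip_def using L2fun_mult_integrable[OF L2fun_cube L2fun_cube] L2fun_mult_integrable[OF L2fun_cube uL]
      by (subst Bochner_Integration.integral_diff) auto
    finally have e: "ip ?I (\<lambda>y. u x - u y) = u x * nsq ?I - ip ?I u" .
    have "u x - davg k u x = N * ip ?I (\<lambda>y. u x - u y)"
      unfolding e ip_cube davg_def N_def by (simp add: right_diff_distrib)
    then have "(u x - davg k u x)^2 \<le> N * (\<integral>y. ?I y * (u x - u y)^2 \<partial>lborel)"
      using cube_average_sq[OF L] by (simp add: N_def)
    then have "ennreal ((u x - davg k u x)^2) \<le> ennreal N * ennreal (\<integral>y. ?I y * (u x - u y)^2 \<partial>lborel)"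
      using N0 by (simp add: ennreal_mult[symmetric] ennreal_leI)
    also have "ennreal (\<integral>y. ?I y * (u x - u y)^2 \<partial>lborel) = (\<integral>\<^sup>+y. ennreal (?I y * (u x - u y)^2) \<partial>lborel)"
    proof (rule nn_integral_eq_integral[symmetric])
      have "(\<lambda>y. (?I y * (u x - u y))^2) = (\<lambda>y. ?I y * (u x - u y)^2)" by (auto simp: indicator_def)
      then show "integrable lborel (\<lambda>y. ?I y * (u x - u y)^2)" using L2fun_sq[OF L] by simp
    qed auto
    \<comment> \<open>With y = x + h the domain of h can be enlarged to \<open>Q\<close>, which no
      longer depends on x, so that the integrations can be exchanged.\<close>
    also have "\<dots> = (\<integral>\<^sup>+h. ennreal (?I (h + x) * (u x - u (h + x))^2) \<partial>lborel)"
      by (rule lborel_nn_integral_shift[symmetric]) measurable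
    also have "\<dots> \<le> (\<integral>\<^sup>+h. ennreal ((u (x + h) - u x)^2) * indicator Q h \<partial>lborel)"
    proof (rule nn_integral_mono)
      fix h
      have "h \<in> Q" if "h + x \<in> cube k x"
        using cube_dist[OF that] by (auto simp: Q_def mem_box_cart l_def abs_le_iff) (smt (verit))
      then show "ennreal (?I (h + x) * (u x - u (h + x))^2) \<le> ennreal ((u (x + h) - u x)^2) * indicator Q h"
        by (auto simp: indicator_def power2_commute add.commute)
    qed
    finally show ?thesis using N0 by (simp add: mult_left_mono)
  qed
  define D where "D = l^2 * (CARD('n) * dip u u)"
  have D0: "0 \<le> D" by (simp add: D_def dip_nonneg)
  have "(\<integral>\<^sup>+x. ennreal ((u x - davg k u x)^2) \<partial>lborel)
      \<le> (\<integral>\<^sup>+x. ennreal N * (\<integral>\<^sup>+h. ennreal ((u (x + h) - u x)^2) * indicator Q h \<partial>lborel) \<partial>lborel)"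
    by (intro nn_integral_mono pt)
  also have "\<dots> = ennreal N * (\<integral>\<^sup>+x. \<integral>\<^sup>+h. ennreal ((u (x + h) - u x)^2) * indicator Q h \<partial>lborel \<partial>lborel)"
    by (intro nn_integral_cmult) (auto simp: Q_def)
  also have "(\<integral>\<^sup>+x. \<integral>\<^sup>+h. ennreal ((u (x + h) - u x)^2) * indicator Q h \<partial>lborel \<partial>lborel)
      = (\<integral>\<^sup>+h. \<integral>\<^sup>+x. ennreal ((u (x + h) - u x)^2) * indicator Q h \<partial>lborel \<partial>lborel)"
    by (intro lborel_pair.Fubini'[symmetric]) (auto simp: Q_def)
  also have "\<dots> \<le> (\<integral>\<^sup>+h. ennreal D * indicator Q h \<partial>lborel)"
  proof (rule nn_integral_mono)
    fix h :: "real^'n"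
    have "(\<integral>\<^sup>+x. ennreal ((u (x + h) - u x)^2) \<partial>lborel) \<le> ennreal D" if "h \<in> Q"
    proof -
      have "\<bar>h $ i\<bar> \<le> l" for i using that by (auto simp: Q_def mem_box_cart abs_le_iff) (smt (verit))
      from H1_translate[OF u this] show ?thesis
        by (subst L2fun_nn_integral) (auto simp: D_def intro!: L2fun_diff L2fun_shift uL ennreal_leI)
    qed
    then show "(\<integral>\<^sup>+x. ennreal ((u (x + h) - u x)^2) * indicator Q h \<partial>lborel) \<le> ennreal D * indicator Q h"
      by (cases "h \<in> Q") auto
  qed
  also have "\<dots> = ennreal D * ennreal ((2 * l) ^ CARD('n))"
    using eQ by (subst nn_integral_cmult) (auto simp: Q_def)
  also have "ennreal N * (ennreal D * ennreal ((2 * l) ^ CARD('n))) = ennreal (2 ^ CARD('n) * CARD('n) * dip u u / 4 ^ k)"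
  proof -
    have four: "(4::real) ^ k = 2 ^ k * 2 ^ k" by (simp flip: power_mult_distrib)
    have "N * (D * (2 * l) ^ CARD('n)) = 2 ^ CARD('n) * CARD('n) * dip u u / 4 ^ k"
      unfolding N_def D_def l_def
      by (simp add: power_mult power_mult_distrib power_divide power2_eq_square four)
    then show ?thesis using N0 D0 l0 by (simp add: ennreal_mult[symmetric])
  qed
  finally have b: "(\<integral>\<^sup>+x. ennreal ((u x - davg k u x)^2) \<partial>lborel) \<le> ennreal (2 ^ CARD('n) * CARD('n) * dip u u / 4 ^ k)"
    using N0 by (simp add: mult_left_mono)
  show "L2fun (\<lambda>x. u x - davg k u x)"
    "nsq (\<lambda>x. u x - davg k u x) \<le> 2 ^ CARD('n) * CARD('n) * dip u u / 4 ^ k"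
    using L2fun_nnI[OF _ b] dip_nonneg[of u] by simp_all
qed

lemma L2fun_davg:
  assumes "H1 u" shows "L2fun (davg k u)"
  using L2fun_diff[OF H1_L2[OF assms] davg_error(1)[OF assms, of k]] by simp

text \<open>The coarse average is constant on the finer cubes and reproduced by averaging over them.
  The increment is therefore an average of the residual, so that the pointwise bound applies to a
  function of small norm.\<close>

lemma davg_refine:
  fixes u :: "real^'n::finite \<Rightarrow> real"
  assumes u: "H1 u"
  shows "davg (Suc k) u x - davg k u x = davg (Suc k) (\<lambda>x. u x - davg k u x) x"
proof -
  let ?I = "indicat_real (cube (Suc k) x)"
  have "ip ?I (davg k u) = ip ?I (\<lambda>y. davg k u x * ?I y)"
    unfolding ip_def using cube_Suc[of k x] davg_cong_cube[of _ k x u]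
    by (intro Bochner_Integration.integral_cong) (auto simp: indicator_def)
  also have "\<dots> = davg k u x * nsq ?I" unfolding ip_def by (simp add: mult_ac flip: integral_mult_right_zero)
  finally have "2 ^ (Suc k * CARD('n)) * ip ?I (davg k u) = davg k u x" unfolding ip_cube by simp
  then show ?thesis
    unfolding davg_def[of "Suc k"] using H1_L2[OF u] L2fun_davg[OF u, of k] L2fun_cube[of "Suc k" x]
    by (simp add: ip_diff_right right_diff_distrib)
qed

section \<open>Local compactness\<close>

lemma integrable_cball_mult:
  fixes f :: "real^'n::finite \<Rightarrow> real"
  shows "integrable lborel f \<Longrightarrow> integrable lborel (\<lambda>x. indicat_real (cball 0 R) x * f x)"
  using integrable_mult_indicator[of "cball 0 R" lborel f] by simp

text \<open>Each function is its dyadic average plus an error that the gradient bound makes small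
  uniformly in \<open>n\<close>. For fixed \<open>k\<close> the averages are products with fixed
  indicators, so they tend to 0 pointwise and stay bounded on the ball.\<close>

lemma rellich:
  fixes w :: "nat \<Rightarrow> real^'n::finite \<Rightarrow> real"
  assumes w: "\<And>n. H1 (w n)" and b1: "\<And>n. nsq (w n) \<le> M" and b2: "\<And>n. dip (w n) (w n) \<le> M"
    and wc: "wconv w (\<lambda>x. 0)"
  shows "(\<lambda>n. \<integral>x. indicat_real (cball 0 R) x * (w n x)^2 \<partial>lborel) \<longlonglongrightarrow> 0"
proof (rule LIMSEQ_I)
  fix e :: real assume e: "0 < e"
  let ?B = "indicat_real (cball 0 R :: (real^'n) set)"
  have wL: "L2fun (w n)" for n using w H1_L2 by blast
  have M0: "0 \<le> M" using b2[of 0] dip_nonneg[of "w 0"] by linarith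
  define C :: real where "C = 2 ^ CARD('n) * CARD('n)"
  \<comment> \<open>The scale is fixed here, before \<open>n\<close>; the factor 2 comes from a^2
    \<le> 2 b^2 + 2 (a - b)^2 below.\<close>
  have "(\<lambda>k. 2 * (C * M) * (1/4)^k) \<longlonglongrightarrow> 2 * (C * M) * 0"
    by (intro tendsto_intros LIMSEQ_realpow_zero) auto
  then have "\<forall>\<^sub>F k in sequentially. 2 * (C * M) * (1/4)^k < e / 2" using e by (intro order_tendstoD(2)) auto
  then obtain k where k: "2 * (C * M) * (1/4)^k < e / 2" by (auto simp: eventually_sequentially)
  have [measurable]: "davg k (w n) \<in> borel_measurable borel" for n by (intro davg_measurable L2fun_meas wL)
  have Bi: "integrable lborel ?B"
    using emeasure_bounded_finite[of "cball 0 R :: (real^'n) set"] by (auto simp: integrable_indicator_iff)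
  have "(\<lambda>n. \<integral>x. ?B x * (davg k (w n) x)^2 \<partial>lborel) \<longlonglongrightarrow> (\<integral>x. 0 \<partial>(lborel :: (real^'n) measure))"
  proof (rule integral_dominated_convergence)
    show "integrable lborel (\<lambda>x. ?B x * (2 ^ (k * CARD('n)) * M))" using Bi by simp
    show "AE x in lborel. (\<lambda>n. ?B x * (davg k (w n) x)^2) \<longlonglongrightarrow> 0"
    proof (intro AE_I2)
      fix x
      have "(\<lambda>n. ip (w n) (indicat_real (cube k x))) \<longlonglongrightarrow> ip (\<lambda>x. 0) (indicat_real (cube k x))"
        using wc L2fun_cube unfolding wconv_def by blast
      then have "(\<lambda>n. ip (indicat_real (cube k x)) (w n)) \<longlonglongrightarrow> 0" by (simp add: ip_commute[of _ "w _"]) (simp add: ip_def)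
      then have "(\<lambda>n. ?B x * (2 ^ (k * CARD('n)) * ip (indicat_real (cube k x)) (w n))^2) \<longlonglongrightarrow> ?B x * (2 ^ (k * CARD('n)) * 0)^2"
        by (intro tendsto_intros)
      then show "(\<lambda>n. ?B x * (davg k (w n) x)^2) \<longlonglongrightarrow> 0" by (simp add: davg_def)
    qed
    show "AE x in lborel. norm (?B x * (davg k (w n) x)^2) \<le> ?B x * (2 ^ (k * CARD('n)) * M)" for n
    proof (intro AE_I2)
      fix x
      have "(davg k (w n) x)^2 \<le> 2 ^ (k * CARD('n)) * nsq (w n)" by (rule davg_sq_le[OF wL])
      also have "\<dots> \<le> 2 ^ (k * CARD('n)) * M" by (intro mult_left_mono b1) auto
      finally show "norm (?B x * (davg k (w n) x)^2) \<le> ?B x * (2 ^ (k * CARD('n)) * M)"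
        by (simp add: indicator_def)
    qed
    show "(\<lambda>x. ?B x * (davg k (w n) x)^2) \<in> borel_measurable lborel" for n
      using davg_measurable[OF L2fun_meas[OF wL], of k n]
      by (intro borel_measurable_times borel_measurable_power borel_measurable_indicator) auto
  qed auto
  then have "(\<lambda>n. 2 * (\<integral>x. ?B x * (davg k (w n) x)^2 \<partial>lborel)) \<longlonglongrightarrow> 2 * 0" by (intro tendsto_intros) simp
  from order_tendstoD(2)[OF this, of "e / 2"] e
  have "\<forall>\<^sub>F n in sequentially. 2 * (\<integral>x. ?B x * (davg k (w n) x)^2 \<partial>lborel) < e / 2" by simp
  then obtain n0 where n0: "\<And>n. n \<ge> n0 \<Longrightarrow> 2 * (\<integral>x. ?B x * (davg k (w n) x)^2 \<partial>lborel) < e / 2"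
    by (auto simp: eventually_sequentially)
  have "norm ((\<integral>x. ?B x * (w n x)^2 \<partial>lborel) - 0) < e" if "n \<ge> n0" for n
  proof -
    have i1: "integrable lborel (\<lambda>x. ?B x * (davg k (w n) x)^2)"
      by (intro integrable_cball_mult L2fun_sq L2fun_davg w)
    have i2: "integrable lborel (\<lambda>x. (w n x - davg k (w n) x)^2)" by (intro L2fun_sq davg_error w)
    have i0: "integrable lborel (\<lambda>x. ?B x * (w n x)^2)"
      by (intro integrable_cball_mult L2fun_sq wL)
    have "(\<integral>x. ?B x * (w n x)^2 \<partial>lborel) \<le> (\<integral>x. 2 * (?B x * (davg k (w n) x)^2) + 2 * (w n x - davg k (w n) x)^2 \<partial>lborel)"
    proof (rule integral_mono)
      fix x
      have "a^2 \<le> 2 * b^2 + 2 * (a - b)^2" for a b :: real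
        using zero_le_power2[of "a - 2 * b"] by (simp add: power2_eq_square algebra_simps)
      from this[of "w n x" "davg k (w n) x"]
      show "?B x * (w n x)^2 \<le> 2 * (?B x * (davg k (w n) x)^2) + 2 * (w n x - davg k (w n) x)^2"
        by (simp add: indicator_def)
    qed (use i0 i1 i2 in auto)
    also have "\<dots> = 2 * (\<integral>x. ?B x * (davg k (w n) x)^2 \<partial>lborel) + 2 * nsq (\<lambda>x. w n x - davg k (w n) x)"
      unfolding ip_self using i1 i2 by simp
    also have "\<dots> \<le> 2 * (\<integral>x. ?B x * (davg k (w n) x)^2 \<partial>lborel) + 2 * (C * M) * (1/4)^k"
    proof -
      have "nsq (\<lambda>x. w n x - davg k (w n) x) \<le> C * dip (w n) (w n) / 4 ^ k"
        unfolding C_def by (rule davg_error(2)[OF w])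
      also have "\<dots> \<le> C * M / 4 ^ k" by (intro divide_right_mono mult_left_mono b2) (auto simp: C_def)
      finally show ?thesis by (simp add: power_divide)
    qed
    also have "\<dots> < e" using n0[OF that] k by linarith
    finally have "(\<integral>x. ?B x * (w n x)^2 \<partial>lborel) < e" .
    moreover have "0 \<le> (\<integral>x. ?B x * (w n x)^2 \<partial>lborel)" by (intro integral_nonneg_AE) auto
    ultimately show ?thesis by simp
  qed
  then show "\<exists>n0. \<forall>n\<ge>n0. norm ((\<integral>x. ?B x * (w n x)^2 \<partial>lborel) - 0) < e" by blast
qed


section \<open>The Sobolev inequality for fourth powers in dimension at most three\<close>

lemma sum_ennreal_mult:
  fixes a b :: "nat \<Rightarrow> real"
  assumes "\<And>k. 0 \<le> a k" "\<And>k. 0 \<le> b k"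
  shows "(\<Sum>k<K. ennreal (a k) * ennreal (b k)) = ennreal (\<Sum>k<K. a k * b k)"
  using assms by (simp add: ennreal_mult[symmetric])

lemma nn_integral_pow4_le:
  fixes f :: "real^'n::finite \<Rightarrow> real"
  assumes f: "L2fun f" and b: "\<And>x. (f x)^2 \<le> A"
  shows "(\<integral>\<^sup>+x. ennreal ((f x)^4) \<partial>lborel) \<le> ennreal (A * nsq f)"
proof -
  have A: "0 \<le> A" using b[of 0] zero_le_power2[of "f 0"] by linarith
  have [measurable]: "f \<in> borel_measurable borel" using f L2fun_meas by auto
  have "(\<integral>\<^sup>+x. ennreal ((f x)^4) \<partial>lborel) \<le> (\<integral>\<^sup>+x. ennreal A * ennreal ((f x)^2) \<partial>lborel)"
  proof (rule nn_integral_mono)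
    fix x
    have "(f x)^4 = (f x)^2 * (f x)^2" by (simp flip: power_add)
    also have "\<dots> \<le> A * (f x)^2" by (intro mult_right_mono b) auto
    finally show "ennreal ((f x)^4) \<le> ennreal A * ennreal ((f x)^2)"
      using A by (simp add: ennreal_mult[symmetric] ennreal_leI)
  qed
  also have "\<dots> = ennreal A * ennreal (nsq f)"
    by (subst nn_integral_cmult) (auto simp: L2fun_nn_integral f)
  finally show ?thesis using A by (simp add: ennreal_mult ip_self_nonneg)
qed

text \<open>Cauchy-Schwarz with the weights (9/10)^k, whose sum is at most 10. The price is the
  growth (10/9)^k, taken close to 1 so that it can be paid repeatedly.\<close>

lemma weighted_sum_sq:
  fixes x :: "nat \<Rightarrow> real"
  shows "(\<Sum>k<K. x k)^2 \<le> 10 * (\<Sum>k<K. (10/9)^k * (x k)^2)"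
proof -
  have r: "sqrt ((9/10)^k) * sqrt ((10/9)^k) = (1::real)" for k
    by (simp flip: real_sqrt_mult power_mult_distrib)
  have "(\<Sum>k<K. x k) = (\<Sum>k<K. sqrt ((9/10)^k) * (sqrt ((10/9)^k) * x k))"
    by (intro sum.cong refl) (simp add: r flip: mult.assoc)
  then have "(\<Sum>k<K. x k)^2 = (\<Sum>k<K. sqrt ((9/10)^k) * (sqrt ((10/9)^k) * x k))^2" by simp
  also have "\<dots> \<le> (\<Sum>k<K. (sqrt ((9/10)^k))^2) * (\<Sum>k<K. (sqrt ((10/9)^k) * x k)^2)"
    by (rule Cauchy_Schwarz_ineq_sum)
  also have "\<dots> = (\<Sum>k<K. (9/10)^k) * (\<Sum>k<K. (10/9)^k * (x k)^2)"
    by (simp add: power_mult_distrib)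
  also have "\<dots> \<le> 10 * (\<Sum>k<K. (10/9)^k * (x k)^2)"
  proof (rule mult_right_mono)
    have "(\<Sum>k<K. (9/10::real)^k) \<le> (\<Sum>k. (9/10)^k)" by (intro sum_le_suminf summable_geometric) auto
    then show "(\<Sum>k<K. (9/10::real)^k) \<le> 10" by (simp add: suminf_geometric)
  qed (auto intro!: sum_nonneg)
  finally show ?thesis .
qed

text \<open>Two applications of the quadratic case; the growth rate becomes (10/9)^3 = 1000/729,
  still below 2, so that increments decaying like 2^-k remain summable. The constant is 10^2 times
  10.\<close>

lemma weighted_sum_pow4:
  fixes x :: "nat \<Rightarrow> real"
  shows "(\<Sum>k<K. x k)^4 \<le> 1000 * (\<Sum>k<K. (1000/729)^k * (x k)^4)"
proof -
  have "(\<Sum>k<K. x k)^4 = ((\<Sum>k<K. x k)^2)^2" by (simp flip: power_mult)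
  also have "\<dots> \<le> (10 * (\<Sum>k<K. (10/9)^k * (x k)^2))^2"
    by (intro power_mono weighted_sum_sq) auto
  also have "\<dots> = 100 * (\<Sum>k<K. (10/9)^k * (x k)^2)^2" by (simp add: power_mult_distrib)
  also have "\<dots> \<le> 100 * (10 * (\<Sum>k<K. (10/9)^k * ((10/9)^k * (x k)^2)^2))"
    by (intro mult_left_mono weighted_sum_sq) auto
  also have "(\<Sum>k<K. (10/9)^k * ((10/9)^k * (x k)^2)^2) = (\<Sum>k<K. (1000/729)^k * (x k)^4)"
  proof (intro sum.cong refl)
    fix k
    have "(10/9::real)^k * ((10/9)^k)^2 = (1000/729)^k"
      by (simp add: power2_eq_square flip: power_mult_distrib)
    then show "(10/9)^k * ((10/9)^k * (x k)^2)^2 = (1000/729)^k * (x k)^4"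
      by (simp add: power_mult_distrib flip: mult.assoc power_mult)
  qed
  finally show ?thesis by simp
qed

text \<open>The dyadic increments satisfy \<open>\<parallel>d\<^sub>k\<parallel>\<^sub>4\<^sup>4 \<le> \<parallel>d\<^sub>k\<parallel>\<^sub>\<infinity>\<^sup>2 \<parallel>d\<^sub>k\<parallel>\<^sub>2\<^sup>2 = O(2\<^sup>k\<^sup>N \<sqdot> 16\<^sup>-\<^sup>k)\<close>, which is
  summable because \<open>N < 4\<close>.\<close>
lemma sobolev_nn:
  fixes u :: "real^'n::finite \<Rightarrow> real"
  assumes N: "CARD('n) \<le> 3" and u: "H1 u"
  shows "(\<integral>\<^sup>+x. ennreal ((u x)^4) \<partial>lborel) \<le> ennreal ((16 + 16 * (2 ^ CARD('n) * real CARD('n)) + 128000 * 2 ^ CARD('n) * (2 ^ CARD('n) * real CARD('n))^2) * (nsq u + dip u u)^2)"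
proof -
  have uL: "L2fun u" using u by (rule H1_L2)
  have um[measurable]: "u \<in> borel_measurable borel" using uL L2fun_meas by auto
  have dm[measurable]: "davg k u \<in> borel_measurable borel" for k by (rule davg_measurable[OF um])
  define C :: real where "C = 2 ^ CARD('n) * real CARD('n)"
  define D where "D = dip u u"
  have C0: "0 \<le> C" and D0: "0 \<le> D" by (auto simp: C_def D_def dip_nonneg)
  define r where "r k x = u x - davg k u x" for k x
  have rk: "r k = (\<lambda>x. u x - davg k u x)" for k by (simp add: r_def fun_eq_iff)
  have rL: "L2fun (r k)" and rb: "nsq (r k) \<le> C * D / 4 ^ k" for k
    using davg_error[OF u, of k] by (simp_all add: r_def[abs_def] C_def D_def)
  define d where "d k x = davg (Suc k) u x - davg k u x" for k x
  have dL: "L2fun (d k)" for k unfolding d_def by (intro L2fun_diff L2fun_davg u)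
  have dm': "d k \<in> borel_measurable borel" for k using dL L2fun_meas by auto
  \<comment> \<open>This is the constant in the product of the pointwise bound 2^((k+1) N) C D / 4^k
    and the norm bound 4 C D / 4^k for the increments.\<close>
  define E where "E = 4 * 2 ^ CARD('n) * C^2 * D^2"
  have E0: "0 \<le> E" by (simp add: E_def)
  have d4: "(\<integral>\<^sup>+x. ennreal ((d k x)^4) \<partial>lborel) \<le> ennreal (E * (1/2)^k)" for k
  proof -
    define A where "A = 2 ^ (Suc k * CARD('n)) * (C * D / 4 ^ k)"
    have "(d k x)^2 \<le> A" for x
    proof -
      have "(d k x)^2 \<le> 2 ^ (Suc k * CARD('n)) * nsq (r k)"
        unfolding d_def davg_refine[OF u] rk[symmetric] by (rule davg_sq_le[OF rL])
      also have "\<dots> \<le> A" unfolding A_def by (intro mult_left_mono rb) auto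
      finally show ?thesis .
    qed
    then have 1: "(\<integral>\<^sup>+x. ennreal ((d k x)^4) \<partial>lborel) \<le> ennreal (A * nsq (d k))"
      by (rule nn_integral_pow4_le[OF dL])
    have A0: "0 \<le> A" using C0 D0 by (simp add: A_def)
    have "d k = (\<lambda>x. r k x - r (Suc k) x)" by (simp add: d_def r_def fun_eq_iff)
    then have "sqrt (nsq (d k)) \<le> sqrt (nsq (r k)) + sqrt (nsq (\<lambda>x. (-1) * r (Suc k) x))"
      using L2_triangle[OF rL[of k] L2fun_scale[OF rL, of "-1" "Suc k"]] by simp
    also have "nsq (\<lambda>x. (-1) * r (Suc k) x) = nsq (r (Suc k))"
      by (simp add: ip_def)
    also have "sqrt (nsq (r (Suc k))) \<le> sqrt (C * D / 4 ^ k)"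
    proof -
      have "C * D / 4 ^ Suc k \<le> C * D / 4 ^ k" using C0 D0 by (intro divide_left_mono) auto
      then show ?thesis using rb[of "Suc k"] by simp
    qed
    also have "sqrt (nsq (r k)) \<le> sqrt (C * D / 4 ^ k)" using rb[of k] by simp
    finally have "sqrt (nsq (d k)) \<le> 2 * sqrt (C * D / 4 ^ k)" by simp
    then have "nsq (d k) \<le> (2 * sqrt (C * D / 4 ^ k))^2" by (rule sqrt_le_D)
    also have "\<dots> = 4 * (C * D / 4 ^ k)" using C0 D0 by (simp add: power_mult_distrib)
    finally have "A * nsq (d k) \<le> A * (4 * (C * D / 4 ^ k))" by (intro mult_left_mono A0)
    also have "\<dots> = E * (2 ^ (k * CARD('n)) / 16 ^ k)"
    proof -
      have "(16::real) ^ k = 4 ^ k * 4 ^ k" by (simp flip: power_mult_distrib)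
      then show ?thesis unfolding A_def E_def by (simp add: power_add power2_eq_square)
    qed
    \<comment> \<open>The dimension enters here: 2^(k N) \<le> 8^k against 16^k.\<close>
    also have "\<dots> \<le> E * (1/2)^k"
    proof (rule mult_left_mono[OF _ E0])
      have "(2::real) ^ (k * CARD('n)) \<le> 2 ^ (k * 3)" using N by (intro power_increasing) auto
      also have "\<dots> = 8 ^ k" by (simp add: mult.commute[of k] power_mult)
      finally have "2 ^ (k * CARD('n)) / (16::real) ^ k \<le> 8 ^ k / 16 ^ k" by (intro divide_right_mono) auto
      also have "\<dots> = (1/2)^k" by (simp flip: power_divide)
      finally show "2 ^ (k * CARD('n)) / (16::real) ^ k \<le> (1/2)^k" .
    qed
    finally show ?thesis using 1 by (meson ennreal_leI order_trans)
  qed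
  have P0: "(\<integral>\<^sup>+x. ennreal ((davg 0 u x)^4) \<partial>lborel) \<le> ennreal (nsq u * (2 * nsq u + 2 * C * D))"
  proof -
    have "(davg 0 u x)^2 \<le> nsq u" for x using davg_sq_le[OF uL, of 0 x] by simp
    then have "(\<integral>\<^sup>+x. ennreal ((davg 0 u x)^4) \<partial>lborel) \<le> ennreal (nsq u * nsq (davg 0 u))"
      by (rule nn_integral_pow4_le[OF L2fun_davg[OF u]])
    also have "\<dots> \<le> ennreal (nsq u * (2 * nsq u + 2 * C * D))"
    proof (intro ennreal_leI mult_left_mono ip_self_nonneg)
      have "davg 0 u = (\<lambda>x. u x - r 0 x)" by (simp add: r_def)
      then have "nsq (davg 0 u) = nsq u - 2 * ip u (r 0) + nsq (r 0)"
        using ip_diff_sq[OF uL rL] by simp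
      \<comment> \<open>Nonnegativity of the norm of u + r 0 controls the cross term in the norm of
        u - r 0, which is \<open>davg 0 u\<close>.\<close>
      moreover have "0 \<le> nsq u + 2 * ip u (r 0) + nsq (r 0)"
        using ip_lin_sq[OF uL rL, of 1 1 0] ip_self_nonneg[of "\<lambda>x. 1 * u x + 1 * r 0 x"] by simp
      ultimately show "nsq (davg 0 u) \<le> 2 * nsq u + 2 * C * D" using rb[of 0] by simp
    qed
    finally show ?thesis .
  qed
  have Pk: "(\<integral>\<^sup>+x. ennreal ((davg K u x)^4) \<partial>lborel) \<le> ennreal (8 * (nsq u * (2 * nsq u + 2 * C * D)) + 32000 * E)" for K
  proof -
    have "(\<integral>\<^sup>+x. ennreal ((davg K u x)^4) \<partial>lborel)
        \<le> (\<integral>\<^sup>+x. ennreal 8 * ennreal ((davg 0 u x)^4) + (\<Sum>k<K. ennreal (8000 * (1000/729)^k) * ennreal ((d k x)^4)) \<partial>lborel)"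
    proof (rule nn_integral_mono)
      fix x
      have t: "davg K u x = davg 0 u x + (\<Sum>k<K. d k x)"
        unfolding d_def by (simp add: sum_lessThan_telescope[of "\<lambda>k. davg k u x"])
      have "(a + b)^4 \<le> 8 * a^4 + 8 * b^4" for a b :: real
      proof -
        have "(a + b)^2 \<le> 2 * a^2 + 2 * b^2" using zero_le_power2[of "a - b"] by (simp add: power2_eq_square algebra_simps)
        then have "((a + b)^2)^2 \<le> (2 * a^2 + 2 * b^2)^2" by (intro power_mono) auto
        moreover have "(2 * a^2 + 2 * b^2)^2 \<le> 8 * (a^2)^2 + 8 * (b^2)^2"
          using zero_le_power2[of "a^2 - b^2"] by (simp add: power2_eq_square algebra_simps)
        ultimately show ?thesis by (simp flip: power_mult)
      qed
      then have "(davg K u x)^4 \<le> 8 * (davg 0 u x)^4 + 8 * (\<Sum>k<K. d k x)^4" unfolding t .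
      also have "\<dots> \<le> 8 * (davg 0 u x)^4 + 8 * (1000 * (\<Sum>k<K. (1000/729)^k * (d k x)^4))"
        using weighted_sum_pow4[of "\<lambda>k. d k x" K] by linarith
      also have "\<dots> = 8 * (davg 0 u x)^4 + (\<Sum>k<K. (8000 * (1000/729)^k) * (d k x)^4)"
        by (simp add: sum_distrib_left mult_ac)
      finally have "ennreal ((davg K u x)^4) \<le> ennreal (8 * (davg 0 u x)^4 + (\<Sum>k<K. (8000 * (1000/729)^k) * (d k x)^4))"
        by (rule ennreal_leI)
      also have "\<dots> = ennreal 8 * ennreal ((davg 0 u x)^4) + (\<Sum>k<K. ennreal (8000 * (1000/729)^k) * ennreal ((d k x)^4))"
        by (subst sum_ennreal_mult) (simp_all add: sum_nonneg ennreal_mult)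
      finally show "ennreal ((davg K u x)^4) \<le> ennreal 8 * ennreal ((davg 0 u x)^4) + (\<Sum>k<K. ennreal (8000 * (1000/729)^k) * ennreal ((d k x)^4))" .
    qed
    also have "\<dots> = ennreal 8 * (\<integral>\<^sup>+x. ennreal ((davg 0 u x)^4) \<partial>lborel) + (\<Sum>k<K. ennreal (8000 * (1000/729)^k) * (\<integral>\<^sup>+x. ennreal ((d k x)^4) \<partial>lborel))"
      using dm' by (simp add: nn_integral_add nn_integral_cmult nn_integral_sum)
    also have "\<dots> \<le> ennreal 8 * ennreal (nsq u * (2 * nsq u + 2 * C * D)) + (\<Sum>k<K. ennreal (8000 * (1000/729)^k) * ennreal (E * (1/2)^k))"
      by (intro add_mono mult_left_mono sum_mono P0 d4) auto
    also have "\<dots> = ennreal (8 * (nsq u * (2 * nsq u + 2 * C * D)) + (\<Sum>k<K. (8000 * (1000/729)^k) * (E * (1/2)^k)))"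
      using E0 C0 D0 ip_self_nonneg[of u]
      by (subst sum_ennreal_mult) (simp_all add: sum_nonneg ennreal_mult)
    also have "\<dots> \<le> ennreal (8 * (nsq u * (2 * nsq u + 2 * C * D)) + 32000 * E)"
    proof (intro ennreal_leI add_left_mono)
      have "(\<Sum>k<K. (8000 * (1000/729)^k) * (E * (1/2)^k)) = 8000 * E * (\<Sum>k<K. (500/729)^k)"
      proof -
        \<comment> \<open>The ratio 500/729 is below 1 and its geometric series sums to 729/229,
          less than 4.\<close>
        have "(1000/729::real)^k * (1/2)^k = (500/729)^k" for k by (simp flip: power_mult_distrib)
        then show ?thesis unfolding sum_distrib_left by (intro sum.cong refl) (simp add: mult_ac)
      qed
      also have "\<dots> \<le> 8000 * E * 4"
      proof (rule mult_left_mono)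
        have "(\<Sum>k<K. (500/729::real)^k) \<le> (\<Sum>k. (500/729)^k)" by (intro sum_le_suminf summable_geometric) auto
        also have "\<dots> \<le> 4" by (simp add: suminf_geometric)
        finally show "(\<Sum>k<K. (500/729::real)^k) \<le> 4" .
      qed (use E0 in auto)
      finally show "(\<Sum>k<K. (8000 * (1000/729)^k) * (E * (1/2)^k)) \<le> 32000 * E" by simp
    qed
    finally show ?thesis .
  qed
  \<comment> \<open>The bounds on the averages are uniform in the scale. The residuals tend to 0 in
    mean, so a subsequence of the averages converges to u almost everywhere, and Fatou's lemma
    transfers the bound.\<close>
  have "(\<lambda>k. \<integral>x. norm ((r k x)^2) \<partial>lborel) \<longlonglongrightarrow> 0"
  proof (rule tendsto_sandwich[OF _ _ tendsto_const])
    have "(\<lambda>k. C * D * (1/4)^k) \<longlonglongrightarrow> C * D * 0" by (intro tendsto_intros LIMSEQ_realpow_zero) auto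
    then show "(\<lambda>k. C * D * (1/4)^k) \<longlonglongrightarrow> 0" by simp
    show "\<forall>\<^sub>F k in sequentially. (\<integral>x. norm ((r k x)^2) \<partial>lborel) \<le> C * D * (1/4)^k"
      using rb by (simp add: ip_self power_divide)
  qed auto
  from tendsto_L1_AE_subseq[OF L2fun_sq[OF rL] this]
  obtain s where s: "strict_mono (s::nat\<Rightarrow>nat)" "AE x in lborel. (\<lambda>k. (r (s k) x)^2) \<longlonglongrightarrow> 0" by blast
  have "(\<integral>\<^sup>+x. ennreal ((u x)^4) \<partial>lborel) = (\<integral>\<^sup>+x. liminf (\<lambda>k. ennreal ((davg (s k) u x)^4)) \<partial>lborel)"
  proof (rule nn_integral_cong_AE)
    show "AE x in lborel. ennreal ((u x)^4) = liminf (\<lambda>k. ennreal ((davg (s k) u x)^4))"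
      using s(2)
    proof eventually_elim
      case (elim x)
      then have "(\<lambda>k. r (s k) x) \<longlonglongrightarrow> 0" by simp
      then have "(\<lambda>k. u x - r (s k) x) \<longlonglongrightarrow> u x - 0" by (intro tendsto_intros)
      then have "(\<lambda>k. davg (s k) u x) \<longlonglongrightarrow> u x" by (simp add: r_def)
      then have lm: "(\<lambda>k. ennreal ((davg (s k) u x)^4)) \<longlonglongrightarrow> ennreal ((u x)^4)"
        by (intro tendsto_ennrealI tendsto_power)
      show ?case by (rule lim_imp_Liminf[OF _ lm, symmetric]) simp
    qed
  qed
  also have "\<dots> \<le> liminf (\<lambda>k. \<integral>\<^sup>+x. ennreal ((davg (s k) u x)^4) \<partial>lborel)"
    by (intro nn_integral_liminf) measurable
  also have "\<dots> \<le> limsup (\<lambda>k. \<integral>\<^sup>+x. ennreal ((davg (s k) u x)^4) \<partial>lborel)"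
    by (intro Liminf_le_Limsup) auto
  also have "\<dots> \<le> ennreal (8 * (nsq u * (2 * nsq u + 2 * C * D)) + 32000 * E)"
    by (intro Limsup_bounded always_eventually allI Pk)
  also have "\<dots> \<le> ennreal ((16 + 16 * (2 ^ CARD('n) * real CARD('n)) + 128000 * 2 ^ CARD('n) * (2 ^ CARD('n) * real CARD('n))^2) * (nsq u + dip u u)^2)"
  proof (rule ennreal_leI)
    define I where "I = nsq u"
    have I0: "0 \<le> I" by (simp add: I_def ip_self_nonneg)
    have 1: "I * I \<le> (I + D)^2" "I * D \<le> (I + D)^2" "D^2 \<le> (I + D)^2"
      using I0 D0 by (simp_all add: power2_eq_square algebra_simps)
    \<comment> \<open>The three constants are 8 times 2, 8 times 2 C, and 32000 times the factor 4
      in \<open>E\<close>.\<close>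
    have "8 * (I * (2 * I + 2 * C * D)) + 32000 * E = 16 * (I * I) + 16 * C * (I * D) + (128000 * 2 ^ CARD('n) * C^2) * D^2"
      by (simp add: E_def algebra_simps)
    also have "\<dots> \<le> 16 * (I + D)^2 + 16 * C * (I + D)^2 + (128000 * 2 ^ CARD('n) * C^2) * (I + D)^2"
      using C0 by (intro add_mono mult_left_mono 1) auto
    finally show "8 * (nsq u * (2 * nsq u + 2 * C * D)) + 32000 * E \<le> (16 + 16 * (2 ^ CARD('n) * real CARD('n)) + 128000 * 2 ^ CARD('n) * (2 ^ CARD('n) * real CARD('n))^2) * (nsq u + dip u u)^2"
      unfolding I_def[symmetric] D_def[symmetric] C_def[symmetric] by (simp add: distrib_right)
  qed
  finally show ?thesis .
qed

lemma sobolev: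
  assumes N: "CARD('n::finite) \<le> 3"
  obtains S where "S > 0" "\<And>u :: real^'n \<Rightarrow> real. H1 u \<Longrightarrow> integrable lborel (\<lambda>x. (u x)^4)"
    "\<And>u :: real^'n \<Rightarrow> real. H1 u \<Longrightarrow> (\<integral>x. (u x)^4 \<partial>lborel) \<le> S * (nsq u + dip u u)^2"
proof -
  define S :: real where "S = 16 + 16 * (2 ^ CARD('n) * real CARD('n)) + 128000 * 2 ^ CARD('n) * (2 ^ CARD('n) * real CARD('n))^2"
  have S: "0 < S" unfolding S_def by (intro add_pos_nonneg) auto
  have i: "integrable lborel (\<lambda>x. (u x)^4)" if u: "H1 u" for u :: "real^'n \<Rightarrow> real"
  proof (rule integrableI_bounded)
    show "(\<lambda>x. (u x)^4) \<in> borel_measurable lborel"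
      using L2fun_meas[OF H1_L2[OF u]] by (intro borel_measurable_power) simp
    show "(\<integral>\<^sup>+x. ennreal (norm ((u x)^4)) \<partial>lborel) < \<infinity>"
      using sobolev_nn[OF N u] by (auto simp: order.strict_trans1)
  qed
  have "(\<integral>x. (u x)^4 \<partial>lborel) \<le> S * (nsq u + dip u u)^2" if u: "H1 u" for u :: "real^'n \<Rightarrow> real"
  proof -
    have "ennreal (\<integral>x. (u x)^4 \<partial>lborel) = (\<integral>\<^sup>+x. ennreal ((u x)^4) \<partial>lborel)"
      by (intro nn_integral_eq_integral[symmetric] i u) auto
    also have "\<dots> \<le> ennreal (S * (nsq u + dip u u)^2)" unfolding S_def by (rule sobolev_nn[OF N u])
    finally show ?thesis using S by simp
  qed
  then show ?thesis using that[OF S] i by blast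
qed

section \<open>The energy space\<close>

lemma finite_weak_compact:
  fixes f :: "'i \<Rightarrow> nat \<Rightarrow> real^'n::finite \<Rightarrow> real"
  assumes "finite I" and L2: "\<And>i n. L2fun (f i n)" and bd: "\<And>i n. nsq (f i n) \<le> M"
  shows "\<exists>r z. strict_mono (r::nat\<Rightarrow>nat) \<and> (\<forall>i\<in>I. L2fun (z i) \<and> wconv (\<lambda>n. f i (r n)) (z i))"
  using assms(1)
proof induction
  case empty
  have "strict_mono (\<lambda>n::nat. n)" by (simp add: strict_mono_def)
  then show ?case by blast
next
  case (insert j I)
  then obtain r z where r: "strict_mono (r::nat\<Rightarrow>nat)" and z: "\<forall>i\<in>I. L2fun (z i) \<and> wconv (\<lambda>n. f i (r n)) (z i)"
    by blast
  obtain y s where y: "L2fun y" and s: "strict_mono (s::nat\<Rightarrow>nat)" and w: "wconv (\<lambda>n. f j (r (s n))) y"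
    by (rule L2_weak_compact[of "\<lambda>n. f j (r n)", OF L2 bd])
  have "strict_mono (\<lambda>n. r (s n))" using r s by (simp add: strict_mono_def)
  moreover have "wconv (\<lambda>n. f i (r (s n))) (z i)" if "i \<in> I" for i
    using z that wconv_subseq[of "\<lambda>n. f i (r n)" "z i" s] s by blast
  ultimately show ?case using y w z insert.hyps
    by (intro exI[of _ "\<lambda>n. r (s n)"] exI[of _ "z(j := y)"]) auto
qed

text \<open>One component of the energy space, so that each estimate is proved once and applied to
  both components.\<close>

definition XV :: "(real^'n::finite \<Rightarrow> real) \<Rightarrow> (real^'n \<Rightarrow> real) \<Rightarrow> bool" where
  "XV V u \<longleftrightarrow> H1 u \<and> integrable lborel (\<lambda>x. V x * (u x)^2)"

text \<open>The energy form of one component. The potential part is written as an L2 product of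
  functions weighted by the root of V, so that Cauchy-Schwarz and weak compactness in L2 apply to it
  directly.\<close>

definition ebil :: "real \<Rightarrow> (real^'n::finite \<Rightarrow> real) \<Rightarrow> (real^'n \<Rightarrow> real) \<Rightarrow> (real^'n \<Rightarrow> real) \<Rightarrow> real" where
  "ebil \<epsilon> V u v = \<epsilon>^2 * dip u v + ip (\<lambda>x. sqrt (V x) * u x) (\<lambda>x. sqrt (V x) * v x)"

lemma Xsp_iff: "(u1, u2) \<in> Xsp V1 V2 \<longleftrightarrow> XV V1 u1 \<and> XV V2 u2"
  by (auto simp: Xsp_def XV_def)

lemma XV_L2:
  assumes "XV V u" "\<And>x. 0 \<le> V x" "V \<in> borel_measurable borel"
  shows "L2fun (\<lambda>x. sqrt (V x) * u x)"
proof -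
  have [measurable]: "V \<in> borel_measurable borel" "u \<in> borel_measurable borel"
    using assms L2fun_meas[OF H1_L2] by (auto simp: XV_def)
  have "(\<lambda>x. (sqrt (V x) * u x)^2) = (\<lambda>x. V x * (u x)^2)" using assms(2) by (simp add: power_mult_distrib)
  then show ?thesis using assms(1) by (simp add: L2fun_def XV_def)
qed

lemma XV_iff:
  assumes "\<And>x. 0 \<le> V x" "V \<in> borel_measurable borel"
  shows "XV V u \<longleftrightarrow> H1 u \<and> L2fun (\<lambda>x. sqrt (V x) * u x)"
proof -
  have "(\<lambda>x. (sqrt (V x) * u x)^2) = (\<lambda>x. V x * (u x)^2)" using assms(1) by (simp add: power_mult_distrib)
  then show ?thesis using XV_L2[of V u] assms L2fun_sq[of "\<lambda>x. sqrt (V x) * u x"] by (auto simp: XV_def)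
qed

lemma ebil_self:
  assumes "XV V u" "\<And>x. 0 \<le> V x"
  shows "(\<integral>x. \<epsilon>^2 * (norm (wgrad u x))^2 + V x * (u x)^2 \<partial>lborel) = ebil \<epsilon> V u u"
proof -
  have "nsq (\<lambda>x. sqrt (V x) * u x) = (\<integral>x. V x * (u x)^2 \<partial>lborel)"
    unfolding ip_self using assms(2) by (simp add: power_mult_distrib)
  moreover have "integrable lborel (\<lambda>x. (norm (wgrad u x))^2)"
    using assms by (intro norm_sq_integral(1) wgrad_L2) (simp add: XV_def)
  ultimately show ?thesis using assms by (simp add: ebil_def dip_self XV_def)
qed

lemma Xnormsq_eq:
  assumes "XV V1 u1" "XV V2 u2" "\<And>x. 0 \<le> V1 x" "\<And>x. 0 \<le> V2 x"
  shows "Xnormsq \<epsilon> V1 V2 (u1, u2) = ebil \<epsilon> V1 u1 u1 + ebil \<epsilon> V2 u2 u2"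
  using assms by (simp add: Xnormsq_def ebil_self)

lemma ebil_nonneg: "0 \<le> ebil \<epsilon> V u u"
  unfolding ebil_def by (intro add_nonneg_nonneg mult_nonneg_nonneg dip_nonneg ip_self_nonneg) auto

lemma XV_lin:
  assumes "XV V u" "XV V v" "\<And>x. 0 \<le> V x" "V \<in> borel_measurable borel"
  shows "XV V (\<lambda>x. a * u x + b * v x)"
proof -
  have "L2fun (\<lambda>x. a * (sqrt (V x) * u x) + b * (sqrt (V x) * v x))"
    using assms by (intro L2fun_lin XV_L2)
  then show ?thesis using assms H1_lin[of u v a b] by (simp add: XV_iff algebra_simps)
qed

lemma ebil_lin_sq:
  assumes "XV V u" "XV V v" "\<And>x. 0 \<le> V x" "V \<in> borel_measurable borel"
  shows "ebil \<epsilon> V (\<lambda>x. a * u x + b * v x) (\<lambda>x. a * u x + b * v x)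
    = a^2 * ebil \<epsilon> V u u + 2 * a * b * ebil \<epsilon> V u v + b^2 * ebil \<epsilon> V v v"
proof -
  have e: "(\<lambda>x. sqrt (V x) * (a * u x + b * v x)) = (\<lambda>x. a * (sqrt (V x) * u x) + b * (sqrt (V x) * v x))"
    by (simp add: algebra_simps)
  show ?thesis using assms ip_lin_sq[OF XV_L2[OF assms(1,3,4)] XV_L2[OF assms(2,3,4)], of a b]
    by (simp add: ebil_def e dip_lin_sq XV_def algebra_simps)
qed

lemma ebil_lower:
  assumes "XV V u" "\<And>x. m \<le> V x" "0 < m" "V \<in> borel_measurable borel"
  shows "\<epsilon>^2 * dip u u + m * nsq u \<le> ebil \<epsilon> V u u"
proof -
  have V0: "0 \<le> V x" for x using assms(2)[of x] assms(3) by linarith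
  have u: "L2fun u" using assms(1) H1_L2 by (auto simp: XV_def)
  have "nsq (\<lambda>x. sqrt m * u x) \<le> nsq (\<lambda>x. sqrt (V x) * u x)"
  proof (rule ip_self_mono[OF XV_L2[OF assms(1) V0 assms(4)]])
    show "(\<lambda>x. sqrt m * u x) \<in> borel_measurable borel" using L2fun_meas[OF u] by measurable
    show "\<bar>sqrt m * u x\<bar> \<le> \<bar>sqrt (V x) * u x\<bar>" for x
      unfolding abs_mult using assms(2)[of x] assms(3) by (intro mult_right_mono) auto
  qed
  moreover have "nsq (\<lambda>x. sqrt m * u x) = m * nsq u"
    using ip_lin_sq[OF u u, of "sqrt m" 0] assms(3) by simp
  ultimately show ?thesis by (simp add: ebil_def)
qed

text \<open>The bounded weight \<open>1 / (1 + \<surd>V)\<close> lets \<open>\<surd>V z\<close> be tested against \<open>L\<^sup>2\<close> before it is known to be in \<open>L\<^sup>2\<close>.\<close>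
lemma weak_limit_weighted:
  fixes f :: "nat \<Rightarrow> real^'n::finite \<Rightarrow> real"
  assumes V: "\<And>x. 0 \<le> V x" "V \<in> borel_measurable borel"
    and f: "\<And>n. L2fun (f n)" and Vf: "\<And>n. L2fun (\<lambda>x. sqrt (V x) * f n x)"
    and z: "L2fun z" "wconv f z" and h: "L2fun h" "wconv (\<lambda>n x. sqrt (V x) * f n x) h"
  shows "AE x in lborel. h x = sqrt (V x) * z x"
proof -
  define w where "w x = 1 / (1 + sqrt (V x))" for x
  have w: "0 < w x" "w x \<le> 1" "w x * sqrt (V x) \<le> 1" for x
  proof -
    have "0 < 1 + sqrt (V x)" using V(1)[of x] real_sqrt_ge_zero[of "V x"] by linarith
    then show "0 < w x" "w x \<le> 1" "w x * sqrt (V x) \<le> 1"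
      using V(1)[of x] by (auto simp: w_def field_simps)
  qed
  have [measurable]: "V \<in> borel_measurable borel" by (rule V)
  have wm[measurable]: "w \<in> borel_measurable borel" unfolding w_def[abs_def] by measurable
  have [measurable]: "h \<in> borel_measurable borel" "z \<in> borel_measurable borel" using h z L2fun_meas by auto
  have w1: "L2fun (\<lambda>x. w x * g x)" "L2fun (\<lambda>x. w x * sqrt (V x) * g x)" if g: "L2fun g" for g
  proof -
    have [measurable]: "g \<in> borel_measurable borel" using g L2fun_meas by auto
    have "\<bar>w x * g x\<bar> \<le> \<bar>g x\<bar>" for x
      using w(1,2)[of x] mult_right_mono[of "w x" 1 "\<bar>g x\<bar>"] by (simp add: abs_mult)
    then show "L2fun (\<lambda>x. w x * g x)" by (intro L2fun_bound[OF g]) auto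
    have "\<bar>w x * sqrt (V x) * g x\<bar> \<le> \<bar>g x\<bar>" for x
      using w[of x] V(1)[of x] mult_right_mono[of "w x * sqrt (V x)" 1 "\<bar>g x\<bar>"]
      by (simp add: abs_mult)
    then show "L2fun (\<lambda>x. w x * sqrt (V x) * g x)" by (intro L2fun_bound[OF g]) auto
  qed
  define k where "k x = w x * h x - w x * sqrt (V x) * z x" for x
  have k: "L2fun k" unfolding k_def by (intro L2fun_diff w1 h z)
  have "ip h (\<lambda>x. w x * k x) = ip z (\<lambda>x. w x * sqrt (V x) * k x)"
  proof (rule LIMSEQ_unique)
    show "(\<lambda>n. ip (\<lambda>x. sqrt (V x) * f n x) (\<lambda>x. w x * k x)) \<longlonglongrightarrow> ip h (\<lambda>x. w x * k x)"
      using h(2) w1(1)[OF k] by (simp add: wconv_def)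
    have "(\<lambda>n. ip (f n) (\<lambda>x. w x * sqrt (V x) * k x)) \<longlonglongrightarrow> ip z (\<lambda>x. w x * sqrt (V x) * k x)"
      using z(2) w1(2)[OF k] by (simp add: wconv_def)
    then show "(\<lambda>n. ip (\<lambda>x. sqrt (V x) * f n x) (\<lambda>x. w x * k x)) \<longlonglongrightarrow> ip z (\<lambda>x. w x * sqrt (V x) * k x)"
      by (simp add: ip_def mult_ac)
  qed
  then have "ip (\<lambda>x. w x * h x) k = ip (\<lambda>x. w x * sqrt (V x) * z x) k"
    by (simp add: ip_def mult_ac)
  then have "nsq k = 0"
    using ip_diff_left[OF w1(1)[OF h(1)] w1(2)[OF z(1)] k] unfolding k_def[abs_def, symmetric] by simp
  then have "AE x in lborel. k x = 0" using ip_self_eq_0[OF k] by simp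
  then show ?thesis
  proof eventually_elim
    case (elim x)
    then have "w x * (h x - sqrt (V x) * z x) = 0" by (simp add: k_def algebra_simps)
    then show ?case using w(1)[of x] by simp
  qed
qed

text \<open>Weak limits of the functions, the weighted functions and all partial derivatives are
  taken along one subsequence and identified with the corresponding data of \<open>z\<close>.
  Convergence of the form is claimed only against \<open>z\<close>, as needed for expanding the
  energy of u - z.\<close>

lemma XV_weak_compact:
  fixes u :: "nat \<Rightarrow> real^'n::finite \<Rightarrow> real"
  assumes V: "\<And>x. m \<le> V x" "0 < m" "V \<in> borel_measurable borel" and e: "\<epsilon> > 0"
    and u: "\<And>n. XV V (u n)" and bd: "\<And>n. ebil \<epsilon> V (u n) (u n) \<le> M"
  obtains r z where "strict_mono (r::nat\<Rightarrow>nat)" "XV V z" "wconv (\<lambda>n. u (r n)) z"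
    "(\<lambda>n. ebil \<epsilon> V (u (r n)) z) \<longlonglongrightarrow> ebil \<epsilon> V z z"
proof -
  have V0: "0 \<le> V x" for x using V(1)[of x] V(2) by linarith
  note uV = XV_L2[OF u V0 V(3)]
  have uH: "H1 (u n)" for n using u by (simp add: XV_def)
  have uL: "L2fun (u n)" for n using uH H1_L2 by blast
  \<comment> \<open>The index type lists everything that needs a limit: \<open>None\<close> is the
    function, \<open>Some None\<close> the weighted function, \<open>Some (Some j)\<close> the j-th
    partial derivative.\<close>
  define f :: "'n option option \<Rightarrow> nat \<Rightarrow> real^'n \<Rightarrow> real" where
    "f i n = (case i of None \<Rightarrow> u n | Some None \<Rightarrow> (\<lambda>x. sqrt (V x) * u n x) | Some (Some j) \<Rightarrow> (\<lambda>x. wgrad (u n) x $ j))" for i n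
  have fL: "L2fun (f i n)" for i n unfolding f_def using uL uV wgrad_L2[OF uH] by (auto split: option.splits)
  have fb: "nsq (f i n) \<le> max (M / m) (max M (M / \<epsilon>^2))" for i n
  proof -
    have l: "\<epsilon>^2 * dip (u n) (u n) + m * nsq (u n) \<le> M"
      using ebil_lower[OF u V, of \<epsilon> n] bd[of n] by linarith
    have n1: "0 \<le> \<epsilon>^2 * dip (u n) (u n)" "0 \<le> m * nsq (u n)"
      using V(2) by (auto simp: dip_nonneg ip_self_nonneg)
    have 1: "nsq (u n) \<le> M / m" using l n1 V(2) by (simp add: field_simps)
    have d: "dip (u n) (u n) \<le> M / \<epsilon>^2" using l n1 e by (simp add: field_simps)
    have 2: "nsq (\<lambda>x. wgrad (u n) x $ j) \<le> M / \<epsilon>^2" for j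
    proof -
      have "nsq (\<lambda>x. wgrad (u n) x $ j) \<le> dip (u n) (u n)"
        unfolding dip_def by (intro member_le_sum) (auto simp: ip_self_nonneg)
      then show ?thesis using d by linarith
    qed
    have 3: "nsq (\<lambda>x. sqrt (V x) * u n x) \<le> M"
      using bd[of n] n1 by (simp add: ebil_def)
    show ?thesis unfolding f_def using 1 2 3 by (auto split: option.splits simp: le_max_iff_disj)
  qed
  obtain r y where r: "strict_mono (r::nat\<Rightarrow>nat)"
    and yL: "\<And>i. L2fun (y i)" and yw: "\<And>i. wconv (\<lambda>n. f i (r n)) (y i)"
    using finite_weak_compact[of UNIV f, OF _ fL fb] by auto
  define z where "z = y None"
  have z: "L2fun z" "wconv (\<lambda>n. u (r n)) z" using yL[of None] yw[of None] by (auto simp: z_def f_def)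
  define G where "G x = (\<chi> j. y (Some (Some j)) x)" for x
  have Gj: "(\<lambda>x. G x $ j) = y (Some (Some j))" for j by (simp add: G_def)
  have Gw: "wconv (\<lambda>n x. wgrad (u (r n)) x $ j) (\<lambda>x. G x $ j)" for j
    using yw[of "Some (Some j)"] unfolding Gj by (simp add: f_def)
  have wg: "is_weak_grad z G"
    unfolding is_weak_grad_ip
  proof (intro conjI allI impI)
    show "L2fun (\<lambda>x. G x $ j)" for j unfolding Gj by (rule yL)
    fix \<phi> :: "real^'n \<Rightarrow> real" and j assume t: "test_fun \<phi>"
    have "(\<lambda>n. ip (u (r n)) (partial_deriv j \<phi>)) \<longlonglongrightarrow> ip z (partial_deriv j \<phi>)"
      using z(2) test_fun_partial_L2[OF t] by (simp add: wconv_def)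
    moreover have "ip (u (r n)) (partial_deriv j \<phi>) = - ip (\<lambda>x. wgrad (u (r n)) x $ j) \<phi>" for n
      using H1_wgrad[OF uH] t by (simp add: is_weak_grad_ip)
    moreover have "(\<lambda>n. - ip (\<lambda>x. wgrad (u (r n)) x $ j) \<phi>) \<longlonglongrightarrow> - ip (\<lambda>x. G x $ j) \<phi>"
      using Gw[of j] test_fun_L2[OF t] by (intro tendsto_minus) (simp add: wconv_def)
    ultimately show "ip z (partial_deriv j \<phi>) = - ip (\<lambda>x. G x $ j) \<phi>"
      using LIMSEQ_unique by simp
  qed (rule z)
  define h where "h = y (Some None)"
  have h: "L2fun h" "wconv (\<lambda>n x. sqrt (V x) * u (r n) x) h"
    using yL[of "Some None"] yw[of "Some None"] by (auto simp: h_def f_def)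
  have hz: "AE x in lborel. h x = sqrt (V x) * z x"
    by (rule weak_limit_weighted[OF V0 V(3) uL uV z h])
  have zm[measurable]: "z \<in> borel_measurable borel" "V \<in> borel_measurable borel" using z V L2fun_meas by auto
  have Vz: "L2fun (\<lambda>x. sqrt (V x) * z x)"
    using hz by (intro L2fun_AE_cong[OF h(1)]) auto
  have zH: "H1 z" using wg by (auto simp: H1_def)
  have XVz: "XV V z" using zH Vz by (simp add: XV_iff V0 V(3))
  have "(\<lambda>n. ip (\<lambda>x. wgrad (u (r n)) x $ j) (\<lambda>x. wgrad z x $ j)) \<longlonglongrightarrow> nsq (\<lambda>x. wgrad z x $ j)" for j
  proof -
    have "AE x in lborel. G x $ j = wgrad z x $ j" using wgrad_AE[OF wg] by eventually_elim simp
    then have "ip (\<lambda>x. G x $ j) (\<lambda>x. wgrad z x $ j) = nsq (\<lambda>x. wgrad z x $ j)"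
      using weak_grad_L2(2)[OF wg, of j] wgrad_L2[OF zH, of j] by (intro ip_AE_cong) (auto simp: L2fun_def)
    then show ?thesis using Gw[of j] wgrad_L2[OF zH, of j] by (auto simp: wconv_def)
  qed
  then have d: "(\<lambda>n. dip (u (r n)) z) \<longlonglongrightarrow> dip z z" unfolding dip_def by (intro tendsto_sum)
  have "ip h (\<lambda>x. sqrt (V x) * z x) = nsq (\<lambda>x. sqrt (V x) * z x)"
    using h(1) Vz hz by (intro ip_AE_cong) (auto simp: L2fun_def)
  then have v: "(\<lambda>n. ip (\<lambda>x. sqrt (V x) * u (r n) x) (\<lambda>x. sqrt (V x) * z x)) \<longlonglongrightarrow> nsq (\<lambda>x. sqrt (V x) * z x)"
    using h(2) Vz by (auto simp: wconv_def)
  have "(\<lambda>n. ebil \<epsilon> V (u (r n)) z) \<longlonglongrightarrow> ebil \<epsilon> V z z"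
    unfolding ebil_def by (intro tendsto_intros d v)
  then show ?thesis using that r XVz z by blast
qed

lemma wconv_diff:
  assumes "\<And>n. L2fun (u n)" "L2fun z" "wconv u z"
  shows "wconv (\<lambda>n x. u n x - z x) (\<lambda>x. 0)"
  unfolding wconv_def
proof (intro allI impI)
  fix g :: "real^'a \<Rightarrow> real" assume g: "L2fun g"
  have "(\<lambda>n. ip (u n) g - ip z g) \<longlonglongrightarrow> ip z g - ip z g"
    using assms g by (intro tendsto_intros) (simp add: wconv_def)
  then show "(\<lambda>n. ip (\<lambda>x. u n x - z x) g) \<longlonglongrightarrow> ip (\<lambda>x. 0) g"
    using ip_diff_left[OF assms(1,2) g] by (simp add: ip_def[of "\<lambda>x. 0"])
qed

text \<open>Here \<open>P\<close> is small in \<open>L\<^sup>2\<close> outside a ball and above a high level, while on the remaining set it is bounded.\<close>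
lemma local_decay_product:
  fixes P :: "real^'n::finite \<Rightarrow> real" and R :: "nat \<Rightarrow> real^'n \<Rightarrow> real"
  assumes P: "L2fun P" "\<And>x. 0 \<le> P x" and R: "\<And>n. L2fun (R n)" "\<And>n x. 0 \<le> R n x"
    and Rb: "\<And>n. nsq (R n) \<le> K"
    and loc: "\<And>r. (\<lambda>n. \<integral>x. indicat_real (cball 0 r) x * R n x \<partial>lborel) \<longlonglongrightarrow> 0"
    and Ri: "\<And>n. integrable lborel (R n)"
  shows "(\<lambda>n. ip P (R n)) \<longlonglongrightarrow> 0"
proof (rule LIMSEQ_I)
  fix e :: real assume e: "0 < e"
  have [measurable]: "P \<in> borel_measurable borel" "R n \<in> borel_measurable borel" for n
    using L2fun_meas[OF P(1)] L2fun_meas[OF R(1)] by auto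
  have K0: "0 \<le> K" using Rb[of 0] ip_self_nonneg[of "R 0"] by linarith
  define A where "A m = {x :: real^'n. norm x \<le> real m \<and> P x \<le> real m}" for m
  have [measurable]: "A m \<in> sets borel" for m unfolding A_def by measurable
  define Q where "Q m x = indicat_real (- A m) x * P x" for m x
  have [measurable]: "Q m \<in> borel_measurable borel" for m unfolding Q_def by measurable
  have QL: "L2fun (Q m)" for m by (rule L2fun_bound[OF P(1)]) (auto simp: Q_def indicator_def P)
  have "(\<lambda>m. \<integral>x. (Q m x)^2 \<partial>lborel) \<longlonglongrightarrow> (\<integral>x. 0 \<partial>(lborel :: (real^'n) measure))"
  proof (rule integral_dominated_convergence[OF _ _ L2fun_sq[OF P(1)]])
    show "AE x in lborel. (\<lambda>m. (Q m x)^2) \<longlonglongrightarrow> 0"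
    proof (intro AE_I2 tendsto_eventually)
      fix x :: "real^'n"
      obtain m0 :: nat where "max (norm x) (P x) \<le> real m0" using real_arch_simple by blast
      then have "Q m x = 0" if "m \<ge> m0" for m
        using that by (auto simp: Q_def A_def indicator_def)
      then show "\<forall>\<^sub>F m in sequentially. (Q m x)^2 = 0" by (auto simp: eventually_sequentially)
    qed
    show "AE x in lborel. norm ((Q m x)^2) \<le> (P x)^2" for m
      by (intro AE_I2) (auto simp: Q_def indicator_def)
  qed auto
  then have "(\<lambda>m. sqrt (nsq (Q m)) * sqrt K) \<longlonglongrightarrow> sqrt 0 * sqrt K"
    unfolding ip_self by (intro tendsto_intros) simp
  from order_tendstoD(2)[OF this, of "e / 2"] e
  obtain m where m: "sqrt (nsq (Q m)) * sqrt K < e / 2" by (auto simp: eventually_sequentially)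
  have "(\<lambda>n. m * (\<integral>x. indicat_real (cball 0 m) x * R n x \<partial>lborel)) \<longlonglongrightarrow> real m * 0"
    by (intro tendsto_intros loc)
  from order_tendstoD(2)[OF this, of "e / 2"] e
  obtain n0 where n0: "\<And>n. n \<ge> n0 \<Longrightarrow> m * (\<integral>x. indicat_real (cball 0 m) x * R n x \<partial>lborel) < e / 2"
    by (auto simp: eventually_sequentially)
  have "norm (ip P (R n) - 0) < e" if "n \<ge> n0" for n
  proof -
    have i: "integrable lborel (\<lambda>x. indicat_real (cball 0 m) x * R n x)" by (intro integrable_cball_mult Ri)
    have "ip P (R n) \<le> (\<integral>x. m * (indicat_real (cball 0 m) x * R n x) + Q m x * R n x \<partial>lborel)"
      unfolding ip_def
    proof (rule integral_mono)
      show "integrable lborel (\<lambda>x. P x * R n x)" by (intro L2fun_mult_integrable P R)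
      show "integrable lborel (\<lambda>x. m * (indicat_real (cball 0 m) x * R n x) + Q m x * R n x)"
        using i L2fun_mult_integrable[OF QL R(1)] by auto
      fix x
      show "P x * R n x \<le> m * (indicat_real (cball 0 m) x * R n x) + Q m x * R n x"
        using P(2)[of x] R(2)[of n x] by (auto simp: Q_def A_def indicator_def mult_right_mono)
    qed
    also have "\<dots> = m * (\<integral>x. indicat_real (cball 0 m) x * R n x \<partial>lborel) + ip (Q m) (R n)"
      unfolding ip_def using i L2fun_mult_integrable[OF QL R(1)]
      by (subst Bochner_Integration.integral_add) auto
    also have "ip (Q m) (R n) \<le> sqrt (nsq (Q m)) * sqrt K"
    proof -
      have "sqrt (nsq (Q m)) * sqrt (nsq (R n)) \<le> sqrt (nsq (Q m)) * sqrt K"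
        using Rb[of n] by (intro mult_left_mono) (auto simp: ip_self_nonneg)
      then show ?thesis using ip_CS_abs[OF QL[of m] R(1)[of n]] by linarith
    qed
    finally have "ip P (R n) < e" using n0[OF that] m by linarith
    moreover have "0 \<le> ip P (R n)" unfolding ip_def using P R by (intro integral_nonneg_AE) auto
    ultimately show ?thesis by simp
  qed
  then show "\<exists>n0. \<forall>n\<ge>n0. norm (ip P (R n) - 0) < e" by blast
qed

section \<open>The quartic functional\<close>

text \<open>The fourth power is encoded through the square, so that products of two such functions
  are in L2 and quartic integrals become L2 products.\<close>

definition L4fun :: "(real^'n::finite \<Rightarrow> real) \<Rightarrow> bool" where
  "L4fun f \<longleftrightarrow> f \<in> borel_measurable borel \<and> L2fun (\<lambda>x. (f x)^2)"

lemma H1_L4: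
  fixes u :: "real^'n::finite \<Rightarrow> real"
  assumes "CARD('n) \<le> 3" "H1 u"
  shows "L4fun u"
proof -
  obtain S where "\<And>u :: real^'n \<Rightarrow> real. H1 u \<Longrightarrow> integrable lborel (\<lambda>x. (u x)^4)"
    using sobolev[OF assms(1)] by metis
  then have i: "integrable lborel (\<lambda>x. (u x)^4)" using assms(2) by blast
  have m[measurable]: "u \<in> borel_measurable borel" using H1_L2[OF assms(2)] L2fun_meas by blast
  have "(\<lambda>x. ((u x)^2)^2) = (\<lambda>x. (u x)^4)" by (simp flip: power_mult)
  then show ?thesis using i m by (simp add: L4fun_def L2fun_def)
qed

lemma L4fun_mult:
  assumes "L4fun f" "L4fun g"
  shows "L2fun (\<lambda>x. f x * g x)"
proof (rule L2fun_bound)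
  have [measurable]: "f \<in> borel_measurable borel" "g \<in> borel_measurable borel" using assms by (auto simp: L4fun_def)
  show "(\<lambda>x. f x * g x) \<in> borel_measurable lborel" by measurable
  show "L2fun (\<lambda>x. (f x)^2 + (g x)^2)" using assms by (intro L2fun_add) (auto simp: L4fun_def)
  show "AE x in lborel. \<bar>f x * g x\<bar> \<le> \<bar>(f x)^2 + (g x)^2\<bar>" using abs_mult_le_squares by simp
qed

lemma L4fun_mult4:
  assumes "L4fun f" "L4fun g" "L4fun h" "L4fun k"
  shows "integrable lborel (\<lambda>x. f x * g x * (h x * k x))"
  by (intro L2fun_mult_integrable L4fun_mult assms)

lemma L4fun_lin:
  assumes "L4fun f" "L4fun g"
  shows "L4fun (\<lambda>x. a * f x + b * g x)"
proof -
  have [measurable]: "f \<in> borel_measurable borel" "g \<in> borel_measurable borel" using assms by (auto simp: L4fun_def)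
  have "L2fun (\<lambda>x. 1 * (a^2 * (f x * f x) + b^2 * (g x * g x)) + (2 * a * b) * (f x * g x))"
    by (intro L2fun_lin L4fun_mult assms)
  then have "L2fun (\<lambda>x. (a * f x + b * g x)^2)" by (simp add: power2_eq_square algebra_simps)
  then show ?thesis by (simp add: L4fun_def)
qed

lemma L4fun_integrand:
  assumes "L4fun u1" "L4fun u2"
  shows "integrable lborel (\<lambda>x. (u1 x)^4)" "integrable lborel (\<lambda>x. (u1 x)^2 * (u2 x)^2)"
    "integrable lborel (\<lambda>x. a1 * (u1 x)^4 + a2 * (u2 x)^4 + 2 * \<beta> * (u1 x)^2 * (u2 x)^2)"
proof -
  have p4: "integrable lborel (\<lambda>x. (u x)^4)" if "L4fun u" for u :: "real^'a \<Rightarrow> real"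
    using L4fun_mult4[OF that that that that] by (simp add: power4_eq_xxxx mult.assoc)
  show 1: "integrable lborel (\<lambda>x. (u1 x)^4)" by (rule p4[OF assms(1)])
  show 2: "integrable lborel (\<lambda>x. (u1 x)^2 * (u2 x)^2)"
    using L4fun_mult4[OF assms(1,1) assms(2,2)] by (simp add: power2_eq_square)
  have "integrable lborel (\<lambda>x. a1 * (u1 x)^4 + a2 * (u2 x)^4 + (2 * \<beta>) * ((u1 x)^2 * (u2 x)^2))"
    using 1 2 p4[OF assms(2)] by simp
  then show "integrable lborel (\<lambda>x. a1 * (u1 x)^4 + a2 * (u2 x)^4 + 2 * \<beta> * (u1 x)^2 * (u2 x)^2)"
    by (simp add: mult.assoc)
qed

lemma Bfun_pair: "Bfun a1 a2 \<beta> (u1, u2) = (\<integral>x. a1 * (u1 x)^4 + a2 * (u2 x)^4 + 2 * \<beta> * (u1 x)^2 * (u2 x)^2 \<partial>lborel)"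
  by (simp add: Bfun_def)

lemma Bfun_scale: "Bfun a1 a2 \<beta> (\<lambda>x. t * u1 x, \<lambda>x. t * u2 x) = t^4 * Bfun a1 a2 \<beta> (u1, u2)"
proof -
  have "(\<lambda>x. a1 * (t * u1 x)^4 + a2 * (t * u2 x)^4 + 2 * \<beta> * (t * u1 x)^2 * (t * u2 x)^2)
      = (\<lambda>x. t^4 * (a1 * (u1 x)^4 + a2 * (u2 x)^4 + 2 * \<beta> * (u1 x)^2 * (u2 x)^2))"
    by (simp add: power_mult_distrib algebra_simps power2_eq_square power4_eq_xxxx)
  then show ?thesis by (simp add: Bfun_pair)
qed

lemma Bfun_abs: "Bfun a1 a2 \<beta> (\<lambda>x. \<bar>u1 x\<bar>, \<lambda>x. \<bar>u2 x\<bar>) = Bfun a1 a2 \<beta> (u1, u2)"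
  by (simp add: Bfun_pair power_even_abs)

lemma Bfun_affine:
  fixes u1 u2 :: "real^'n::finite \<Rightarrow> real"
  assumes [measurable]: "u1 \<in> borel_measurable borel" "u2 \<in> borel_measurable borel" and c: "c > 0"
  shows "Bfun a1 a2 \<beta> (\<lambda>x. u1 (a + c *\<^sub>R x), \<lambda>x. u2 (a + c *\<^sub>R x)) = Bfun a1 a2 \<beta> (u1, u2) / c ^ CARD('n)"
  unfolding Bfun_pair
  using lborel_integral_affine[of "\<lambda>x. a1 * (u1 x)^4 + a2 * (u2 x)^4 + 2 * \<beta> * (u1 x)^2 * (u2 x)^2" c a] c by simp

lemma Bfun_nonneg:
  assumes "0 \<le> a1" "0 \<le> a2" "0 \<le> \<beta>"
  shows "0 \<le> Bfun a1 a2 \<beta> (u1, u2)"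
  unfolding Bfun_pair using assms by (intro integral_nonneg_AE AE_I2) auto

lemma Bfun_AE_zero:
  assumes "AE x in lborel. u1 x = 0" "AE x in lborel. u2 x = 0"
  shows "Bfun a1 a2 \<beta> (u1, u2) = 0"
  unfolding Bfun_pair
proof (rule integral_eq_zero_AE)
  show "AE x in lborel. a1 * (u1 x)^4 + a2 * (u2 x)^4 + 2 * \<beta> * (u1 x)^2 * (u2 x)^2 = 0"
    using assms by eventually_elim simp
qed

lemma Bfun_bound:
  fixes a1 a2 \<beta> :: real
  assumes N: "CARD('n::finite) \<le> 3" and c: "0 \<le> a1" "0 \<le> a2" "0 \<le> \<beta>"
  obtains K where "K > 0" "\<And>u1 u2 :: real^'n \<Rightarrow> real. H1 u1 \<Longrightarrow> H1 u2 \<Longrightarrow>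
    Bfun a1 a2 \<beta> (u1, u2) \<le> K * (nsq u1 + dip u1 u1 + nsq u2 + dip u2 u2)^2"
proof -
  obtain S where S: "S > 0" and Sb: "\<And>u :: real^'n \<Rightarrow> real. H1 u \<Longrightarrow> (\<integral>x. (u x)^4 \<partial>lborel) \<le> S * (nsq u + dip u u)^2"
    using sobolev[OF N] by metis
  \<comment> \<open>The added 1 keeps \<open>K\<close> positive when all coefficients vanish; the
    final 2 comes from A^2 + B^2 \<le> 2 (A + B)^2.\<close>
  define K where "K = (a1 + a2 + 2 * \<beta> + 1) * S * 2"
  have "Bfun a1 a2 \<beta> (u1, u2) \<le> K * (nsq u1 + dip u1 u1 + nsq u2 + dip u2 u2)^2"
    if u: "H1 u1" "H1 u2" for u1 u2 :: "real^'n \<Rightarrow> real"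
  proof -
    note L4 = H1_L4[OF N u(1)] H1_L4[OF N u(2)]
    let ?A = "nsq u1 + dip u1 u1" and ?B = "nsq u2 + dip u2 u2"
    have AB: "0 \<le> ?A" "0 \<le> ?B" by (auto simp: ip_self_nonneg dip_nonneg)
    have "Bfun a1 a2 \<beta> (u1, u2) \<le> (\<integral>x. (a1 + a2 + 2 * \<beta> + 1) * ((u1 x)^4 + (u2 x)^4) \<partial>lborel)"
      unfolding Bfun_pair
    proof (rule integral_mono[OF L4fun_integrand(3)[OF L4]])
      show "integrable lborel (\<lambda>x. (a1 + a2 + 2 * \<beta> + 1) * ((u1 x)^4 + (u2 x)^4))"
        using L4fun_integrand(1)[OF L4] L4fun_integrand(1)[OF L4(2,1)] by simp
      fix x
      let ?s = "(u1 x)^4" and ?t = "(u2 x)^4"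
      have p: "0 \<le> ?s" "0 \<le> ?t" by auto
      have "2 * ((u1 x)^2 * (u2 x)^2) \<le> ?s + ?t"
        using zero_le_power2[of "(u1 x)^2 - (u2 x)^2"] by (simp add: power2_diff flip: power_mult)
      then have "(u1 x)^2 * (u2 x)^2 \<le> ?s + ?t" using p by (smt (verit) zero_le_mult_iff zero_le_power2)
      then have "2 * \<beta> * ((u1 x)^2 * (u2 x)^2) \<le> 2 * \<beta> * (?s + ?t)" using c by (intro mult_left_mono) auto
      moreover have "a1 * ?s \<le> a1 * (?s + ?t)" "a2 * ?t \<le> a2 * (?s + ?t)" using c p by (auto intro!: mult_left_mono)
      ultimately have "a1 * ?s + a2 * ?t + 2 * \<beta> * ((u1 x)^2 * (u2 x)^2) \<le> a1 * (?s + ?t) + a2 * (?s + ?t) + 2 * \<beta> * (?s + ?t) + (?s + ?t)"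
        using p by linarith
      also have "\<dots> = (a1 + a2 + 2 * \<beta> + 1) * (?s + ?t)" by (simp add: algebra_simps)
      finally show "a1 * ?s + a2 * ?t + 2 * \<beta> * (u1 x)^2 * (u2 x)^2 \<le> (a1 + a2 + 2 * \<beta> + 1) * (?s + ?t)"
        by (simp only: mult.assoc)
    qed
    also have "\<dots> = (a1 + a2 + 2 * \<beta> + 1) * ((\<integral>x. (u1 x)^4 \<partial>lborel) + (\<integral>x. (u2 x)^4 \<partial>lborel))"
      using L4fun_integrand(1)[OF L4] L4fun_integrand(1)[OF L4(2,1)] by simp
    also have "\<dots> \<le> (a1 + a2 + 2 * \<beta> + 1) * (S * ?A^2 + S * ?B^2)"
      using c by (intro mult_left_mono add_mono Sb u) auto
    also have "\<dots> \<le> (a1 + a2 + 2 * \<beta> + 1) * (S * (2 * (?A + ?B)^2))"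
    proof (rule mult_left_mono)
      have "?A^2 + ?B^2 \<le> 2 * (?A + ?B)^2"
      proof -
        have "a^2 + b^2 \<le> 2 * (a + b)^2" if "0 \<le> a" "0 \<le> b" for a b :: real
          using that by (simp add: power2_sum)
        then show ?thesis using AB by blast
      qed
      then have "S * (?A^2 + ?B^2) \<le> S * (2 * (?A + ?B)^2)" using S by (intro mult_left_mono) auto
      then show "S * ?A^2 + S * ?B^2 \<le> S * (2 * (?A + ?B)^2)" by (simp add: distrib_left)
    qed (use c in auto)
    also have "\<dots> = K * (?A + ?B)^2" by (simp only: K_def mult_ac)
    finally show ?thesis by (simp only: add.assoc)
  qed
  moreover have "K > 0" using S c by (simp add: K_def add_nonneg_pos)
  ultimately show ?thesis using that by blast
qed

text \<open>That B is a quartic polynomial along lines is all that its differentiation requires. The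
  coefficients stay anonymous: \<open>b1\<close> will be determined by a minimum property instead of
  by its integral.\<close>

lemma Bfun_line:
  fixes u1 u2 v1 v2 :: "real^'n::finite \<Rightarrow> real"
  assumes L: "L4fun u1" "L4fun u2" "L4fun v1" "L4fun v2"
  obtains b1 b2 b3 b4 where
    "\<And>t. Bfun a1 a2 \<beta> (\<lambda>x. u1 x + t * v1 x, \<lambda>x. u2 x + t * v2 x)
      = Bfun a1 a2 \<beta> (u1, u2) + t * b1 + t^2 * b2 + t^3 * b3 + t^4 * b4"
proof -
  define p0 where "p0 x = a1 * (u1 x)^4 + a2 * (u2 x)^4 + 2 * \<beta> * (u1 x)^2 * (u2 x)^2" for x
  define p1 where "p1 x = (4 * a1) * (u1 x * u1 x * (u1 x * v1 x)) + (4 * a2) * (u2 x * u2 x * (u2 x * v2 x))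
    + (4 * \<beta>) * (u1 x * v1 x * (u2 x * u2 x)) + (4 * \<beta>) * (u1 x * u1 x * (u2 x * v2 x))" for x
  define p2 where "p2 x = (6 * a1) * (u1 x * u1 x * (v1 x * v1 x)) + (6 * a2) * (u2 x * u2 x * (v2 x * v2 x))
    + (2 * \<beta>) * (v1 x * v1 x * (u2 x * u2 x)) + (8 * \<beta>) * (u1 x * v1 x * (u2 x * v2 x)) + (2 * \<beta>) * (u1 x * u1 x * (v2 x * v2 x))" for x
  define p3 where "p3 x = (4 * a1) * (u1 x * v1 x * (v1 x * v1 x)) + (4 * a2) * (u2 x * v2 x * (v2 x * v2 x))
    + (4 * \<beta>) * (v1 x * v1 x * (u2 x * v2 x)) + (4 * \<beta>) * (u1 x * v1 x * (v2 x * v2 x))" for x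
  define p4 where "p4 x = a1 * (v1 x)^4 + a2 * (v2 x)^4 + 2 * \<beta> * (v1 x)^2 * (v2 x)^2" for x
  have i0: "integrable lborel p0" "integrable lborel p4"
    unfolding p0_def p4_def by (intro L4fun_integrand L)+
  have i1: "integrable lborel p1" "integrable lborel p2" "integrable lborel p3"
    unfolding p1_def p2_def p3_def
    by (intro Bochner_Integration.integrable_add integrable_mult_right L4fun_mult4 L)+
  have e: "a1 * (u1 x + t * v1 x)^4 + a2 * (u2 x + t * v2 x)^4 + 2 * \<beta> * (u1 x + t * v1 x)^2 * (u2 x + t * v2 x)^2
    = p0 x + t * p1 x + t^2 * p2 x + t^3 * p3 x + t^4 * p4 x" for x t
    unfolding p0_def p1_def p2_def p3_def p4_def
    by (simp add: algebra_simps power2_eq_square power3_eq_cube power4_eq_xxxx)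
  have "Bfun a1 a2 \<beta> (\<lambda>x. u1 x + t * v1 x, \<lambda>x. u2 x + t * v2 x)
      = Bfun a1 a2 \<beta> (u1, u2) + t * (\<integral>x. p1 x \<partial>lborel) + t^2 * (\<integral>x. p2 x \<partial>lborel) + t^3 * (\<integral>x. p3 x \<partial>lborel) + t^4 * (\<integral>x. p4 x \<partial>lborel)" for t
    unfolding Bfun_pair e p0_def[symmetric] using i0 i1 by simp
  then show ?thesis using that by blast
qed

text \<open>An elementary one-sided substitute for the Brezis-Lieb splitting. Some mixed terms are
  of order P R, which vanishes after integration when R concentrates away from P; the others are of
  order sqrt(P R) (P + R), and Young's inequality with parameter \<eta> trades them for P R and a
  small multiple of P^2 + R^2.\<close>

lemma quartic_split:
  fixes s t \<sigma> \<tau> a1 a2 \<beta> \<eta> :: real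
  assumes c: "0 \<le> a1" "0 \<le> a2" "0 \<le> \<beta>" and \<eta>: "0 < \<eta>"
  defines "P \<equiv> s^2 + t^2" and "R \<equiv> \<sigma>^2 + \<tau>^2"
  shows "a1 * (s + \<sigma>)^4 + a2 * (t + \<tau>)^4 + 2 * \<beta> * (s + \<sigma>)^2 * (t + \<tau>)^2
    \<le> (a1 * s^4 + a2 * t^4 + 2 * \<beta> * s^2 * t^2) + (a1 * \<sigma>^4 + a2 * \<tau>^4 + 2 * \<beta> * \<sigma>^2 * \<tau>^2)
      + (a1 + a2 + 2 * \<beta>) * (4 * \<eta> * (P^2 + R^2) + (2 / \<eta> + 6) * (P * R))"
proof -
  have P0: "0 \<le> P" "0 \<le> R" by (auto simp: P_def R_def)
  \<comment> \<open>The common bound for all products of an old and a new variable.\<close>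
  define y where "y = sqrt (P * R)"
  have y0: "0 \<le> y" and y2: "y^2 = P * R" using P0 by (auto simp: y_def)
  define X where "X = s * \<sigma>"
  define Y where "Y = t * \<tau>"
  have X2: "X^2 \<le> y^2" unfolding y2 X_def P_def R_def power_mult_distrib by (intro mult_mono) auto
  have Y2: "Y^2 \<le> y^2" unfolding y2 Y_def P_def R_def power_mult_distrib by (intro mult_mono) auto
  have X: "X \<le> y" using power2_le_imp_le[OF _ y0, of "\<bar>X\<bar>"] X2 by simp
  have Y: "Y \<le> y" using power2_le_imp_le[OF _ y0, of "\<bar>Y\<bar>"] Y2 by simp
  have XY: "X * Y \<le> y^2" using X2 Y2 sum_squares_bound[of X Y] by simp
  have cross: "s^2 * \<tau>^2 + \<sigma>^2 * t^2 \<le> y^2" unfolding y2 P_def R_def by (simp add: algebra_simps)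
  define Z where "Z = y * (P + R)"
  have b1: "X * (s^2 + \<sigma>^2) \<le> Z"
    unfolding Z_def using X y0 by (intro mult_mono) (auto simp: P_def R_def)
  have b2: "Y * (t^2 + \<tau>^2) \<le> Z"
    unfolding Z_def using Y y0 by (intro mult_mono) (auto simp: P_def R_def)
  have b3: "Y * (s^2 + \<sigma>^2) + X * (t^2 + \<tau>^2) \<le> Z"
  proof -
    have "Y * (s^2 + \<sigma>^2) \<le> y * (s^2 + \<sigma>^2)" "X * (t^2 + \<tau>^2) \<le> y * (t^2 + \<tau>^2)"
      using X Y by (auto intro!: mult_right_mono)
    then show ?thesis unfolding Z_def P_def R_def by (simp add: algebra_simps)
  qed
  have Z0: "0 \<le> Z" unfolding Z_def using y0 P0 by simp
  \<comment> \<open>Young's inequality, read off from the square of y - \<eta> (P + R).\<close>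
  have Zb: "Z \<le> y^2 / (2 * \<eta>) + \<eta> * (P^2 + R^2)"
  proof -
    have "0 \<le> (y - \<eta> * (P + R))^2" by simp
    also have "(y - \<eta> * (P + R))^2 = y^2 - 2 * \<eta> * Z + \<eta>^2 * (P + R)^2"
      unfolding Z_def by (simp add: power2_eq_square algebra_simps)
    finally have "2 * \<eta> * Z \<le> y^2 + \<eta>^2 * (P + R)^2" by linarith
    moreover have "(P + R)^2 \<le> 2 * (P^2 + R^2)"
      using sum_squares_bound[of P R] by (simp add: power2_sum)
    then have "\<eta>^2 * (P + R)^2 \<le> \<eta>^2 * (2 * (P^2 + R^2))" by (intro mult_left_mono) auto
    ultimately have "2 * \<eta> * Z \<le> y^2 + \<eta>^2 * (2 * (P^2 + R^2))" by linarith
    also have "\<dots> = 2 * \<eta> * (y^2 / (2 * \<eta>) + \<eta> * (P^2 + R^2))"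
      using \<eta> by (simp add: field_simps power2_eq_square)
    finally show ?thesis using \<eta> by simp
  qed
  \<comment> \<open>One bound for the mixed terms of all three monomials; the coefficients 4 and 6
    are those of the binomial expansion of a fourth power.\<close>
  define W where "W = 4 * Z + 6 * y^2"
  have W: "W \<le> 4 * \<eta> * (P^2 + R^2) + (2 / \<eta> + 6) * (P * R)"
  proof -
    have e: "4 * (y^2 / (2 * \<eta>)) = (2 / \<eta>) * y^2" by simp
    have "4 * Z \<le> 4 * (y^2 / (2 * \<eta>)) + 4 * (\<eta> * (P^2 + R^2))" using Zb by linarith
    then have "W \<le> (2 / \<eta>) * y^2 + 4 * (\<eta> * (P^2 + R^2)) + 6 * y^2" unfolding W_def e by linarith
    also have "\<dots> = 4 * \<eta> * (P^2 + R^2) + (2 / \<eta> + 6) * y^2" by (simp add: distrib_right)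
    finally show ?thesis unfolding y2 .
  qed
  have e1: "(s + \<sigma>)^4 = s^4 + \<sigma>^4 + (4 * (X * (s^2 + \<sigma>^2)) + 6 * X^2)"
    unfolding X_def by (simp add: algebra_simps power2_eq_square power4_eq_xxxx)
  have e2: "(t + \<tau>)^4 = t^4 + \<tau>^4 + (4 * (Y * (t^2 + \<tau>^2)) + 6 * Y^2)"
    unfolding Y_def by (simp add: algebra_simps power2_eq_square power4_eq_xxxx)
  have e3: "(s + \<sigma>)^2 * (t + \<tau>)^2 = s^2 * t^2 + \<sigma>^2 * \<tau>^2 + ((s^2 * \<tau>^2 + \<sigma>^2 * t^2)
      + 2 * (Y * (s^2 + \<sigma>^2) + X * (t^2 + \<tau>^2)) + 4 * (X * Y))"
    unfolding X_def Y_def by (simp add: algebra_simps power2_eq_square)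
  have "a1 * (4 * (X * (s^2 + \<sigma>^2)) + 6 * X^2) \<le> a1 * W"
    unfolding W_def using b1 X2 by (intro mult_left_mono c) linarith
  moreover have "a2 * (4 * (Y * (t^2 + \<tau>^2)) + 6 * Y^2) \<le> a2 * W"
    unfolding W_def using b2 Y2 by (intro mult_left_mono c) linarith
  moreover have "(2 * \<beta>) * ((s^2 * \<tau>^2 + \<sigma>^2 * t^2) + 2 * (Y * (s^2 + \<sigma>^2) + X * (t^2 + \<tau>^2)) + 4 * (X * Y)) \<le> (2 * \<beta>) * W"
  proof (rule mult_left_mono)
    have "0 \<le> y^2" by simp
    then show "(s^2 * \<tau>^2 + \<sigma>^2 * t^2) + 2 * (Y * (s^2 + \<sigma>^2) + X * (t^2 + \<tau>^2)) + 4 * (X * Y) \<le> W"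
      unfolding W_def using add_mono[OF add_mono[OF cross mult_left_mono[OF b3, of 2]] mult_left_mono[OF XY, of 4]] Z0 \<open>0 \<le> y^2\<close>
      by (smt (verit))
  qed (use c in auto)
  moreover have "(a1 + a2 + 2 * \<beta>) * W \<le> (a1 + a2 + 2 * \<beta>) * (4 * \<eta> * (P^2 + R^2) + (2 / \<eta> + 6) * (P * R))"
    using c by (intro mult_left_mono W) auto
  ultimately show ?thesis
    unfolding mult.assoc[of "2 * \<beta>"] e1 e2 e3 by (simp only: distrib_left distrib_right)
qed

text \<open>For a bounded sequence of remainders the \<eta>-term is uniformly small and
  \<open>ip P R\<close> tends to 0. An upper bound suffices, since B is to be maximised.\<close>

lemma Bfun_split:
  fixes u1 u2 :: "real^'n::finite \<Rightarrow> real"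
  assumes c: "0 \<le> a1" "0 \<le> a2" "0 \<le> \<beta>" and \<eta>: "0 < \<eta>"
    and L: "L4fun u1" "L4fun u2" "L4fun w1" "L4fun w2"
  defines "P \<equiv> \<lambda>x. (u1 x)^2 + (u2 x)^2" and "R \<equiv> \<lambda>x. (w1 x)^2 + (w2 x)^2"
  shows "Bfun a1 a2 \<beta> (\<lambda>x. u1 x + w1 x, \<lambda>x. u2 x + w2 x)
    \<le> Bfun a1 a2 \<beta> (u1, u2) + Bfun a1 a2 \<beta> (w1, w2)
      + (a1 + a2 + 2 * \<beta>) * (4 * \<eta> * (nsq P + nsq R) + (2 / \<eta> + 6) * ip P R)"
proof -
  have PL: "L2fun P" "L2fun R" unfolding P_def R_def using L by (auto intro!: L2fun_add simp: L4fun_def)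
  have s: "L4fun (\<lambda>x. u1 x + w1 x)" "L4fun (\<lambda>x. u2 x + w2 x)"
    using L4fun_lin[OF L(1,3), of 1 1] L4fun_lin[OF L(2,4), of 1 1] by simp_all
  let ?u = "\<lambda>x. a1 * (u1 x)^4 + a2 * (u2 x)^4 + 2 * \<beta> * (u1 x)^2 * (u2 x)^2"
  let ?w = "\<lambda>x. a1 * (w1 x)^4 + a2 * (w2 x)^4 + 2 * \<beta> * (w1 x)^2 * (w2 x)^2"
  let ?r = "\<lambda>x. (a1 + a2 + 2 * \<beta>) * (4 * \<eta> * (P x * P x + R x * R x) + (2 / \<eta> + 6) * (P x * R x))"
  note i = L4fun_integrand(3)[OF L(1,2), of a1 a2 \<beta>] L4fun_integrand(3)[OF L(3,4), of a1 a2 \<beta>]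
    L2fun_mult_integrable[OF PL(1,1)] L2fun_mult_integrable[OF PL(2,2)] L2fun_mult_integrable[OF PL]
  have ir: "integrable lborel ?r" using i(3-5) by simp
  have "Bfun a1 a2 \<beta> (\<lambda>x. u1 x + w1 x, \<lambda>x. u2 x + w2 x) \<le> (\<integral>x. ?u x + ?w x + ?r x \<partial>lborel)"
    unfolding Bfun_pair
  proof (rule integral_mono[OF L4fun_integrand(3)[OF s]])
    show "integrable lborel (\<lambda>x. ?u x + ?w x + ?r x)"
      by (intro Bochner_Integration.integrable_add i ir)
    show "a1 * (u1 x + w1 x)^4 + a2 * (u2 x + w2 x)^4 + 2 * \<beta> * (u1 x + w1 x)^2 * (u2 x + w2 x)^2 \<le> ?u x + ?w x + ?r x" for x
      using quartic_split[OF c \<eta>, of "u1 x" "w1 x" "u2 x" "w2 x"] by (simp add: P_def R_def power2_eq_square)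
  qed
  also have "\<dots> = Bfun a1 a2 \<beta> (u1, u2) + Bfun a1 a2 \<beta> (w1, w2) + (\<integral>x. ?r x \<partial>lborel)"
    unfolding Bfun_pair using i(1,2) ir
    by (subst Bochner_Integration.integral_add, auto)+
  also have "(\<integral>x. ?r x \<partial>lborel) = (a1 + a2 + 2 * \<beta>) * (4 * \<eta> * (nsq P + nsq R) + (2 / \<eta> + 6) * ip P R)"
    unfolding ip_def using i(3-5) by simp
  finally show ?thesis .
qed

text \<open>The squared norm of the energy space when both potentials are the constant
  \<open>m\<close>.\<close>

definition cnorm :: "real \<Rightarrow> real \<Rightarrow> (real^'n::finite \<Rightarrow> real) \<Rightarrow> (real^'n \<Rightarrow> real) \<Rightarrow> real" where
  "cnorm \<epsilon> m u1 u2 = \<epsilon>^2 * (dip u1 u1 + dip u2 u2) + m * (nsq u1 + nsq u2)"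

lemma cnorm_nonneg: "0 \<le> m \<Longrightarrow> 0 \<le> cnorm \<epsilon> m u1 u2"
  unfolding cnorm_def by (intro add_nonneg_nonneg mult_nonneg_nonneg dip_nonneg ip_self_nonneg) auto

text \<open>Treats the pairs for which the quotient B / Q^2 is undefined.\<close>

lemma Bfun_zero_if_cnorm_zero:
  assumes "H1 u1" "H1 u2" "0 < m" "cnorm \<epsilon> m u1 u2 = 0"
  shows "Bfun a1 a2 \<beta> (u1, u2) = 0"
proof -
  have "0 \<le> \<epsilon>^2 * (dip u1 u1 + dip u2 u2)"
    by (intro mult_nonneg_nonneg add_nonneg_nonneg dip_nonneg) auto
  moreover have "0 \<le> m * (nsq u1 + nsq u2)"
    using assms(3) by (intro mult_nonneg_nonneg add_nonneg_nonneg ip_self_nonneg) auto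
  ultimately have "m * (nsq u1 + nsq u2) = 0" using assms(4) unfolding cnorm_def by linarith
  then have "nsq u1 + nsq u2 = 0" using assms(3) by simp
  then have "nsq u1 = 0" "nsq u2 = 0" using ip_self_nonneg[of u1] ip_self_nonneg[of u2] by linarith+
  then show ?thesis using ip_self_eq_0 H1_L2 assms(1,2) by (intro Bfun_AE_zero) blast+
qed

section \<open>The constant potential: supremum of the quotient and near-maximisers of bounded
  support\<close>

lemma tent_tendsto: "(\<lambda>n. tent (real (Suc n)) x) \<longlonglongrightarrow> 1"
proof (rule tendsto_eventually)
  obtain n0 :: nat where n0: "norm x \<le> real n0" using real_arch_simple by blast
  have "tent (real (Suc n)) x = 1" if "n \<ge> n0" for n
    using that n0 by (intro tent_props(5)) auto
  then show "\<forall>\<^sub>F n in sequentially. tent (real (Suc n)) x = 1" by (auto simp: eventually_sequentially)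
qed

text \<open>The cut-off factors out of the integrand as a fourth power between 0 and 1, so the
  integrand itself is the majorant.\<close>

lemma Bfun_tent_tendsto:
  fixes u1 u2 :: "real^'n::finite \<Rightarrow> real"
  assumes L: "L4fun u1" "L4fun u2" and c: "0 \<le> a1" "0 \<le> a2" "0 \<le> \<beta>"
  shows "(\<lambda>n. Bfun a1 a2 \<beta> (\<lambda>x. tent (real (Suc n)) x * u1 x, \<lambda>x. tent (real (Suc n)) x * u2 x)) \<longlonglongrightarrow> Bfun a1 a2 \<beta> (u1, u2)"
  unfolding Bfun_pair
proof (rule integral_dominated_convergence[OF _ _ L4fun_integrand(3)[OF L, of a1 a2 \<beta>]])
  have [measurable]: "u1 \<in> borel_measurable borel" "u2 \<in> borel_measurable borel" using L by (auto simp: L4fun_def)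
  have [measurable]: "tent (real (Suc n)) \<in> borel_measurable (borel :: (real^'n) measure)" for n
    by (intro tent_props) simp
  let ?p = "\<lambda>n x. tent (real (Suc n)) (x :: real^'n)"
  show "(\<lambda>x. a1 * (u1 x)^4 + a2 * (u2 x)^4 + 2 * \<beta> * (u1 x)^2 * (u2 x)^2) \<in> borel_measurable lborel" by measurable
  show "(\<lambda>x. a1 * (?p n x * u1 x)^4 + a2 * (?p n x * u2 x)^4 + 2 * \<beta> * (?p n x * u1 x)^2 * (?p n x * u2 x)^2) \<in> borel_measurable lborel" for n
    by measurable
  show "AE x in lborel. (\<lambda>n. a1 * (?p n x * u1 x)^4 + a2 * (?p n x * u2 x)^4 + 2 * \<beta> * (?p n x * u1 x)^2 * (?p n x * u2 x)^2)
      \<longlonglongrightarrow> a1 * (u1 x)^4 + a2 * (u2 x)^4 + 2 * \<beta> * (u1 x)^2 * (u2 x)^2"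
  proof (intro AE_I2)
    fix x
    have "(\<lambda>n. a1 * (?p n x * u1 x)^4 + a2 * (?p n x * u2 x)^4 + 2 * \<beta> * (?p n x * u1 x)^2 * (?p n x * u2 x)^2)
      \<longlonglongrightarrow> a1 * (1 * u1 x)^4 + a2 * (1 * u2 x)^4 + 2 * \<beta> * (1 * u1 x)^2 * (1 * u2 x)^2"
      by (intro tendsto_intros tent_tendsto)
    then show "(\<lambda>n. a1 * (?p n x * u1 x)^4 + a2 * (?p n x * u2 x)^4 + 2 * \<beta> * (?p n x * u1 x)^2 * (?p n x * u2 x)^2)
      \<longlonglongrightarrow> a1 * (u1 x)^4 + a2 * (u2 x)^4 + 2 * \<beta> * (u1 x)^2 * (u2 x)^2" by simp
  qed
  show "AE x in lborel. norm (a1 * (?p n x * u1 x)^4 + a2 * (?p n x * u2 x)^4 + 2 * \<beta> * (?p n x * u1 x)^2 * (?p n x * u2 x)^2)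
      \<le> a1 * (u1 x)^4 + a2 * (u2 x)^4 + 2 * \<beta> * (u1 x)^2 * (u2 x)^2" for n
  proof (intro AE_I2)
    fix x
    let ?F = "a1 * (u1 x)^4 + a2 * (u2 x)^4 + 2 * \<beta> * (u1 x)^2 * (u2 x)^2"
    have "a1 * (?p n x * u1 x)^4 + a2 * (?p n x * u2 x)^4 + 2 * \<beta> * (?p n x * u1 x)^2 * (?p n x * u2 x)^2 = (?p n x)^4 * ?F"
      by (simp add: power_mult_distrib algebra_simps power2_eq_square power4_eq_xxxx)
    moreover have "0 \<le> ?F" using c by auto
    moreover have "0 \<le> (?p n x)^4" "(?p n x)^4 \<le> 1"
      using tent_props(2,3)[of "real (Suc n)" x] by (auto intro!: power_le_one)
    ultimately show "norm (a1 * (?p n x * u1 x)^4 + a2 * (?p n x * u2 x)^4 + 2 * \<beta> * (?p n x * u1 x)^2 * (?p n x * u2 x)^2) \<le> ?F"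
      by (simp add: mult_left_le_one_le)
  qed
qed

text \<open>\<sigma> is the supremum of the quotient at \<epsilon> = 1. No maximiser is claimed: a
  near-maximiser can be cut off far out at small cost, and bounded support is what allows it to be
  placed near a single point.\<close>

lemma const_potential_sup:
  fixes a1 a2 \<beta> m :: real
  assumes N: "CARD('n::finite) \<le> 3" and c: "0 < a1" "0 \<le> a2" "0 \<le> \<beta>" and m: "0 < m"
  obtains \<sigma> where "\<sigma> > 0"
    "\<And>u1 u2 :: real^'n \<Rightarrow> real. H1 u1 \<Longrightarrow> H1 u2 \<Longrightarrow> Bfun a1 a2 \<beta> (u1, u2) \<le> \<sigma> * (cnorm 1 m u1 u2)^2"
    "\<And>\<kappa>. 0 \<le> \<kappa> \<Longrightarrow> \<kappa> < 1 \<Longrightarrow> \<exists>w1 w2 :: real^'n \<Rightarrow> real. \<exists>R. H1 w1 \<and> H1 w2 \<and> R > 0 \<and>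
      (\<forall>x. R \<le> norm x \<longrightarrow> w1 x = 0 \<and> w2 x = 0) \<and> \<kappa> * \<sigma> * (cnorm 1 m w1 w2)^2 < Bfun a1 a2 \<beta> (w1, w2)"
proof -
  have c0: "0 \<le> a1" using c by simp
  obtain K where K: "K > 0" and Kb: "\<And>u1 u2 :: real^'n \<Rightarrow> real. H1 u1 \<Longrightarrow> H1 u2 \<Longrightarrow>
    Bfun a1 a2 \<beta> (u1, u2) \<le> K * (nsq u1 + dip u1 u1 + nsq u2 + dip u2 u2)^2"
    by (rule Bfun_bound[OF N c0 c(2,3)]) blast
  define A where "A = {Bfun a1 a2 \<beta> (u1, u2) / (cnorm 1 m u1 u2)^2 | u1 u2 :: real^'n \<Rightarrow> real. H1 u1 \<and> H1 u2 \<and> 0 < cnorm 1 m u1 u2}"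
  define \<sigma> where "\<sigma> = Sup A"
  have bdd: "bdd_above A"
  proof (rule bdd_aboveI[of _ "K * (1 + 1 / m)^2"])
    fix a assume "a \<in> A"
    then obtain u1 u2 :: "real^'n \<Rightarrow> real" where u: "H1 u1" "H1 u2" "0 < cnorm 1 m u1 u2" and a: "a = Bfun a1 a2 \<beta> (u1, u2) / (cnorm 1 m u1 u2)^2"
      by (auto simp: A_def)
    have "nsq u1 + dip u1 u1 + nsq u2 + dip u2 u2 \<le> (1 + 1 / m) * cnorm 1 m u1 u2"
      using m dip_nonneg[of u1] dip_nonneg[of u2] ip_self_nonneg[of u1] ip_self_nonneg[of u2]
      unfolding cnorm_def by (simp add: field_simps)
    then have "(nsq u1 + dip u1 u1 + nsq u2 + dip u2 u2)^2 \<le> ((1 + 1 / m) * cnorm 1 m u1 u2)^2"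
      using dip_nonneg[of u1] dip_nonneg[of u2] ip_self_nonneg[of u1] ip_self_nonneg[of u2] by (intro power_mono) auto
    then have "Bfun a1 a2 \<beta> (u1, u2) \<le> K * ((1 + 1 / m) * cnorm 1 m u1 u2)^2"
      using Kb[OF u(1,2)] K mult_left_mono[of _ _ K] by (smt (verit))
    then show "a \<le> K * (1 + 1 / m)^2"
      unfolding a using u(3) by (simp add: divide_le_eq power_mult_distrib mult_ac)
  qed
  have ub: "Bfun a1 a2 \<beta> (u1, u2) \<le> \<sigma> * (cnorm 1 m u1 u2)^2" if u: "H1 u1" "H1 u2" for u1 u2 :: "real^'n \<Rightarrow> real"
  proof (cases "cnorm 1 m u1 u2 = 0")
    case True
    then show ?thesis using Bfun_zero_if_cnorm_zero[OF u m True] by simp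
  next
    case False
    then have p: "0 < cnorm 1 m u1 u2" using cnorm_nonneg[of m 1 u1 u2] m by simp
    then have "Bfun a1 a2 \<beta> (u1, u2) / (cnorm 1 m u1 u2)^2 \<le> \<sigma>"
      unfolding \<sigma>_def using u by (intro cSup_upper bdd) (auto simp: A_def)
    then show ?thesis using p by (simp add: divide_le_eq)
  qed
  \<comment> \<open>A witness for \<sigma> > 0: it equals 1 on the unit ball, where the positive
    coefficient \<open>a1\<close> makes the integrand positive.\<close>
  let ?z = "tent 1 :: real^'n \<Rightarrow> real"
  have zH: "H1 ?z" by (rule H1_tent)
  have zB: "0 < Bfun a1 a2 \<beta> (?z, ?z)"
  proof -
    note L4 = H1_L4[OF N zH]
    have nn: "0 \<le> a1 * (?z x)^4 + a2 * (?z x)^4 + 2 * \<beta> * (?z x)^2 * (?z x)^2" for x using c by auto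
    have "Bfun a1 a2 \<beta> (?z, ?z) \<noteq> 0"
    proof
      assume "Bfun a1 a2 \<beta> (?z, ?z) = 0"
      then have "AE x in lborel. a1 * (?z x)^4 + a2 * (?z x)^4 + 2 * \<beta> * (?z x)^2 * (?z x)^2 = 0"
        unfolding Bfun_pair using nn
        by (subst (asm) integral_nonneg_eq_0_iff_AE[OF L4fun_integrand(3)[OF L4 L4]]) auto
      then have "AE x in lborel. (x :: real^'n) \<notin> ball 0 1"
      proof eventually_elim
        case (elim x)
        have "0 \<le> a2 * (?z x)^4" "0 \<le> 2 * \<beta> * (?z x)^2 * (?z x)^2" "0 \<le> a1 * (?z x)^4" using c by auto
        then have "a1 * (?z x)^4 = 0" using elim by linarith
        then have "?z x = 0" using c by simp
        then show ?case using tent_props(5)[of 1 x] by auto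
      qed
      then have "emeasure lborel (ball 0 1 :: (real^'n) set) = 0"
        by (subst (asm) AE_iff_measurable[OF _ refl]) (auto simp: ball_def)
      then show False using content_ball_pos[of 1 "0::real^'n"] by (simp add: measure_def)
    qed
    then show ?thesis using Bfun_nonneg[OF c0 c(2,3), of ?z ?z] by linarith
  qed
  have zc: "0 < cnorm 1 m ?z ?z"
    using Bfun_zero_if_cnorm_zero[OF zH zH m] zB cnorm_nonneg[of m 1 ?z ?z] m by (metis less_eq_real_def less_irrefl)
  have \<sigma>: "0 < \<sigma>"
  proof (rule ccontr)
    assume "\<not> 0 < \<sigma>"
    then have "\<sigma> * (cnorm 1 m ?z ?z)^2 \<le> 0" by (simp add: mult_nonpos_nonneg)
    then show False using ub[OF zH zH] zB by linarith
  qed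
  have "\<exists>w1 w2 :: real^'n \<Rightarrow> real. \<exists>R. H1 w1 \<and> H1 w2 \<and> R > 0 \<and>
      (\<forall>x. R \<le> norm x \<longrightarrow> w1 x = 0 \<and> w2 x = 0) \<and> \<kappa> * \<sigma> * (cnorm 1 m w1 w2)^2 < Bfun a1 a2 \<beta> (w1, w2)"
    if \<kappa>: "0 \<le> \<kappa>" "\<kappa> < 1" for \<kappa>
  proof -
    have "\<kappa> * \<sigma> < Sup A" using \<sigma> \<kappa> unfolding \<sigma>_def[symmetric] by simp
    moreover have "A \<noteq> {}" using zH zc by (auto simp: A_def)
    ultimately obtain a where "a \<in> A" "\<kappa> * \<sigma> < a" using less_cSupD by blast
    then obtain u1 u2 :: "real^'n \<Rightarrow> real" where u: "H1 u1" "H1 u2" "0 < cnorm 1 m u1 u2"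
      and "\<kappa> * \<sigma> < Bfun a1 a2 \<beta> (u1, u2) / (cnorm 1 m u1 u2)^2" by (auto simp: A_def)
    then have lt: "\<kappa> * \<sigma> * (cnorm 1 m u1 u2)^2 < Bfun a1 a2 \<beta> (u1, u2)" by (simp add: less_divide_eq)
    let ?p = "\<lambda>n x. tent (real (Suc n)) (x :: real^'n)"
    define g where "g u i = nsq (\<lambda>x. wgrad u x $ i)" for u :: "real^'n \<Rightarrow> real" and i
    \<comment> \<open>An upper bound for the gradient energy of the n-th cut-off of
      \<open>u\<close>, with limit \<open>dip u u\<close>. Upper bounds suffice because the energy
      stands in the denominator of the quotient.\<close>
    define b where "b u n = (\<Sum>i\<in>UNIV. (sqrt (g u i) + (1 / Suc n) * sqrt (nsq u))^2)" for u :: "real^'n \<Rightarrow> real" and n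
    have blim: "b u \<longlonglongrightarrow> dip u u" for u :: "real^'n \<Rightarrow> real"
    proof -
      have "(\<lambda>n. \<Sum>i\<in>UNIV. (sqrt (g u i) + inverse (real (Suc n)) * sqrt (nsq u))^2) \<longlonglongrightarrow> (\<Sum>i\<in>UNIV. (sqrt (g u i) + 0 * sqrt (nsq u))^2)"
        by (intro tendsto_sum tendsto_power tendsto_add tendsto_const tendsto_mult LIMSEQ_inverse_real_of_nat)
      moreover have "(\<Sum>i\<in>UNIV. (sqrt (g u i) + 0 * sqrt (nsq u))^2) = dip u u"
        by (simp add: g_def dip_def ip_self_nonneg)
      ultimately show ?thesis unfolding b_def by (simp add: inverse_eq_divide)
    qed
    have cut: "H1 (\<lambda>x. ?p n x * u x)" "dip (\<lambda>x. ?p n x * u x) (\<lambda>x. ?p n x * u x) \<le> b u n" "nsq (\<lambda>x. ?p n x * u x) \<le> nsq u"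
      if u: "H1 u" for u n
    proof -
      note tp = tent_props[of "real (Suc n)"]
      have R0: "(0::real) < real (Suc n)" by simp
      show "H1 (\<lambda>x. ?p n x * u x)" "dip (\<lambda>x. ?p n x * u x) (\<lambda>x. ?p n x * u x) \<le> b u n"
        using H1_cutoff[OF u tp(1)[OF R0] tp(3)[OF R0] tp(4)[OF R0]] by (simp_all add: b_def g_def)
      show "nsq (\<lambda>x. ?p n x * u x) \<le> nsq u"
      proof (rule ip_self_mono[OF H1_L2[OF u]])
        show "(\<lambda>x. ?p n x * u x) \<in> borel_measurable borel"
          using tp(1)[OF R0] L2fun_meas[OF H1_L2[OF u]] by measurable
        show "\<bar>?p n x * u x\<bar> \<le> \<bar>u x\<bar>" for x
          unfolding abs_mult using tp(3)[OF R0, of x] by (intro mult_left_le_one_le) auto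
      qed
    qed
    define q where "q n = (b u1 n + b u2 n) + m * (nsq u1 + nsq u2)" for n
    have "(\<lambda>n. \<kappa> * \<sigma> * (q n)^2) \<longlonglongrightarrow> \<kappa> * \<sigma> * ((dip u1 u1 + dip u2 u2) + m * (nsq u1 + nsq u2))^2"
      unfolding q_def by (intro tendsto_intros blim)
    then have l1: "(\<lambda>n. \<kappa> * \<sigma> * (q n)^2) \<longlonglongrightarrow> \<kappa> * \<sigma> * (cnorm 1 m u1 u2)^2" by (simp add: cnorm_def)
    have l2: "(\<lambda>n. Bfun a1 a2 \<beta> (\<lambda>x. ?p n x * u1 x, \<lambda>x. ?p n x * u2 x)) \<longlonglongrightarrow> Bfun a1 a2 \<beta> (u1, u2)"
      by (intro Bfun_tent_tendsto H1_L4[OF N] u c0 c(2,3))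
    have "\<forall>\<^sub>F n in sequentially. 0 < Bfun a1 a2 \<beta> (\<lambda>x. ?p n x * u1 x, \<lambda>x. ?p n x * u2 x) - \<kappa> * \<sigma> * (q n)^2"
      using lt by (intro order_tendstoD(1)[OF tendsto_diff[OF l2 l1]]) simp
    then obtain n where n: "\<kappa> * \<sigma> * (q n)^2 < Bfun a1 a2 \<beta> (\<lambda>x. ?p n x * u1 x, \<lambda>x. ?p n x * u2 x)"
      by (auto simp: eventually_sequentially)
    let ?w1 = "\<lambda>x. ?p n x * u1 x" and ?w2 = "\<lambda>x. ?p n x * u2 x"
    have "cnorm 1 m ?w1 ?w2 \<le> q n"
      unfolding cnorm_def q_def using cut(2,3)[OF u(1), of n] cut(2,3)[OF u(2), of n] m
      by (simp add: add_mono mult_left_mono)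
    then have "(cnorm 1 m ?w1 ?w2)^2 \<le> (q n)^2" using cnorm_nonneg[of m 1 ?w1 ?w2] m by (intro power_mono) auto
    then have "\<kappa> * \<sigma> * (cnorm 1 m ?w1 ?w2)^2 \<le> \<kappa> * \<sigma> * (q n)^2" using \<kappa> \<sigma> by (intro mult_left_mono) auto
    then have "\<kappa> * \<sigma> * (cnorm 1 m ?w1 ?w2)^2 < Bfun a1 a2 \<beta> (?w1, ?w2)" using n by linarith
    moreover have "2 * real (Suc n) \<le> norm x \<Longrightarrow> ?w1 x = 0 \<and> ?w2 x = 0" for x
      using tent_props(6)[of "real (Suc n)" x] by simp
    ultimately show ?thesis using cut(1)[OF u(1), of n] cut(1)[OF u(2), of n]
      by (intro exI[of _ ?w1] exI[of _ ?w2] exI[of _ "2 * real (Suc n)"]) auto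
  qed
  then show ?thesis using that \<sigma> ub by blast
qed

text \<open>The substitution x -> \<epsilon> x absorbs \<epsilon> into the gradient and divides both
  B and the energy by \<open>\<epsilon> ^ N\<close>. The energy enters squared, so one such power
  remains in the constant.\<close>

lemma const_potential_scaled:
  fixes u1 u2 :: "real^'n::finite \<Rightarrow> real"
  assumes b: "\<And>u1 u2 :: real^'n \<Rightarrow> real. H1 u1 \<Longrightarrow> H1 u2 \<Longrightarrow> Bfun a1 a2 \<beta> (u1, u2) \<le> \<sigma> * (cnorm 1 m u1 u2)^2"
    and \<sigma>: "0 \<le> \<sigma>" and m: "0 \<le> m" and e: "0 < \<epsilon>" and u: "H1 u1" "H1 u2"
  shows "Bfun a1 a2 \<beta> (u1, u2) \<le> \<sigma> / \<epsilon> ^ CARD('n) * (cnorm \<epsilon> m u1 u2)^2"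
proof -
  define E where "E = \<epsilon> ^ CARD('n)"
  have E: "0 < E" using e by (simp add: E_def)
  let ?v1 = "\<lambda>x. u1 (0 + \<epsilon> *\<^sub>R x)" and ?v2 = "\<lambda>x. u2 (0 + \<epsilon> *\<^sub>R x)"
  have mu: "u1 \<in> borel_measurable borel" "u2 \<in> borel_measurable borel" using u H1_L2 L2fun_meas by auto
  have v: "H1 ?v1" "H1 ?v2" by (rule H1_affine(1)[OF u(1) e], rule H1_affine(1)[OF u(2) e])
  have "cnorm 1 m ?v1 ?v2 \<le> cnorm \<epsilon> m u1 u2 / E"
    using H1_affine(2)[OF u(1) e, of 0] H1_affine(2)[OF u(2) e, of 0]
      ip_affine[OF mu(1) mu(1) e, of 0] ip_affine[OF mu(2) mu(2) e, of 0]
    unfolding cnorm_def E_def[symmetric] by (simp add: add_divide_distrib distrib_left)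
  then have "(cnorm 1 m ?v1 ?v2)^2 \<le> (cnorm \<epsilon> m u1 u2 / E)^2"
    using cnorm_nonneg[OF m] by (intro power_mono) auto
  then have "\<sigma> * (cnorm 1 m ?v1 ?v2)^2 \<le> \<sigma> * (cnorm \<epsilon> m u1 u2 / E)^2" using \<sigma> by (intro mult_left_mono)
  then have "Bfun a1 a2 \<beta> (u1, u2) / E \<le> \<sigma> * (cnorm \<epsilon> m u1 u2 / E)^2"
    using b[OF v] Bfun_affine[OF mu e, of a1 a2 \<beta> 0] unfolding E_def by linarith
  then show ?thesis using E unfolding E_def[symmetric] by (simp add: power_divide field_simps power2_eq_square)
qed

section \<open>Existence of ground states\<close>

text \<open>The trial pair is a fixed near-maximiser for the level m, moved to the common minimum
  point and dilated so that its energy is measured at the lower level \<mu>. All margins are fixed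
  before \<epsilon>, so \<epsilon> only has to make the support small.\<close>

lemma concentration_level:
  fixes V1 V2 :: "real^'n::finite \<Rightarrow> real"
  assumes N: "CARD('n) \<le> 3" and V: "continuous_on UNIV V1" "continuous_on UNIV V2"
    and V0: "\<And>x. 0 \<le> V1 x" "\<And>x. 0 \<le> V2 x"
    and x0: "V1 x0 = \<mu>" "V2 x0 = \<mu>" and \<mu>: "0 < \<mu>" "\<mu> < m" and \<sigma>: "0 < \<sigma>"
    and near: "\<And>\<kappa>. 0 \<le> \<kappa> \<Longrightarrow> \<kappa> < 1 \<Longrightarrow> \<exists>w1 w2 :: real^'n \<Rightarrow> real. \<exists>R. H1 w1 \<and> H1 w2 \<and> R > 0 \<and>
      (\<forall>x. R \<le> norm x \<longrightarrow> w1 x = 0 \<and> w2 x = 0) \<and> \<kappa> * \<sigma> * (cnorm 1 m w1 w2)^2 < Bfun a1 a2 \<beta> (w1, w2)"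
  shows "\<exists>\<epsilon>0>0. \<forall>\<epsilon>. 0 < \<epsilon> \<longrightarrow> \<epsilon> < \<epsilon>0 \<longrightarrow> (\<exists>z1 z2. XV V1 z1 \<and> XV V2 z2 \<and>
    \<sigma> / \<epsilon> ^ CARD('n) * (ebil \<epsilon> V1 z1 z1 + ebil \<epsilon> V2 z2 z2)^2 < Bfun a1 a2 \<beta> (z1, z2))"
proof -
  \<comment> \<open>This dilation lowers the gradient part by the same factor \<mu>/m as the
    potential part.\<close>
  define l where "l = sqrt (m / \<mu>)"
  have l2: "l^2 = m / \<mu>" and l1: "1 < l" using \<mu> by (auto simp: l_def)
  \<comment> \<open>Strictly between 1/l and 1, which leaves the surplus \<kappa> l > 1 for the
    potential not being exactly \<mu>.\<close>
  define \<kappa> where "\<kappa> = (1 + 1 / l) / 2"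
  have \<kappa>: "0 \<le> \<kappa>" "\<kappa> < 1" "1 < \<kappa> * l" using l1 by (auto simp: \<kappa>_def field_simps)
  \<comment> \<open>Chosen so that the square of 1 + \<eta>/\<mu> equals \<kappa> l, the whole
    available surplus.\<close>
  define \<eta> where "\<eta> = \<mu> * (sqrt (\<kappa> * l) - 1)"
  have \<eta>: "0 < \<eta>" using \<kappa> \<mu> by (simp add: \<eta>_def)
  have \<eta>2: "(1 + \<eta> / \<mu>)^2 = \<kappa> * l" using \<mu> \<kappa> by (simp add: \<eta>_def)
  obtain w1 w2 :: "real^'n \<Rightarrow> real" and R where w: "H1 w1" "H1 w2" and R: "R > 0"
    and supp: "\<And>x. R \<le> norm x \<Longrightarrow> w1 x = 0" "\<And>x. R \<le> norm x \<Longrightarrow> w2 x = 0"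
    and nm: "\<kappa> * \<sigma> * (cnorm 1 m w1 w2)^2 < Bfun a1 a2 \<beta> (w1, w2)"
    using near[OF \<kappa>(1,2)] by blast
  have cV: "\<exists>d>0. \<forall>x. dist x x0 < d \<longrightarrow> V x \<le> \<mu> + \<eta>" if Vc: "continuous_on UNIV V" "V x0 = \<mu>" for V :: "real^'n \<Rightarrow> real"
  proof -
    obtain d where d: "d > 0" "\<And>x. dist x x0 < d \<Longrightarrow> dist (V x) (V x0) < \<eta>"
      using Vc(1) \<eta> unfolding continuous_on_iff by (metis UNIV_I)
    have "V x \<le> \<mu> + \<eta>" if "dist x x0 < d" for x
      using d(2)[OF that] \<open>V x0 = \<mu>\<close> by (simp add: dist_real_def)
    then show ?thesis using d(1) by blast
  qed
  obtain d1 d2 where d: "d1 > 0" "d2 > 0" "\<And>x. dist x x0 < d1 \<Longrightarrow> V1 x \<le> \<mu> + \<eta>" "\<And>x. dist x x0 < d2 \<Longrightarrow> V2 x \<le> \<mu> + \<eta>"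
    using cV[OF V(1) x0(1)] cV[OF V(2) x0(2)] by blast
  \<comment> \<open>The rescaled support has radius R l \<epsilon>, and this keeps it where both
    potentials are at most \<mu> + \<eta>.\<close>
  define \<epsilon>0 where "\<epsilon>0 = min d1 d2 / (l * R)"
  have "\<epsilon>0 > 0" using d R l1 by (simp add: \<epsilon>0_def)
  moreover have "\<exists>z1 z2. XV V1 z1 \<and> XV V2 z2 \<and>
    \<sigma> / \<epsilon> ^ CARD('n) * (ebil \<epsilon> V1 z1 z1 + ebil \<epsilon> V2 z2 z2)^2 < Bfun a1 a2 \<beta> (z1, z2)"
    if e: "0 < \<epsilon>" "\<epsilon> < \<epsilon>0" for \<epsilon>
  proof -
    define c where "c = 1 / (l * \<epsilon>)"
    have c: "0 < c" using l1 e by (simp add: c_def)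
    define C where "C = c ^ CARD('n)"
    have C: "0 < C" using c by (simp add: C_def)
    \<comment> \<open>Makes a + c x equal to c (x - x0), so that the trial functions are centred at
      \<open>x0\<close>.\<close>
    define a where "a = - (c *\<^sub>R x0)"
    have en: "XV V (\<lambda>x. w (a + c *\<^sub>R x)) \<and> ebil \<epsilon> V (\<lambda>x. w (a + c *\<^sub>R x)) (\<lambda>x. w (a + c *\<^sub>R x))
        \<le> (\<mu> / m) * dip w w / C + (\<mu> + \<eta>) * nsq w / C"
      if V: "continuous_on UNIV V" "\<And>x. 0 \<le> V x" and d: "\<And>x. dist x x0 < min d1 d2 \<Longrightarrow> V x \<le> \<mu> + \<eta>"
        and w: "H1 w" "\<And>x. R \<le> norm x \<Longrightarrow> w x = 0" for V w
    proof -
      let ?z = "\<lambda>x. w (a + c *\<^sub>R x)"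
      have Vm[measurable]: "V \<in> borel_measurable borel" using V(1) by (rule borel_measurable_continuous_onI)
      have wm: "w \<in> borel_measurable borel" using w H1_L2 L2fun_meas by blast
      have zH: "H1 ?z" by (rule H1_affine(1)[OF w(1) c])
      have zL: "L2fun ?z" by (rule H1_L2[OF zH])
      have [measurable]: "?z \<in> borel_measurable borel" by (rule L2fun_meas[OF zL])
      have b: "\<bar>sqrt (V x) * ?z x\<bar> \<le> \<bar>sqrt (\<mu> + \<eta>) * ?z x\<bar>" for x
      \<comment> \<open>Outside the rescaled support both sides vanish, so the potential is only
        ever compared near \<open>x0\<close>, however large it is elsewhere.\<close>
      proof (cases "R \<le> norm (a + c *\<^sub>R x)")
        case False
        have "a + c *\<^sub>R x = c *\<^sub>R (x - x0)" by (simp add: a_def algebra_simps)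
        then have "c * dist x x0 < R" using False c by (simp add: dist_norm)
        then have "dist x x0 < R * (l * \<epsilon>)" using c l1 e by (simp add: c_def field_simps)
        also have "\<dots> < min d1 d2" using e R l1 unfolding \<epsilon>0_def by (simp add: less_divide_eq mult_ac)
        finally have "V x \<le> \<mu> + \<eta>" by (rule d)
        then show ?thesis unfolding abs_mult using V(2)[of x] by (intro mult_right_mono) auto
      qed (simp add: w(2))
      have Vz: "L2fun (\<lambda>x. sqrt (V x) * ?z x)"
        by (rule L2fun_bound[OF L2fun_scale[OF zL, of "sqrt (\<mu> + \<eta>)"]]) (use b in auto)
      have "nsq (\<lambda>x. sqrt (V x) * ?z x) \<le> nsq (\<lambda>x. sqrt (\<mu> + \<eta>) * ?z x)"
        by (rule ip_self_mono[OF L2fun_scale[OF zL] _ b]) measurable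
      also have "\<dots> = (\<mu> + \<eta>) * nsq ?z"
        using ip_lin_sq[OF zL zL, of "sqrt (\<mu> + \<eta>)" 0] \<mu> \<eta> by simp
      also have "nsq ?z = nsq w / C" unfolding C_def by (rule ip_affine[OF wm wm c])
      finally have 1: "nsq (\<lambda>x. sqrt (V x) * ?z x) \<le> (\<mu> + \<eta>) * nsq w / C" by simp
      have "\<epsilon>^2 * dip ?z ?z \<le> \<epsilon>^2 * (c^2 / C * dip w w)"
        unfolding C_def by (intro mult_left_mono H1_affine(2) w c) auto
      also have "\<dots> = (\<epsilon>^2 * c^2) * dip w w / C" by simp
      also have "\<epsilon>^2 * c^2 = \<mu> / m"
        using l2 e l1 \<mu> by (simp add: c_def power_divide power_mult_distrib)
      finally have 2: "\<epsilon>^2 * dip ?z ?z \<le> (\<mu> / m) * dip w w / C" .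
      show ?thesis using zH Vz 1 2 V(2) Vm by (simp add: XV_iff ebil_def)
    qed
    define z1 where "z1 x = w1 (a + c *\<^sub>R x)" for x
    define z2 where "z2 x = w2 (a + c *\<^sub>R x)" for x
    have E1: "XV V1 z1 \<and> ebil \<epsilon> V1 z1 z1 \<le> (\<mu> / m) * dip w1 w1 / C + (\<mu> + \<eta>) * nsq w1 / C"
      unfolding z1_def[abs_def] by (rule en[OF V(1) V0(1) _ w(1) supp(1)]) (simp_all add: d)
    have E2: "XV V2 z2 \<and> ebil \<epsilon> V2 z2 z2 \<le> (\<mu> / m) * dip w2 w2 / C + (\<mu> + \<eta>) * nsq w2 / C"
      unfolding z2_def[abs_def] by (rule en[OF V(2) V0(2) _ w(2) supp(2)]) (simp_all add: d)
    define q where "q = cnorm 1 m w1 w2"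
    define Q where "Q = ebil \<epsilon> V1 z1 z1 + ebil \<epsilon> V2 z2 z2"
    have Q0: "0 \<le> Q" by (simp add: Q_def ebil_nonneg)
    have "Q \<le> (\<mu> / m) * (1 + \<eta> / \<mu>) * q / C"
    proof -
      define g where "g = dip w1 w1 + dip w2 w2"
      define M where "M = nsq w1 + nsq w2"
      have g0: "0 \<le> g" by (simp add: g_def dip_nonneg)
      have "Q \<le> ((\<mu> / m) * g + (\<mu> + \<eta>) * M) / C"
        using E1 E2 unfolding Q_def g_def M_def by (simp add: add_divide_distrib distrib_left)
      also have "\<dots> \<le> ((\<mu> / m) * (1 + \<eta> / \<mu>) * q) / C"
      proof (rule divide_right_mono)
        define k where "k = (\<mu> / m) * (1 + \<eta> / \<mu>)"
        have "(\<mu> / m) * g \<le> k * g"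
          using \<mu> \<eta> g0 unfolding k_def by (intro mult_right_mono) (auto simp: field_simps)
        moreover have "(\<mu> + \<eta>) * M = k * (m * M)" using \<mu> unfolding k_def by (simp add: field_simps)
        moreover have "k * q = k * g + k * (m * M)"
          unfolding distrib_left[symmetric] by (simp add: q_def cnorm_def g_def M_def)
        ultimately have "(\<mu> / m) * g + (\<mu> + \<eta>) * M \<le> k * q" by linarith
        then show "(\<mu> / m) * g + (\<mu> + \<eta>) * M \<le> (\<mu> / m) * (1 + \<eta> / \<mu>) * q" unfolding k_def .
      qed (use C in simp)
      finally show ?thesis by simp
    qed
    then have "Q^2 \<le> ((\<mu> / m) * (1 + \<eta> / \<mu>) * q / C)^2" using Q0 by (intro power_mono)
    also have "\<dots> = (1 / l^4) * (\<kappa> * l) * q^2 / C^2"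
    proof -
      have "\<mu> / m = 1 / l^2" unfolding l2 by simp
      then have "(\<mu> / m)^2 = 1 / l^4" by (simp add: power_divide flip: power_mult)
      then have "((\<mu> / m) * (1 + \<eta> / \<mu>))^2 = (1 / l^4) * (\<kappa> * l)"
        unfolding power_mult_distrib \<eta>2 by simp
      then show ?thesis unfolding power_divide[of _ C] power_mult_distrib[of _ q] by simp
    qed
    finally have Q2: "Q^2 \<le> (1 / l^4) * (\<kappa> * l) * q^2 / C^2" .
    define E where "E = \<epsilon> ^ CARD('n)"
    have E: "0 < E" using e by (simp add: E_def)
    have CE: "1 / (C * E) = l ^ CARD('n)"
      using e l1 by (simp add: C_def c_def E_def power_divide power_mult_distrib)
    \<comment> \<open>Here N \<le> 3 is used: the Jacobian l^N and the surplus factor l are together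
      absorbed by l^4, which stems from the squared energy.\<close>
    have lN: "l ^ CARD('n) * l \<le> l^4"
    proof -
      have "l ^ Suc (CARD('n)) \<le> l ^ 4" using N l1 by (intro power_increasing) auto
      then show ?thesis by (simp add: mult.commute)
    qed
    have "\<sigma> / E * Q^2 \<le> \<sigma> / E * ((1 / l^4) * (\<kappa> * l) * q^2 / C^2)"
      using \<sigma> E by (intro mult_left_mono Q2) auto
    also have "\<dots> = (\<kappa> * \<sigma> * q^2 / C) * ((1 / (C * E)) * l / l^4)"
      by (simp add: power2_eq_square mult_ac)
    also have "\<dots> \<le> (\<kappa> * \<sigma> * q^2 / C) * 1"
    proof (rule mult_left_mono)
      show "1 / (C * E) * l / l^4 \<le> 1" unfolding CE using lN l1 by simp
    qed (use \<kappa> \<sigma> C in auto)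
    also have "\<dots> < Bfun a1 a2 \<beta> (w1, w2) / C" using nm C unfolding q_def by (simp add: divide_strict_right_mono)
    also have "\<dots> = Bfun a1 a2 \<beta> (z1, z2)"
      unfolding z1_def[abs_def] z2_def[abs_def] C_def
      by (rule Bfun_affine[symmetric, OF _ _ c]) (use w H1_L2 L2fun_meas in blast)+
    finally have "\<sigma> / \<epsilon> ^ CARD('n) * (ebil \<epsilon> V1 z1 z1 + ebil \<epsilon> V2 z2 z2)^2 < Bfun a1 a2 \<beta> (z1, z2)"
      unfolding E_def Q_def .
    then show ?thesis using E1 E2 by blast
  qed
  ultimately show ?thesis by blast
qed

text \<open>Outside the ball V may be replaced by m from below; inside, the deficit is at most m
  times the local mass, which tends to 0 along a weakly null sequence.\<close>

lemma ip_le_ebil_local: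
  fixes u :: "real^'n::finite \<Rightarrow> real"
  assumes u: "XV V u" and V: "\<And>x. 0 \<le> V x" and Vm: "V \<in> borel_measurable borel" and m: "0 \<le> m"
    and out: "\<And>x. R \<le> norm x \<Longrightarrow> m \<le> V x"
  shows "\<epsilon>^2 * dip u u + m * nsq u \<le> ebil \<epsilon> V u u + m * (\<integral>x. indicat_real (cball 0 R) x * (u x)^2 \<partial>lborel)"
proof -
  have uL: "L2fun u" using u H1_L2 by (auto simp: XV_def)
  have i: "integrable lborel (\<lambda>x. indicat_real (cball 0 R) x * (u x)^2)" by (intro integrable_cball_mult L2fun_sq uL)
  have iV: "integrable lborel (\<lambda>x. V x * (u x)^2)" using u by (simp add: XV_def)
  have "m * nsq u = (\<integral>x. m * (u x)^2 \<partial>lborel)" by (simp add: ip_self)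
  also have "\<dots> \<le> (\<integral>x. V x * (u x)^2 + m * (indicat_real (cball 0 R) x * (u x)^2) \<partial>lborel)"
  proof (rule integral_mono)
    fix x
    show "m * (u x)^2 \<le> V x * (u x)^2 + m * (indicat_real (cball 0 R) x * (u x)^2)"
      using V[of x] m out[of x] by (cases "norm x \<le> R") (auto intro: mult_right_mono)
  qed (use i iV L2fun_sq[OF uL] in auto)
  also have "\<dots> = (\<integral>x. V x * (u x)^2 \<partial>lborel) + m * (\<integral>x. indicat_real (cball 0 R) x * (u x)^2 \<partial>lborel)"
    using i iV by simp
  also have "(\<integral>x. V x * (u x)^2 \<partial>lborel) = nsq (\<lambda>x. sqrt (V x) * u x)"
    unfolding ip_self using V by (simp add: power_mult_distrib)
  finally show ?thesis by (simp add: ebil_def)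
qed

text \<open>\<tau> bounds the quotient for the constant potential m, and the pair (y1, y2) puts the
  supremum S strictly above it. A maximising sequence on the unit sphere therefore cannot lose mass
  to its weakly null remainder, on which only \<tau> is available.\<close>

lemma nehari_quotient_maximiser:
  fixes V1 V2 :: "real^'n::finite \<Rightarrow> real"
  assumes N: "CARD('n) \<le> 3" and c: "0 \<le> a1" "0 \<le> a2" "0 \<le> \<beta>"
    and Vm: "V1 \<in> borel_measurable borel" "V2 \<in> borel_measurable borel"
    and V\<mu>: "\<And>x. \<mu> \<le> V1 x" "\<And>x. \<mu> \<le> V2 x" and \<mu>: "0 < \<mu>" and e: "0 < \<epsilon>"
    and m: "0 < m" and out: "\<And>x. R \<le> norm x \<Longrightarrow> m \<le> V1 x" "\<And>x. R \<le> norm x \<Longrightarrow> m \<le> V2 x"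
    and \<tau>: "0 \<le> \<tau>" and ub: "\<And>u1 u2 :: real^'n \<Rightarrow> real. H1 u1 \<Longrightarrow> H1 u2 \<Longrightarrow> Bfun a1 a2 \<beta> (u1, u2) \<le> \<tau> * (cnorm \<epsilon> m u1 u2)^2"
    and lev: "XV V1 y1" "XV V2 y2" "\<tau> * (ebil \<epsilon> V1 y1 y1 + ebil \<epsilon> V2 y2 y2)^2 < Bfun a1 a2 \<beta> (y1, y2)"
  shows "\<exists>z1 z2. XV V1 z1 \<and> XV V2 z2 \<and> ebil \<epsilon> V1 z1 z1 + ebil \<epsilon> V2 z2 z2 = 1 \<and> 0 < Bfun a1 a2 \<beta> (z1, z2) \<and>
    (\<forall>v1 v2. XV V1 v1 \<longrightarrow> XV V2 v2 \<longrightarrow> Bfun a1 a2 \<beta> (v1, v2) \<le> Bfun a1 a2 \<beta> (z1, z2) * (ebil \<epsilon> V1 v1 v1 + ebil \<epsilon> V2 v2 v2)^2)"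
proof -
  have V0: "0 \<le> V1 x" "0 \<le> V2 x" for x using V\<mu>[of x] \<mu> by auto
  define Q where "Q u1 u2 = ebil \<epsilon> V1 u1 u1 + ebil \<epsilon> V2 u2 u2" for u1 u2
  define B where "B u1 u2 = Bfun a1 a2 \<beta> (u1, u2)" for u1 u2 :: "real^'n \<Rightarrow> real"
  have Q0: "0 \<le> Q u1 u2" for u1 u2 by (simp add: Q_def ebil_nonneg)
  have H: "XV V u \<Longrightarrow> H1 u" for V u :: "real^'n \<Rightarrow> real" by (simp add: XV_def)
  define \<gamma> where "\<gamma> = 1 / \<epsilon>^2 + 1 / \<mu>"
  have \<gamma>0: "0 < \<gamma>" using e \<mu> by (simp add: \<gamma>_def add_pos_pos)
  have lower: "dip u u \<le> ebil \<epsilon> V u u / \<epsilon>^2" "nsq u \<le> ebil \<epsilon> V u u / \<mu>"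
    if "XV V u" "\<And>x. \<mu> \<le> V x" "V \<in> borel_measurable borel" for u V :: "real^'n \<Rightarrow> real"
  proof -
    have "\<epsilon>^2 * dip u u + \<mu> * nsq u \<le> ebil \<epsilon> V u u" by (rule ebil_lower[OF that(1,2) \<mu> that(3)])
    moreover have "0 \<le> \<epsilon>^2 * dip u u" "0 \<le> \<mu> * nsq u" using \<mu> by (auto simp: dip_nonneg ip_self_nonneg)
    ultimately have "\<epsilon>^2 * dip u u \<le> ebil \<epsilon> V u u" "\<mu> * nsq u \<le> ebil \<epsilon> V u u" by linarith+
    then show "dip u u \<le> ebil \<epsilon> V u u / \<epsilon>^2" "nsq u \<le> ebil \<epsilon> V u u / \<mu>"
      using e \<mu> by (auto simp: field_simps)
  qed
  have sumle: "nsq u1 + dip u1 u1 + nsq u2 + dip u2 u2 \<le> \<gamma> * Q u1 u2" if "XV V1 u1" "XV V2 u2" for u1 u2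
    using lower[OF that(1) V\<mu>(1) Vm(1)] lower[OF that(2) V\<mu>(2) Vm(2)]
    unfolding \<gamma>_def Q_def by (simp add: add_divide_distrib distrib_left distrib_right)
  \<comment> \<open>For arbitrary coefficients because it is applied twice: to B itself and, with
    all coefficients 1, to bound the remainders in L4.\<close>
  have Bb: "\<exists>K>0. \<forall>u1 u2. XV V1 u1 \<longrightarrow> XV V2 u2 \<longrightarrow> Bfun b1 b2 b3 (u1, u2) \<le> K * (Q u1 u2)^2"
    if b: "0 \<le> b1" "0 \<le> b2" "0 \<le> b3" for b1 b2 b3
  proof -
    obtain K where K: "K > 0" "\<And>u1 u2 :: real^'n \<Rightarrow> real. H1 u1 \<Longrightarrow> H1 u2 \<Longrightarrow>
      Bfun b1 b2 b3 (u1, u2) \<le> K * (nsq u1 + dip u1 u1 + nsq u2 + dip u2 u2)^2"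
      by (rule Bfun_bound[OF N b]) blast
    have "Bfun b1 b2 b3 (u1, u2) \<le> K * \<gamma>^2 * (Q u1 u2)^2" if u: "XV V1 u1" "XV V2 u2" for u1 u2
    proof -
      have "(nsq u1 + dip u1 u1 + nsq u2 + dip u2 u2)^2 \<le> (\<gamma> * Q u1 u2)^2"
        by (intro power_mono sumle u add_nonneg_nonneg ip_self_nonneg dip_nonneg)
      then have "K * (nsq u1 + dip u1 u1 + nsq u2 + dip u2 u2)^2 \<le> K * (\<gamma> * Q u1 u2)^2"
        using K(1) by (intro mult_left_mono) auto
      then show ?thesis using K(2)[OF H[OF u(1)] H[OF u(2)]] by (simp add: power_mult_distrib mult.assoc)
    qed
    then show ?thesis using K(1) \<gamma>0 by (intro exI[of _ "K * \<gamma>^2"]) auto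
  qed
  obtain K where K: "K > 0" "\<And>u1 u2. XV V1 u1 \<Longrightarrow> XV V2 u2 \<Longrightarrow> B u1 u2 \<le> K * (Q u1 u2)^2"
    using Bb[OF c] unfolding B_def by blast
  define A where "A = {B u1 u2 / (Q u1 u2)^2 | u1 u2. XV V1 u1 \<and> XV V2 u2 \<and> 0 < Q u1 u2}"
  define S where "S = Sup A"
  have bdd: "bdd_above A"
    by (rule bdd_aboveI[of _ K]) (auto simp: A_def divide_le_eq K)
  have Sub: "B u1 u2 \<le> S * (Q u1 u2)^2" if u: "XV V1 u1" "XV V2 u2" for u1 u2
  proof (cases "Q u1 u2 = 0")
    case True
    then show ?thesis using K(2)[OF u] by simp
  next
    case False
    then have p: "0 < Q u1 u2" using Q0[of u1 u2] by simp
    then have "B u1 u2 / (Q u1 u2)^2 \<le> S"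
      unfolding S_def using u by (intro cSup_upper bdd) (auto simp: A_def)
    then show ?thesis using p by (simp add: divide_le_eq)
  qed
  have yQ: "0 < Q y1 y2"
  proof (rule ccontr)
    assume "\<not> 0 < Q y1 y2"
    then have "Q y1 y2 = 0" using Q0[of y1 y2] by simp
    then show False using K(2)[OF lev(1,2)] lev(3) unfolding Q_def B_def by simp
  qed
  have S\<tau>: "\<tau> < S"
  proof -
    have "\<tau> * (Q y1 y2)^2 < S * (Q y1 y2)^2" using Sub[OF lev(1,2)] lev(3) unfolding Q_def B_def by linarith
    then show ?thesis using yQ by simp
  qed
  have S0: "0 < S" using S\<tau> \<tau> by simp
  have "\<exists>u1 u2. XV V1 u1 \<and> XV V2 u2 \<and> Q u1 u2 = 1 \<and> S - 1 / Suc n < B u1 u2" for n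
  proof -
    have "S - 1 / Suc n < Sup A" unfolding S_def[symmetric] by simp
    moreover have "A \<noteq> {}" using lev yQ by (auto simp: A_def)
    ultimately obtain a where "a \<in> A" "S - 1 / Suc n < a" using less_cSupD by blast
    then obtain v1 v2 where v: "XV V1 v1" "XV V2 v2" "0 < Q v1 v2" "S - 1 / Suc n < B v1 v2 / (Q v1 v2)^2"
      by (auto simp: A_def)
    \<comment> \<open>Normalises to energy 1; the quotient B / Q^2 is invariant under scaling, so B
      becomes its value.\<close>
    define t where "t = 1 / sqrt (Q v1 v2)"
    have t2: "t^2 = 1 / Q v1 v2" using v(3) by (simp add: t_def power_divide)
    have X: "XV V1 (\<lambda>x. t * v1 x)" "XV V2 (\<lambda>x. t * v2 x)"
      using XV_lin[OF v(1) v(1) V0(1) Vm(1), of t 0] XV_lin[OF v(2) v(2) V0(2) Vm(2), of t 0] by simp_all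
    have "Q (\<lambda>x. t * v1 x) (\<lambda>x. t * v2 x) = t^2 * Q v1 v2"
      using ebil_lin_sq[OF v(1) v(1) V0(1) Vm(1), of \<epsilon> t 0] ebil_lin_sq[OF v(2) v(2) V0(2) Vm(2), of \<epsilon> t 0]
      by (simp add: Q_def distrib_left)
    then have 1: "Q (\<lambda>x. t * v1 x) (\<lambda>x. t * v2 x) = 1" using v(3) t2 by simp
    have "B (\<lambda>x. t * v1 x) (\<lambda>x. t * v2 x) = (t^2)^2 * B v1 v2"
      unfolding B_def Bfun_scale by (simp flip: power_mult)
    also have "\<dots> = B v1 v2 / (Q v1 v2)^2" unfolding t2 by (simp add: power_divide)
    finally show ?thesis using X 1 v(4) by (metis (no_types, lifting))
  qed
  then obtain u1 u2 where u: "\<And>n. XV V1 (u1 n)" "\<And>n. XV V2 (u2 n)" "\<And>n. Q (u1 n) (u2 n) = 1"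
    and uB: "\<And>n. S - 1 / real (Suc n) < B (u1 n) (u2 n)" by metis
  have e1: "ebil \<epsilon> V1 (u1 n) (u1 n) \<le> 1" "ebil \<epsilon> V2 (u2 n) (u2 n) \<le> 1" for n
    using u(3)[of n] ebil_nonneg[of \<epsilon> V1 "u1 n"] ebil_nonneg[of \<epsilon> V2 "u2 n"] unfolding Q_def by linarith+
  obtain r1 z1 where r1: "strict_mono (r1::nat\<Rightarrow>nat)" and z1: "XV V1 z1" "wconv (\<lambda>n. u1 (r1 n)) z1"
    and l1: "(\<lambda>n. ebil \<epsilon> V1 (u1 (r1 n)) z1) \<longlonglongrightarrow> ebil \<epsilon> V1 z1 z1"
    by (rule XV_weak_compact[OF V\<mu>(1) \<mu> Vm(1) e u(1) e1(1)])
  obtain r2 z2 where r2: "strict_mono (r2::nat\<Rightarrow>nat)" and z2: "XV V2 z2" "wconv (\<lambda>n. u2 (r1 (r2 n))) z2"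
    and l2: "(\<lambda>n. ebil \<epsilon> V2 (u2 (r1 (r2 n))) z2) \<longlonglongrightarrow> ebil \<epsilon> V2 z2 z2"
    by (rule XV_weak_compact[of \<mu> V2 \<epsilon> "\<lambda>n. u2 (r1 n)" 1, OF V\<mu>(2) \<mu> Vm(2) e u(2) e1(2)])
  define r where "r n = r1 (r2 n)" for n
  have r: "strict_mono r" using r1 r2 by (simp add: r_def strict_mono_def)
  have wc: "wconv (\<lambda>n. u1 (r n)) z1" "wconv (\<lambda>n. u2 (r n)) z2"
    using wconv_subseq[OF z1(2) r2] z2(2) by (simp_all add: r_def)
  have le: "(\<lambda>n. ebil \<epsilon> V1 (u1 (r n)) z1) \<longlonglongrightarrow> ebil \<epsilon> V1 z1 z1" "(\<lambda>n. ebil \<epsilon> V2 (u2 (r n)) z2) \<longlonglongrightarrow> ebil \<epsilon> V2 z2 z2"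
    using LIMSEQ_subseq_LIMSEQ[OF l1 r2] l2 by (simp_all add: r_def comp_def)
  define w1 where "w1 n x = u1 (r n) x - z1 x" for n x
  define w2 where "w2 n x = u2 (r n) x - z2 x" for n x
  have wX: "XV V1 (w1 n)" "XV V2 (w2 n)" for n
    using XV_lin[OF u(1) z1(1) V0(1) Vm(1), of 1 "r n" "-1"] XV_lin[OF u(2) z2(1) V0(2) Vm(2), of 1 "r n" "-1"]
    by (simp_all add: w1_def[abs_def] w2_def[abs_def])
  define t where "t = Q z1 z2"
  \<comment> \<open>Expanding the square leaves products with the fixed limit only, and these
    converge; the energy thus splits in the limit as 1 = t + (1 - t).\<close>
  have wQ: "Q (w1 n) (w2 n) = 1 - 2 * (ebil \<epsilon> V1 (u1 (r n)) z1 + ebil \<epsilon> V2 (u2 (r n)) z2) + t" for n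
    using ebil_lin_sq[OF u(1) z1(1) V0(1) Vm(1), of \<epsilon> 1 "r n" "-1"] ebil_lin_sq[OF u(2) z2(1) V0(2) Vm(2), of \<epsilon> 1 "r n" "-1"] u(3)[of "r n"]
    by (simp add: w1_def[abs_def] w2_def[abs_def] t_def Q_def)
  have cv: "(\<lambda>n. Q (w1 n) (w2 n)) \<longlonglongrightarrow> 1 - 2 * (ebil \<epsilon> V1 z1 z1 + ebil \<epsilon> V2 z2 z2) + t"
    unfolding wQ by (intro tendsto_intros le)
  have te: "1 - 2 * (ebil \<epsilon> V1 z1 z1 + ebil \<epsilon> V2 z2 z2) + t = 1 - t" by (simp add: t_def Q_def)
  have wQl: "(\<lambda>n. Q (w1 n) (w2 n)) \<longlonglongrightarrow> 1 - t" using cv unfolding te .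
  have t0: "0 \<le> t" unfolding t_def by (rule Q0)
  have t1: "t \<le> 1" using LIMSEQ_le_const[OF wQl, of 0] Q0 by auto
  obtain M where M: "\<And>n. Q (w1 n) (w2 n) \<le> M"
  proof -
    obtain M where "\<And>n. norm (Q (w1 n) (w2 n)) \<le> M"
      using convergent_imp_Bseq[OF convergentI[OF wQl]] by (auto simp: Bseq_def)
    then show ?thesis using that by (metis abs_le_D1 real_norm_def)
  qed
  have wL: "L2fun (w1 n)" "L2fun (w2 n)" for n using wX H H1_L2 by blast+
  define M' where "M' = \<gamma> * M"
  have wb: "nsq (w1 n) \<le> M'" "dip (w1 n) (w1 n) \<le> M'" "nsq (w2 n) \<le> M'" "dip (w2 n) (w2 n) \<le> M'" for n
    using sumle[OF wX, of n n] mult_left_mono[OF M[of n], of \<gamma>] \<gamma>0 ip_self_nonneg[of "w1 n"] ip_self_nonneg[of "w2 n"]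
      dip_nonneg[of "w1 n"] dip_nonneg[of "w2 n"] unfolding M'_def by linarith+
  have zL: "L2fun z1" "L2fun z2" using z1 z2 H H1_L2 by blast+
  have uL: "L2fun (u1 n)" "L2fun (u2 n)" for n using u H H1_L2 by blast+
  have w0: "wconv w1 (\<lambda>x. 0)" "wconv w2 (\<lambda>x. 0)"
    unfolding w1_def[abs_def] w2_def[abs_def] by (intro wconv_diff uL zL wc)+
  have loc: "(\<lambda>n. \<integral>x. indicat_real (cball 0 \<rho>) x * (w1 n x)^2 \<partial>lborel) \<longlonglongrightarrow> 0"
    "(\<lambda>n. \<integral>x. indicat_real (cball 0 \<rho>) x * (w2 n x)^2 \<partial>lborel) \<longlonglongrightarrow> 0" for \<rho>
    by (rule rellich[OF H[OF wX(1)] wb(1,2) w0(1)], rule rellich[OF H[OF wX(2)] wb(3,4) w0(2)])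
  \<comment> \<open>The local mass of the remainders, the error in replacing both potentials by
    m.\<close>
  define L where "L n = (\<integral>x. indicat_real (cball 0 R) x * (w1 n x)^2 \<partial>lborel) + (\<integral>x. indicat_real (cball 0 R) x * (w2 n x)^2 \<partial>lborel)" for n
  have Ll: "L \<longlonglongrightarrow> 0" unfolding L_def using tendsto_add[OF loc] by simp
  have wB: "B (w1 n) (w2 n) \<le> \<tau> * (Q (w1 n) (w2 n) + m * L n)^2" for n
  proof -
    have "cnorm \<epsilon> m (w1 n) (w2 n) \<le> Q (w1 n) (w2 n) + m * L n"
      using ip_le_ebil_local[OF wX(1)[of n] V0(1) Vm(1) less_imp_le[OF m] out(1), where \<epsilon> = \<epsilon> and R = R]
        ip_le_ebil_local[OF wX(2)[of n] V0(2) Vm(2) less_imp_le[OF m] out(2), where \<epsilon> = \<epsilon> and R = R]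
      unfolding cnorm_def Q_def L_def by (simp add: distrib_left)
    then have "(cnorm \<epsilon> m (w1 n) (w2 n))^2 \<le> (Q (w1 n) (w2 n) + m * L n)^2"
      using cnorm_nonneg[of m] m by (intro power_mono) auto
    then have "\<tau> * (cnorm \<epsilon> m (w1 n) (w2 n))^2 \<le> \<tau> * (Q (w1 n) (w2 n) + m * L n)^2" using \<tau> by (intro mult_left_mono)
    then show ?thesis using ub[OF H[OF wX(1)] H[OF wX(2)], of n n] unfolding B_def by linarith
  qed
  define P where "P x = (z1 x)^2 + (z2 x)^2" for x
  define W where "W n x = (w1 n x)^2 + (w2 n x)^2" for n x
  note L4 = H1_L4[OF N H[OF z1(1)]] H1_L4[OF N H[OF z2(1)]]
  have L4w: "L4fun (w1 n)" "L4fun (w2 n)" for n using H1_L4[OF N] H wX by blast+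
  have PL: "L2fun P" unfolding P_def[abs_def] using L4 by (intro L2fun_add) (auto simp: L4fun_def)
  have WL: "L2fun (W n)" for n unfolding W_def[abs_def] using L4w[of n] by (intro L2fun_add) (auto simp: L4fun_def)
  obtain K2 where K2: "\<And>n. nsq (W n) \<le> K2"
  proof -
    obtain K' where K': "K' > 0" "\<And>u1 u2. XV V1 u1 \<Longrightarrow> XV V2 u2 \<Longrightarrow> Bfun 1 1 1 (u1, u2) \<le> K' * (Q u1 u2)^2"
      using Bb[of 1 1 1] by auto
    have "nsq (W n) \<le> K' * M^2" for n
    proof -
      \<comment> \<open>The square of w1^2 + w2^2 is the quartic integrand with all coefficients
        equal to 1.\<close>
      have "nsq (W n) = Bfun 1 1 1 (w1 n, w2 n)"
        unfolding ip_def Bfun_pair W_def by (simp add: algebra_simps power2_eq_square power4_eq_xxxx)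
      also have "\<dots> \<le> K' * (Q (w1 n) (w2 n))^2" by (rule K'(2)[OF wX])
      also have "\<dots> \<le> K' * M^2" using K'(1) by (intro mult_left_mono power_mono M Q0) auto
      finally show ?thesis .
    qed
    then show ?thesis using that by blast
  qed
  have PW: "(\<lambda>n. ip P (W n)) \<longlonglongrightarrow> 0"
  proof (rule local_decay_product[OF PL _ WL _ K2])
    show "(\<lambda>n. \<integral>x. indicat_real (cball 0 \<rho>) x * W n x \<partial>lborel) \<longlonglongrightarrow> 0" for \<rho>
    proof -
      have "(\<integral>x. indicat_real (cball 0 \<rho>) x * W n x \<partial>lborel)
        = (\<integral>x. indicat_real (cball 0 \<rho>) x * (w1 n x)^2 \<partial>lborel) + (\<integral>x. indicat_real (cball 0 \<rho>) x * (w2 n x)^2 \<partial>lborel)" for n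
        unfolding W_def distrib_left
        by (intro Bochner_Integration.integral_add integrable_cball_mult L2fun_sq wL)
      then show ?thesis using tendsto_add[OF loc] by simp
    qed
    show "integrable lborel (W n)" for n
      unfolding W_def[abs_def] by (intro Bochner_Integration.integrable_add L2fun_sq wL)
  qed (simp_all add: P_def W_def)
  define D where "D = a1 + a2 + 2 * \<beta>"
  have D0: "0 \<le> D" using c by (simp add: D_def)
  \<comment> \<open>\<eta> is fixed while n tends to infinity, which removes the product of P and W;
    afterwards \<eta> is sent to 0.\<close>
  have main: "S \<le> B z1 z2 + \<tau> * (1 - t)^2 + D * (4 * \<eta> * (nsq P + K2))" if \<eta>: "0 < \<eta>" for \<eta>
  proof (rule LIMSEQ_le)
    have "(\<lambda>n. 1 / real (Suc (r n))) \<longlonglongrightarrow> 0"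
      using LIMSEQ_subseq_LIMSEQ[OF LIMSEQ_inverse_real_of_nat r] by (simp add: comp_def inverse_eq_divide)
    then have "(\<lambda>n. S - 1 / real (Suc (r n))) \<longlonglongrightarrow> S - 0" by (intro tendsto_intros)
    then show "(\<lambda>n. S - 1 / real (Suc (r n))) \<longlonglongrightarrow> S" by simp
    have "(\<lambda>n. B z1 z2 + \<tau> * (Q (w1 n) (w2 n) + m * L n)^2 + D * (4 * \<eta> * (nsq P + K2) + (2 / \<eta> + 6) * ip P (W n)))
      \<longlonglongrightarrow> B z1 z2 + \<tau> * ((1 - t) + m * 0)^2 + D * (4 * \<eta> * (nsq P + K2) + (2 / \<eta> + 6) * 0)"
      by (intro tendsto_intros wQl Ll PW)
    then show "(\<lambda>n. B z1 z2 + \<tau> * (Q (w1 n) (w2 n) + m * L n)^2 + D * (4 * \<eta> * (nsq P + K2) + (2 / \<eta> + 6) * ip P (W n)))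
      \<longlonglongrightarrow> B z1 z2 + \<tau> * (1 - t)^2 + D * (4 * \<eta> * (nsq P + K2))" by simp
    have "S - 1 / real (Suc (r n)) \<le> B z1 z2 + \<tau> * (Q (w1 n) (w2 n) + m * L n)^2 + D * (4 * \<eta> * (nsq P + K2) + (2 / \<eta> + 6) * ip P (W n))" for n
    proof -
      have "B (u1 (r n)) (u2 (r n)) \<le> B z1 z2 + B (w1 n) (w2 n) + D * (4 * \<eta> * (nsq P + nsq (W n)) + (2 / \<eta> + 6) * ip P (W n))"
        using Bfun_split[OF c \<eta> L4 L4w, of n n] unfolding B_def D_def P_def[abs_def] W_def[abs_def] w1_def w2_def by simp
      moreover have "D * (4 * \<eta> * (nsq P + nsq (W n)) + (2 / \<eta> + 6) * ip P (W n)) \<le> D * (4 * \<eta> * (nsq P + K2) + (2 / \<eta> + 6) * ip P (W n))"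
        using K2[of n] \<eta> by (intro mult_left_mono D0 add_right_mono) auto
      ultimately show ?thesis using uB[of "r n"] wB[of n] by linarith
    qed
    then show "\<exists>n0. \<forall>n\<ge>n0. S - 1 / real (Suc (r n)) \<le> B z1 z2 + \<tau> * (Q (w1 n) (w2 n) + m * L n)^2 + D * (4 * \<eta> * (nsq P + K2) + (2 / \<eta> + 6) * ip P (W n))"
      by blast
  qed
  have main0: "S \<le> B z1 z2 + \<tau> * (1 - t)^2"
  proof (rule field_le_epsilon)
    fix d :: real assume d: "0 < d"
    \<comment> \<open>The added 1 allows division when the first summand vanishes; \<eta> = d / C
      then makes the remaining error at most d.\<close>
    define C where "C = D * (4 * (nsq P + K2)) + 1"
    have "0 \<le> nsq P + K2" using K2[of 0] ip_self_nonneg[of P] ip_self_nonneg[of "W 0"] by linarith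
    then have C: "0 < C" using D0 by (simp add: C_def add_nonneg_pos)
    have "D * (4 * (d / C) * (nsq P + K2)) = (d / C) * (C - 1)" unfolding C_def by simp
    also have "\<dots> \<le> d" using d C by (simp add: field_simps)
    finally show "S \<le> B z1 z2 + \<tau> * (1 - t)^2 + d" using main[of "d / C"] d C by simp
  qed
  have Bz: "B z1 z2 \<le> S * t^2" unfolding t_def by (rule Sub[OF z1(1) z2(1)])
  have t: "t = 1"
  proof (rule ccontr)
    assume "t \<noteq> 1"
    then have lt: "t < 1" using t1 by simp
    have "S \<le> S * t^2 + \<tau> * (1 - t)^2" using main0 Bz by linarith
    also have "\<dots> < S * t^2 + S * (1 - t)^2" using S\<tau> lt by simp
    also have "\<dots> = S * (t^2 + (1 - t)^2)" by (simp add: distrib_left)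
    also have "\<dots> \<le> S * 1"
    proof (rule mult_left_mono)
      have "t * (1 - t) \<ge> 0" using t0 t1 by simp
      then show "t^2 + (1 - t)^2 \<le> 1" by (simp add: power2_eq_square algebra_simps)
    qed (use S0 in simp)
    finally show False by simp
  qed
  have BS: "B z1 z2 = S" using main0 Bz t by simp
  show ?thesis
  proof (intro exI conjI allI impI)
    show "XV V1 z1" "XV V2 z2" by (rule z1(1), rule z2(1))
    show "ebil \<epsilon> V1 z1 z1 + ebil \<epsilon> V2 z2 z2 = 1" using t by (simp add: t_def Q_def)
    show "0 < Bfun a1 a2 \<beta> (z1, z2)" using BS S0 by (simp add: B_def)
    show "Bfun a1 a2 \<beta> (v1, v2) \<le> Bfun a1 a2 \<beta> (z1, z2) * (ebil \<epsilon> V1 v1 v1 + ebil \<epsilon> V2 v2 v2)^2" if "XV V1 v1" "XV V2 v2" for v1 v2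
      using Sub[OF that] BS by (simp add: B_def Q_def)
  qed
qed


section \<open>From a maximiser to a nonnegative ground state\<close>

lemma XV_abs:
  fixes u :: "real^'n::finite \<Rightarrow> real"
  assumes "XV V u"
  shows "XV V (\<lambda>x. \<bar>u x\<bar>)" "ebil \<epsilon> V (\<lambda>x. \<bar>u x\<bar>) (\<lambda>x. \<bar>u x\<bar>) \<le> ebil \<epsilon> V u u"
proof -
  have H: "H1 u" using assms by (simp add: XV_def)
  show "XV V (\<lambda>x. \<bar>u x\<bar>)" using assms H1_abs(1)[OF H] by (simp add: XV_def)
  have "nsq (\<lambda>x. sqrt (V x) * \<bar>u x\<bar>) = nsq (\<lambda>x. sqrt (V x) * u x)"
    unfolding ip_self by (simp add: power_mult_distrib)
  then show "ebil \<epsilon> V (\<lambda>x. \<bar>u x\<bar>) (\<lambda>x. \<bar>u x\<bar>) \<le> ebil \<epsilon> V u u"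
    unfolding ebil_def using mult_left_mono[OF H1_abs(2)[OF H], of "\<epsilon>^2"] by simp
qed

text \<open>Along every line, \<open>t \<mapsto> S Q(z + t v)\<^sup>2 - B(z + t v)\<close> is a nonnegative polynomial vanishing at \<open>0\<close>; its
  derivative there is a multiple of that of \<open>J\<close>, since \<open>S Q(z) = 1\<close>.\<close>
lemma maximiser_ground_state:
  fixes V1 V2 :: "real^'n::finite \<Rightarrow> real"
  assumes N: "CARD('n) \<le> 3"
    and Vm: "V1 \<in> borel_measurable borel" "V2 \<in> borel_measurable borel"
    and V\<mu>: "\<And>x. \<mu> \<le> V1 x" "\<And>x. \<mu> \<le> V2 x" and \<mu>: "0 < \<mu>" and S: "0 < S"
    and z: "XV V1 z1" "XV V2 z2"
    and Qz: "ebil \<epsilon> V1 z1 z1 + ebil \<epsilon> V2 z2 z2 = 1 / S" and Bz: "Bfun a1 a2 \<beta> (z1, z2) = 1 / S"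
    and max: "\<And>v1 v2. XV V1 v1 \<Longrightarrow> XV V2 v2 \<Longrightarrow> Bfun a1 a2 \<beta> (v1, v2) \<le> S * (ebil \<epsilon> V1 v1 v1 + ebil \<epsilon> V2 v2 v2)^2"
  shows "ground_state \<epsilon> V1 V2 a1 a2 \<beta> (z1, z2)"
proof -
  have V0: "0 \<le> V1 x" "0 \<le> V2 x" for x using V\<mu>[of x] \<mu> by auto
  define Q where "Q u1 u2 = ebil \<epsilon> V1 u1 u1 + ebil \<epsilon> V2 u2 u2" for u1 u2
  have Xn: "Xnormsq \<epsilon> V1 V2 (u1, u2) = Q u1 u2" if "XV V1 u1" "XV V2 u2" for u1 u2
    unfolding Q_def by (rule Xnormsq_eq[OF that V0])
  have J: "Jfun \<epsilon> V1 V2 a1 a2 \<beta> (u1, u2) = Q u1 u2 / 2 - Bfun a1 a2 \<beta> (u1, u2) / 4" if "XV V1 u1" "XV V2 u2" for u1 u2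
    by (simp add: Jfun_def Xn[OF that])
  have Jz: "Jfun \<epsilon> V1 V2 a1 a2 \<beta> (z1, z2) = 1 / (4 * S)"
    using J[OF z] Qz Bz by (simp add: Q_def)
  have "((\<lambda>t. Jfun \<epsilon> V1 V2 a1 a2 \<beta> (\<lambda>x. z1 x + t * v1 x, \<lambda>x. z2 x + t * v2 x)) has_real_derivative 0) (at 0)"
    if v: "XV V1 v1" "XV V2 v2" for v1 v2
  proof -
    have X: "XV V1 (\<lambda>x. z1 x + t * v1 x)" "XV V2 (\<lambda>x. z2 x + t * v2 x)" for t
      using XV_lin[OF z(1) v(1) V0(1) Vm(1), of 1 t] XV_lin[OF z(2) v(2) V0(2) Vm(2), of 1 t] by simp_all
    define p where "p = ebil \<epsilon> V1 z1 v1 + ebil \<epsilon> V2 z2 v2"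
    define q where "q = Q v1 v2"
    have Qt: "Q (\<lambda>x. z1 x + t * v1 x) (\<lambda>x. z2 x + t * v2 x) = 1 / S + 2 * t * p + t^2 * q" for t
      using ebil_lin_sq[OF z(1) v(1) V0(1) Vm(1), of \<epsilon> 1 t] ebil_lin_sq[OF z(2) v(2) V0(2) Vm(2), of \<epsilon> 1 t] Qz
      by (simp add: Q_def p_def q_def distrib_left)
    have H: "XV V u \<Longrightarrow> L4fun u" for V u :: "real^'n \<Rightarrow> real" using H1_L4[OF N] by (simp add: XV_def)
    obtain b1 b2 b3 b4 where Bt: "\<And>t. Bfun a1 a2 \<beta> (\<lambda>x. z1 x + t * v1 x, \<lambda>x. z2 x + t * v2 x)
      = 1 / S + t * b1 + t^2 * b2 + t^3 * b3 + t^4 * b4"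
      by (rule Bfun_line[OF H[OF z(1)] H[OF z(2)] H[OF v(1)] H[OF v(2)], of a1 a2 \<beta>, unfolded Bz]) blast
    define f where "f t = S * (1 / S + 2 * t * p + t^2 * q)^2 - (1 / S + t * b1 + t^2 * b2 + t^3 * b3 + t^4 * b4)" for t
    have f0: "f 0 = 0" using S by (simp add: f_def power2_eq_square)
    have fp: "f 0 \<le> f t" for t
    proof -
      have "0 \<le> f t" using max[OF X[of t]] unfolding Bt Q_def[symmetric] Qt f_def by simp
      then show ?thesis using f0 by simp
    qed
    have "((\<lambda>t. S * (1 / S + 2 * t * p + t^2 * q)^2 - (1 / S + t * b1 + t^2 * b2 + t^3 * b3 + t^4 * b4))
        has_real_derivative (S * (2 * (1 / S) * (2 * p)) - b1)) (at 0)"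
      by (rule derivative_eq_intros refl | simp)+
    then have "(f has_real_derivative (4 * p - b1)) (at 0)"
      unfolding f_def[abs_def] using S by simp
    \<comment> \<open>Minimality forces \<open>b1 = 4 * p\<close>, where \<open>p\<close> is half
      the derivative of Q and \<open>b1\<close> the derivative of B: this is the weak equation
      tested with (v1, v2).\<close>
    from DERIV_local_min[OF this, of 1] fp have pb: "4 * p - b1 = 0" by auto
    have "((\<lambda>t. (1 / S + 2 * t * p + t^2 * q) / 2 - (1 / S + t * b1 + t^2 * b2 + t^3 * b3 + t^4 * b4) / 4) has_real_derivative (p - b1 / 4)) (at 0)"
      by (rule derivative_eq_intros refl | simp)+
    moreover have "p - b1 / 4 = 0" using pb by simp
    ultimately show ?thesis by (simp add: J[OF X] Qt Bt)
  qed
  then have crit: "critical_point \<epsilon> V1 V2 a1 a2 \<beta> (z1, z2)"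
    unfolding critical_point_def using z by (auto simp: Xsp_iff)
  have "c_level \<epsilon> V1 V2 a1 a2 \<beta> = 1 / (4 * S)"
    unfolding c_level_def
  proof (rule cInf_eq_minimum)
    have "\<not> (AE x in lborel. z1 x = 0 \<and> z2 x = 0)"
    proof
      assume "AE x in lborel. z1 x = 0 \<and> z2 x = 0"
      then have "Bfun a1 a2 \<beta> (z1, z2) = 0" by (intro Bfun_AE_zero) auto
      then show False using Bz S by simp
    qed
    then have "(z1, z2) \<in> Nehari \<epsilon> V1 V2 a1 a2 \<beta>"
      using z Qz Bz Xn[OF z] by (simp add: Nehari_def Xsp_iff Q_def)
    then show "1 / (4 * S) \<in> Jfun \<epsilon> V1 V2 a1 a2 \<beta> ` Nehari \<epsilon> V1 V2 a1 a2 \<beta>"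
      using Jz by (metis image_eqI)
    fix y assume "y \<in> Jfun \<epsilon> V1 V2 a1 a2 \<beta> ` Nehari \<epsilon> V1 V2 a1 a2 \<beta>"
    then obtain v1 v2 where "(v1, v2) \<in> Nehari \<epsilon> V1 V2 a1 a2 \<beta>" and y: "y = Jfun \<epsilon> V1 V2 a1 a2 \<beta> (v1, v2)" by auto
    then have v: "XV V1 v1" "XV V2 v2" and nz: "\<not> (AE x in lborel. v1 x = 0 \<and> v2 x = 0)"
      and QB: "Q v1 v2 = Bfun a1 a2 \<beta> (v1, v2)"
      by (auto simp: Nehari_def Xsp_iff Xn)
    have Qp: "0 < Q v1 v2"
    proof (rule ccontr)
      assume "\<not> 0 < Q v1 v2"
      then have e0: "ebil \<epsilon> V1 v1 v1 \<le> 0" "ebil \<epsilon> V2 v2 v2 \<le> 0"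
        using ebil_nonneg[of \<epsilon> V1 v1] ebil_nonneg[of \<epsilon> V2 v2] unfolding Q_def by linarith+
      have "AE x in lborel. v x = 0" if "XV V v" "\<And>x. \<mu> \<le> V x" "V \<in> borel_measurable borel" "ebil \<epsilon> V v v \<le> 0" for V v :: "real^'n \<Rightarrow> real"
      proof -
        have "\<epsilon>^2 * dip v v + \<mu> * nsq v \<le> 0" using ebil_lower[OF that(1,2) \<mu> that(3), of \<epsilon>] that(4) by linarith
        moreover have "0 \<le> \<epsilon>^2 * dip v v" "0 \<le> \<mu> * nsq v" using \<mu> by (auto simp: dip_nonneg ip_self_nonneg)
        ultimately have "\<mu> * nsq v = 0" by linarith
        then have "nsq v = 0" using \<mu> by simp
        then show ?thesis using ip_self_eq_0 H1_L2 that(1) unfolding XV_def by blast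
      qed
      then have "AE x in lborel. v1 x = 0" "AE x in lborel. v2 x = 0"
        using v V\<mu> Vm e0 by blast+
      then show False using nz by auto
    qed
    \<comment> \<open>On the Nehari set Q = B, so the quotient bound reads Q \<le> S Q^2 and gives Q
      \<ge> 1/S, while J reduces to Q/4.\<close>
    have "Q v1 v2 \<le> S * (Q v1 v2)^2" using max[OF v] QB by (simp add: Q_def)
    then have "1 \<le> S * Q v1 v2" using Qp by (simp add: power2_eq_square)
    then have "1 / S \<le> Q v1 v2" using S by (simp add: field_simps)
    then show "1 / (4 * S) \<le> y" unfolding y J[OF v] QB[symmetric] by simp
  qed
  then show ?thesis using crit Jz by (simp add: ground_state_def)
qed

lemma Liminf_at_infinity_gt:
  fixes V :: "real^'n::finite \<Rightarrow> real"
  assumes "Liminf at_infinity (\<lambda>x. ereal (V x)) > ereal \<mu>"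
  obtains m R where "\<mu> < m" "\<And>x. R \<le> norm x \<Longrightarrow> m \<le> V x"
proof -
  obtain m where m: "ereal \<mu> < ereal m" "ereal m < Liminf at_infinity (\<lambda>x. ereal (V x))"
    using ereal_dense2[OF assms] by blast
  have "\<forall>\<^sub>F x in at_infinity. ereal m < ereal (V x)" using less_LiminfD[OF m(2)] .
  then obtain R where "\<And>x. R \<le> norm x \<Longrightarrow> m < V x" by (auto simp: eventually_at_infinity)
  then show ?thesis using that[of m R] m(1) by force
qed

theorem theoremA1:
  fixes V1 V2 :: "real^'n::finite \<Rightarrow> real" and a1 a2 \<beta> \<mu> :: real
  assumes "CARD('n) \<le> 3"
    and "a1 > 0" and "a2 > 0" and "\<beta> > max a1 a2"
    and "continuous_on UNIV V1" and "continuous_on UNIV V2"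
    and "\<mu> > 0"
    and "(INF x. ereal (V1 x)) = ereal \<mu>" and "(INF x. ereal (V2 x)) = ereal \<mu>"
    and "Liminf at_infinity (\<lambda>x. ereal (V1 x)) > ereal \<mu>"
    and "Liminf at_infinity (\<lambda>x. ereal (V2 x)) > ereal \<mu>"
    and "{x. V1 x = \<mu> \<and> V2 x = \<mu>} \<noteq> {}"
  shows "\<exists>\<epsilon>0>0. \<forall>\<epsilon>. 0 < \<epsilon> \<and> \<epsilon> < \<epsilon>0 \<longrightarrow>
           (\<exists>u1 u2. ground_state \<epsilon> V1 V2 a1 a2 \<beta> (u1, u2) \<and>
                    (\<forall>x. u1 x \<ge> 0) \<and> (\<forall>x. u2 x \<ge> 0))"
proof -
  note N = assms(1) and \<mu> = assms(7)
  have c: "0 \<le> a1" "0 \<le> a2" "0 \<le> \<beta>" using assms(2-4) by auto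
  have V\<mu>: "\<mu> \<le> V1 x" "\<mu> \<le> V2 x" for x
    using INF_lower[of x UNIV "\<lambda>x. ereal (V1 x)"] INF_lower[of x UNIV "\<lambda>x. ereal (V2 x)"] assms(8,9) by simp_all
  have V0: "0 \<le> V1 x" "0 \<le> V2 x" for x using V\<mu>[of x] \<mu> by auto
  have Vm: "V1 \<in> borel_measurable borel" "V2 \<in> borel_measurable borel"
    using assms(5,6) by (auto intro: borel_measurable_continuous_onI)
  obtain x0 where x0: "V1 x0 = \<mu>" "V2 x0 = \<mu>" using assms(12) by auto
  obtain m1 R1 where m1: "\<mu> < m1" "\<And>x. R1 \<le> norm x \<Longrightarrow> m1 \<le> V1 x" using Liminf_at_infinity_gt[OF assms(10)] by metis
  obtain m2 R2 where m2: "\<mu> < m2" "\<And>x. R2 \<le> norm x \<Longrightarrow> m2 \<le> V2 x" using Liminf_at_infinity_gt[OF assms(11)] by metis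
  \<comment> \<open>One constant for both potentials, since a single dilation is applied to both
    components of the trial pair.\<close>
  define m where "m = min m1 m2"
  define R where "R = max R1 R2"
  have m: "\<mu> < m" using m1 m2 by (simp add: m_def)
  have m0: "0 < m" using m \<mu> by simp
  have out: "m \<le> V1 x" "m \<le> V2 x" if "R \<le> norm x" for x
    using m1(2)[of x] m2(2)[of x] that by (auto simp: m_def R_def)
  obtain \<sigma> where \<sigma>: "\<sigma> > 0"
    and ub: "\<And>u1 u2 :: real^'n \<Rightarrow> real. H1 u1 \<Longrightarrow> H1 u2 \<Longrightarrow> Bfun a1 a2 \<beta> (u1, u2) \<le> \<sigma> * (cnorm 1 m u1 u2)^2"
    and near: "\<And>\<kappa>. 0 \<le> \<kappa> \<Longrightarrow> \<kappa> < 1 \<Longrightarrow> \<exists>w1 w2 :: real^'n \<Rightarrow> real. \<exists>R. H1 w1 \<and> H1 w2 \<and> R > 0 \<and>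
      (\<forall>x. R \<le> norm x \<longrightarrow> w1 x = 0 \<and> w2 x = 0) \<and> \<kappa> * \<sigma> * (cnorm 1 m w1 w2)^2 < Bfun a1 a2 \<beta> (w1, w2)"
    by (rule const_potential_sup[OF N assms(2) c(2,3) m0]) blast
  obtain \<epsilon>0 where \<epsilon>0: "\<epsilon>0 > 0" and lev: "\<And>\<epsilon>. 0 < \<epsilon> \<Longrightarrow> \<epsilon> < \<epsilon>0 \<Longrightarrow> \<exists>z1 z2. XV V1 z1 \<and> XV V2 z2 \<and>
    \<sigma> / \<epsilon> ^ CARD('n) * (ebil \<epsilon> V1 z1 z1 + ebil \<epsilon> V2 z2 z2)^2 < Bfun a1 a2 \<beta> (z1, z2)"
    using concentration_level[OF N assms(5,6) V0 x0 \<mu> m \<sigma> near] by blast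
  have "\<exists>u1 u2. ground_state \<epsilon> V1 V2 a1 a2 \<beta> (u1, u2) \<and> (\<forall>x. u1 x \<ge> 0) \<and> (\<forall>x. u2 x \<ge> 0)"
    if e: "0 < \<epsilon>" "\<epsilon> < \<epsilon>0" for \<epsilon>
  proof -
    obtain y1 y2 where y: "XV V1 y1" "XV V2 y2"
      "\<sigma> / \<epsilon> ^ CARD('n) * (ebil \<epsilon> V1 y1 y1 + ebil \<epsilon> V2 y2 y2)^2 < Bfun a1 a2 \<beta> (y1, y2)"
      using lev[OF e] by blast
    have \<tau>: "0 \<le> \<sigma> / \<epsilon> ^ CARD('n)" using \<sigma> e by simp
    have ub': "Bfun a1 a2 \<beta> (u1, u2) \<le> \<sigma> / \<epsilon> ^ CARD('n) * (cnorm \<epsilon> m u1 u2)^2" if "H1 u1" "H1 u2" for u1 u2 :: "real^'n \<Rightarrow> real"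
      using \<sigma> m0 by (intro const_potential_scaled ub e that) auto
    obtain z1 z2 where z: "XV V1 z1" "XV V2 z2" and Qz: "ebil \<epsilon> V1 z1 z1 + ebil \<epsilon> V2 z2 z2 = 1"
      and Bp: "0 < Bfun a1 a2 \<beta> (z1, z2)"
      and mx: "\<And>v1 v2. XV V1 v1 \<Longrightarrow> XV V2 v2 \<Longrightarrow> Bfun a1 a2 \<beta> (v1, v2) \<le> Bfun a1 a2 \<beta> (z1, z2) * (ebil \<epsilon> V1 v1 v1 + ebil \<epsilon> V2 v2 v2)^2"
      using nehari_quotient_maximiser[OF N c Vm V\<mu> \<mu> e(1) m0 out \<tau> ub' y] by blast
    define S where "S = Bfun a1 a2 \<beta> (z1, z2)"
    have S: "0 < S" using Bp by (simp add: S_def)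
    \<comment> \<open>The multiple that carries a maximiser on the unit sphere to the Nehari set: Q
      becomes a^2 = 1/S and B becomes a^4 S = 1/S.\<close>
    define a where "a = 1 / sqrt S"
    have a2: "a^2 = 1 / S" and a0: "0 \<le> a" using S by (simp_all add: a_def power_divide)
    define p1 where "p1 x = \<bar>z1 x\<bar>" for x
    define p2 where "p2 x = \<bar>z2 x\<bar>" for x
    have p: "XV V1 p1" "XV V2 p2" unfolding p1_def[abs_def] p2_def[abs_def] by (intro XV_abs z)+
    define q where "q = ebil \<epsilon> V1 p1 p1 + ebil \<epsilon> V2 p2 p2"
    have q1: "q \<le> 1"
      using XV_abs(2)[OF z(1), of \<epsilon>] XV_abs(2)[OF z(2), of \<epsilon>] Qz unfolding q_def p1_def[abs_def] p2_def[abs_def] by linarith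
    have Bp: "Bfun a1 a2 \<beta> (p1, p2) = S" unfolding p1_def[abs_def] p2_def[abs_def] Bfun_abs S_def ..
    have q0: "0 \<le> q" unfolding q_def by (intro add_nonneg_nonneg ebil_nonneg)
    \<comment> \<open>Absolute values leave B unchanged and do not increase Q, so maximality forces
      Q to remain 1: the pair of absolute values is again a maximiser.\<close>
    have "S \<le> S * q^2" using mx[OF p] unfolding Bp S_def[symmetric] q_def .
    then have "1 \<le> q^2" using S by simp
    then have q: "q = 1" using q0 q1 by (smt (verit) power_le_one power2_eq_1_iff)
    have u: "XV V1 (\<lambda>x. a * p1 x)" "XV V2 (\<lambda>x. a * p2 x)"
      using XV_lin[OF p(1) p(1) V0(1) Vm(1), of a 0] XV_lin[OF p(2) p(2) V0(2) Vm(2), of a 0] by simp_all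
    have "ebil \<epsilon> V1 (\<lambda>x. a * p1 x) (\<lambda>x. a * p1 x) + ebil \<epsilon> V2 (\<lambda>x. a * p2 x) (\<lambda>x. a * p2 x) = a^2 * q"
      using ebil_lin_sq[OF p(1) p(1) V0(1) Vm(1), of \<epsilon> a 0] ebil_lin_sq[OF p(2) p(2) V0(2) Vm(2), of \<epsilon> a 0]
      by (simp add: q_def distrib_left)
    then have Qu: "ebil \<epsilon> V1 (\<lambda>x. a * p1 x) (\<lambda>x. a * p1 x) + ebil \<epsilon> V2 (\<lambda>x. a * p2 x) (\<lambda>x. a * p2 x) = 1 / S"
      using q a2 by simp
    have "Bfun a1 a2 \<beta> (\<lambda>x. a * p1 x, \<lambda>x. a * p2 x) = (a^2)^2 * S" unfolding Bfun_scale Bp by (simp flip: power_mult)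
    then have Bu: "Bfun a1 a2 \<beta> (\<lambda>x. a * p1 x, \<lambda>x. a * p2 x) = 1 / S" unfolding a2 using S by (simp add: power2_eq_square)
    have "ground_state \<epsilon> V1 V2 a1 a2 \<beta> (\<lambda>x. a * p1 x, \<lambda>x. a * p2 x)"
      by (rule maximiser_ground_state[OF N Vm V\<mu> \<mu> S u Qu Bu]) (use mx in \<open>simp add: S_def\<close>)
    moreover have "\<forall>x. a * p1 x \<ge> 0" "\<forall>x. a * p2 x \<ge> 0" using a0 by (simp_all add: p1_def p2_def)
    ultimately show ?thesis by blast
  qed
  then show ?thesis using \<epsilon>0 by blast
qed

end
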